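(* A stationary IDp process $\{X_n\}_{n\in\mathbb{Z}}$ with L\'evy measure $Q$ is a generalized moving average with an infinitely divisible generator if and only if its L\'evy measure is dissipative, i.e. if and only if $(\mathbb{R}^{\mathbb{Z}},\mathcal{B}^{\otimes\mathbb{Z}},Q,T)$ is dissipative.
   Context: $T$ is the shift on $\mathbb{R}^{\mathbb{Z}}$, $T\{x_i\}=\{x_{i+1}\}$, and $\mathcal{B}$ the Borel $\sigma$-algebra of $\mathbb{R}$. A distribution $\mathbb{P}$ on $(\mathbb{R}^{\mathbb{Z}},\mathcal{B}^{\otimes\mathbb{Z}})$ (or a process with this distribution, not necessarily stationary) is infinitely divisible (ID) if for every integer $k\ge1$ it is the distribution of the sum of $k$ i.i.d. processes. Let $\mathfrak{A}\subset\mathbb{R}^{\mathbb{Z}}$ be the set of sequences with finitely many nonzero coordinates. A stationary IDp process (ID, without Gaussian part) of L\'evy measure $Q$ is a stationary process $X$ with $$\mathbb{E}[\exp i\langle a,X\rangle]=\exp\int_{\mathbb{R}^{\mathbb{Z}}}(e^{i\langle a,x\rangle}-1-i\langle c(x),a\rangle)\,Q(dx),\qquad a\in\mathfrak{A}$$ (the drift is taken to be $0$ by convention), where $c(x)_i=-1$ if $x_i<-1$, $c(x)_i=x_i$ if $-1\le x_i\le1$, $c(x)_i=1$ if $x_i>1$, and $Q$ is a $\sigma$-finite shift-invariant measure with $Q\{0\}=0$ ($0$ the zero sequence) and $\int(x_0^2\wedge1)\,Q(dx)<\infty$. A stationary process $\{X_n\}_{n\in\mathbb{Z}}$ is a generalized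 moving average if there is an i.i.d. collection of processes $\{\{\xi_k^n\}_{k\in\mathbb{Z}}\}_{n\in\mathbb{Z}}$ (for each $n$, $\{\xi^n_k\}_{k\in\mathbb{Z}}$ is a process, and these processes are i.i.d. in $n$) such that, in distribution, $$\{X_n\}_{n\in\mathbb{Z}}=\Big\{\sum_{k\in\mathbb{Z}}\xi_k^{n-k}\Big\}_{n\in\mathbb{Z}}.$$ The process $\{\xi^0_k\}_{k\in\mathbb{Z}}$ is then called a generator of $\{X_n\}_{n\in\mathbb{Z}}$. A measure-preserving system $(\Omega,\mathcal{F},\mu,T)$ is dissipative if, up to a $\mu$-null set, $\Omega$ is the measurable union of all wandering sets, a set $A$ being wandering if the sets $T^{-n}A$, $n\in\mathbb{Z}$, are disjoint. *)

theory Defs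
  imports "HOL-Probability.Probability"
begin

section \<open>The space of two-sided real sequences\<close>

text \<open>Processes indexed by the integers are random elements of this space; the law of such a
  process \<open>X\<close> on a probability space \<open>M\<close> is \<open>distr M seq_space X\<close>.\<close>

abbreviation seq_space :: "(int \<Rightarrow> real) measure" where
  "seq_space \<equiv> PiM (UNIV :: int set) (\<lambda>_. borel)"

definition shift :: "(int \<Rightarrow> real) \<Rightarrow> int \<Rightarrow> real" where
  "shift x = (\<lambda>i. x (i + 1))"

definition measure_preserving :: "'a measure \<Rightarrow> ('a \<Rightarrow> 'a) \<Rightarrow> bool" where
  "measure_preserving M T \<longleftrightarrow> T \<in> measurable M M \<and> distr M M T = M"

definition stationary_process :: "'a measure \<Rightarrow> ('a \<Rightarrow> int \<Rightarrow> real) \<Rightarrow> bool" where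
  "stationary_process M X \<longleftrightarrow>
     prob_space M \<and> X \<in> measurable M seq_space \<and>
     measure_preserving (distr M seq_space X) shift"


section \<open>Infinite divisibility\<close>

definition iid_processes :: "'a measure \<Rightarrow> 'i set \<Rightarrow> ('i \<Rightarrow> 'a \<Rightarrow> int \<Rightarrow> real) \<Rightarrow> bool" where
  "iid_processes M I Y \<longleftrightarrow>
     prob_space M \<and> prob_space.indep_vars M (\<lambda>_. seq_space) Y I \<and>
     (\<forall>i\<in>I. \<forall>j\<in>I. distr M seq_space (Y i) = distr M seq_space (Y j))"

text \<open>Type quantification is impossible inside a formula, so the existential quantifiers over
  probability spaces here and in \<open>is_gma_generator\<close> range over one type, which is large
  enough to carry the canonical product space.  The lemmas \<open>infinitely_divisibleI\<close> and
  \<open>is_gma_generatorI\<close> show that this is no restriction.\<close>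

definition infinitely_divisible :: "(int \<Rightarrow> real) measure \<Rightarrow> bool" where
  "infinitely_divisible P \<longleftrightarrow>
     (\<forall>k::nat. k \<ge> 1 \<longrightarrow>
       (\<exists>(M :: (nat \<Rightarrow> int \<Rightarrow> real) measure) Y.
          iid_processes M {..<k} Y \<and> distr M seq_space (\<lambda>\<omega> n. \<Sum>j<k. Y j \<omega> n) = P))"


section \<open>Stationary infinitely divisible processes without Gaussian part\<close>

definition finitely_supported :: "(int \<Rightarrow> real) set" where
  "finitely_supported = {a. finite {i. a i \<noteq> 0}}"

definition pairing :: "(int \<Rightarrow> real) \<Rightarrow> (int \<Rightarrow> real) \<Rightarrow> real" where
  "pairing a x = (\<Sum>i | a i \<noteq> 0. a i * x i)"

definition trunc :: "(int \<Rightarrow> real) \<Rightarrow> int \<Rightarrow> real" where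
  "trunc x i = (if x i < -1 then -1 else if x i \<le> 1 then x i else 1)"

definition stationary_Levy_measure :: "(int \<Rightarrow> real) measure \<Rightarrow> bool" where
  "stationary_Levy_measure Q \<longleftrightarrow>
     sets Q = sets seq_space \<and> sigma_finite_measure Q \<and> measure_preserving Q shift \<and>
     emeasure Q {\<lambda>_. 0} = 0 \<and>
     (\<integral>\<^sup>+ x. ennreal (min ((x 0)\<^sup>2) 1) \<partial>Q) < \<infinity>"

definition stationary_IDp_process ::
    "'a measure \<Rightarrow> ('a \<Rightarrow> int \<Rightarrow> real) \<Rightarrow> (int \<Rightarrow> real) measure \<Rightarrow> bool" where
  "stationary_IDp_process M X Q \<longleftrightarrow>
     stationary_process M X \<and> stationary_Levy_measure Q \<and>
     (\<forall>a\<in>finitely_supported.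
        (\<integral>\<omega>. iexp (pairing a (X \<omega>)) \<partial>M) =
        exp (\<integral>x. (iexp (pairing a x) - 1 - \<i> * complex_of_real (pairing a (trunc x))) \<partial>Q))"


section \<open>Generalized moving averages\<close>

text \<open>A two-sided series is convergent if both of its one-sided halves are, equivalently if its
  partial sums over \<open>{-m..n}\<close> converge as \<open>m\<close> and \<open>n\<close> tend to infinity independently.
  Convergence need not be absolute.\<close>

definition bi_summable :: "(int \<Rightarrow> real) \<Rightarrow> bool" where
  "bi_summable f \<longleftrightarrow> summable (\<lambda>k. f (int k)) \<and> summable (\<lambda>k. f (- int k - 1))"

definition bi_suminf :: "(int \<Rightarrow> real) \<Rightarrow> real" where
  "bi_suminf f = (\<Sum>k. f (int k)) + (\<Sum>k. f (- int k - 1))"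

text \<open>\<open>\<xi> n \<omega> k\<close> is the coordinate at time \<open>k\<close> of the process with index \<open>n\<close>, that is,
  superscript \<open>n\<close> and subscript \<open>k\<close>.  The series are required to converge almost surely.\<close>

definition gma_representation ::
    "'a measure \<Rightarrow> (int \<Rightarrow> 'a \<Rightarrow> int \<Rightarrow> real) \<Rightarrow> (int \<Rightarrow> real) measure \<Rightarrow> bool" where
  "gma_representation M \<xi> P \<longleftrightarrow>
     iid_processes M UNIV \<xi> \<and>
     (\<forall>n. AE \<omega> in M. bi_summable (\<lambda>k. \<xi> (n - k) \<omega> k)) \<and>
     P = distr M seq_space (\<lambda>\<omega> n. bi_suminf (\<lambda>k. \<xi> (n - k) \<omega> k))"

definition is_gma_generator :: "(int \<Rightarrow> real) measure \<Rightarrow> (int \<Rightarrow> real) measure \<Rightarrow> bool" where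
  "is_gma_generator G P \<longleftrightarrow>
     (\<exists>(M :: (int \<Rightarrow> int \<Rightarrow> real) measure) \<xi>.
        gma_representation M \<xi> P \<and> distr M seq_space (\<xi> 0) = G)"

definition gma_with_ID_generator :: "'a measure \<Rightarrow> ('a \<Rightarrow> int \<Rightarrow> real) \<Rightarrow> bool" where
  "gma_with_ID_generator M X \<longleftrightarrow>
     stationary_process M X \<and>
     (\<exists>G. is_gma_generator G (distr M seq_space X) \<and> infinitely_divisible G)"


section \<open>Dissipative systems\<close>

text \<open>\<open>translate T A n\<close> is the set \<open>T\<^sup>-\<^sup>n A\<close>: a preimage for nonnegative \<open>n\<close>, an image for
  negative \<open>n\<close>.\<close>

definition translate :: "'a measure \<Rightarrow> ('a \<Rightarrow> 'a) \<Rightarrow> 'a set \<Rightarrow> int \<Rightarrow> 'a set" where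
  "translate M T A n =
     (if n \<ge> 0 then (T ^^ nat n) -` A \<inter> space M else (T ^^ nat (- n)) ` A)"

definition wandering :: "'a measure \<Rightarrow> ('a \<Rightarrow> 'a) \<Rightarrow> 'a set \<Rightarrow> bool" where
  "wandering M T A \<longleftrightarrow> A \<in> sets M \<and> disjoint_family (translate M T A)"

text \<open>The measurable (or essential) union of a possibly uncountable family is its least upper
  bound in the measure algebra; it is determined up to null sets.\<close>

definition is_measurable_union :: "'a measure \<Rightarrow> 'a set set \<Rightarrow> 'a set \<Rightarrow> bool" where
  "is_measurable_union M \<A> D \<longleftrightarrow>
     D \<in> sets M \<and> (\<forall>A\<in>\<A>. A - D \<in> null_sets M) \<and>
     (\<forall>E\<in>sets M. (\<forall>A\<in>\<A>. A - E \<in> null_sets M) \<longrightarrow> D - E \<in> null_sets M)"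

definition dissipative :: "'a measure \<Rightarrow> ('a \<Rightarrow> 'a) \<Rightarrow> bool" where
  "dissipative M T \<longleftrightarrow>
     measure_preserving M T \<and>
     (\<exists>D. is_measurable_union M {A. wandering M T A} D \<and> space M - D \<in> null_sets M)"


section \<open>Independence of the choice of the underlying probability space\<close>

lemma iid_processes_canonical:
  fixes M :: "'a measure" and Y :: "'i \<Rightarrow> 'a \<Rightarrow> int \<Rightarrow> real"
  assumes iid: "iid_processes M I Y" and i0: "i0 \<in> I"
  defines "G \<equiv> distr M seq_space (Y i0)"
  shows "distr M (PiM I (\<lambda>_. seq_space)) (\<lambda>\<omega>. \<lambda>i\<in>I. Y i \<omega>) = PiM I (\<lambda>_. G)"
    and "prob_space G"
    and "iid_processes (PiM I (\<lambda>_. G)) I (\<lambda>i \<omega>. \<omega> i)"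
proof -
  interpret prob_space M using iid by (simp add: iid_processes_def)
  have ind: "indep_vars (\<lambda>_. seq_space) Y I" using iid by (simp add: iid_processes_def)
  hence rv: "\<And>i. i \<in> I \<Longrightarrow> Y i \<in> measurable M seq_space" by (simp add: indep_vars_def)
  have eqG: "\<And>i. i \<in> I \<Longrightarrow> distr M seq_space (Y i) = G"
    using iid i0 unfolding iid_processes_def G_def by blast
  have "distr M (PiM I (\<lambda>_. seq_space)) (\<lambda>\<omega>. \<lambda>i\<in>I. Y i \<omega>)
      = PiM I (\<lambda>i. distr M seq_space (Y i))"
    using indep_vars_iff_distr_eq_PiM'[where I = I and M' = "\<lambda>_. seq_space" and X = Y] ind rv i0 by auto
  also have "\<dots> = PiM I (\<lambda>_. G)" by (intro PiM_cong) (auto simp: eqG)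
  finally show "distr M (PiM I (\<lambda>_. seq_space)) (\<lambda>\<omega>. \<lambda>i\<in>I. Y i \<omega>) = PiM I (\<lambda>_. G)" .
  show pG: "prob_space G" unfolding G_def by (rule prob_space_distr[OF rv[OF i0]])
  have sG: "sets G = sets seq_space" by (simp add: G_def)
  interpret N: product_prob_space "\<lambda>_. G" I
    by (simp add: product_prob_space_def product_prob_space_axioms_def
        product_sigma_finite_def pG prob_space_imp_sigma_finite)
  have pN: "prob_space (PiM I (\<lambda>_. G))" by (rule prob_space_PiM) (rule pG)
  have comp: "(\<lambda>\<omega>. \<omega> i) \<in> measurable (PiM I (\<lambda>_. G)) seq_space" if "i \<in> I" for i
    using measurable_component_singleton[of i I "\<lambda>_. G"] that measurable_cong_sets[OF refl sG] by blast
  have dcomp: "distr (PiM I (\<lambda>_. G)) seq_space (\<lambda>\<omega>. \<omega> i) = G" if "i \<in> I" for i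
    using N.PiM_component[OF that] distr_cong[OF refl sG[symmetric], of "PiM I (\<lambda>_. G)" "\<lambda>\<omega>. \<omega> i" "\<lambda>\<omega>. \<omega> i"] by simp
  have "distr (PiM I (\<lambda>_. G)) (PiM I (\<lambda>_. seq_space)) (\<lambda>\<omega>. \<lambda>i\<in>I. \<omega> i)
      = distr (PiM I (\<lambda>_. G)) (PiM I (\<lambda>_. G)) (\<lambda>\<omega>. \<omega>)"
    by (intro distr_cong sets_PiM_cong) (auto simp: sG space_PiM PiE_def extensional_restrict)
  also have "\<dots> = PiM I (\<lambda>_. G)" by (rule distr_id)
  also have "\<dots> = PiM I (\<lambda>i. distr (PiM I (\<lambda>_. G)) seq_space (\<lambda>\<omega>. \<omega> i))"
    by (intro PiM_cong) (auto simp: dcomp)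
  finally have "prob_space.indep_vars (PiM I (\<lambda>_. G)) (\<lambda>_. seq_space) (\<lambda>i \<omega>. \<omega> i) I"
    using prob_space.indep_vars_iff_distr_eq_PiM'[OF pN, where I = I and M' = "\<lambda>_. seq_space" and X = "\<lambda>i \<omega>. \<omega> i"] comp i0 by auto
  thus "iid_processes (PiM I (\<lambda>_. G)) I (\<lambda>i \<omega>. \<omega> i)"
    using pN by (simp add: iid_processes_def dcomp)
qed

lemma infinitely_divisibleI:
  fixes M :: "nat \<Rightarrow> 'a measure"
  assumes "\<And>k. k \<ge> 1 \<Longrightarrow> iid_processes (M k) {..<k} (Y k)"
    and "\<And>k. k \<ge> 1 \<Longrightarrow> distr (M k) seq_space (\<lambda>\<omega> n. \<Sum>j<k. Y k j \<omega> n) = P"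
  shows "infinitely_divisible P"
  unfolding infinitely_divisible_def
proof (intro allI impI)
  fix k :: nat assume k: "1 \<le> k"
  hence k0: "0 \<in> {..<k}" by auto
  define G where "G = distr (M k) seq_space (Y k 0)"
  let ?N = "PiM {..<k} (\<lambda>_. G)"
  note c = iid_processes_canonical[OF assms(1)[OF k] k0, folded G_def]
  interpret prob_space "M k" using assms(1)[OF k] by (simp add: iid_processes_def)
  have rv: "\<And>i. i \<in> {..<k} \<Longrightarrow> Y k i \<in> measurable (M k) seq_space"
    using assms(1)[OF k] by (simp add: iid_processes_def indep_vars_def)
  have m: "(\<lambda>\<omega>. \<lambda>i\<in>{..<k}. Y k i \<omega>) \<in> measurable (M k) (PiM {..<k} (\<lambda>_. seq_space))"
    by (intro measurable_restrict rv)
  have s: "(\<lambda>\<omega> n. \<Sum>j<k. \<omega> j n) \<in> measurable (PiM {..<k} (\<lambda>_. seq_space)) seq_space"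
    by (rule measurable_PiM_single') 
      (auto intro!: borel_measurable_sum measurable_compose[OF measurable_component_singleton] simp: PiE_def)
  have "distr ?N seq_space (\<lambda>\<omega> n. \<Sum>j<k. \<omega> j n)
     = distr (M k) seq_space ((\<lambda>\<omega> n. \<Sum>j<k. \<omega> j n) \<circ> (\<lambda>\<omega>. \<lambda>i\<in>{..<k}. Y k i \<omega>))"
    unfolding c(1)[symmetric] by (rule distr_distr[OF s m])
  also have "\<dots> = P" using assms(2)[OF k] by (simp add: o_def)
  finally show "\<exists>(M :: (nat \<Rightarrow> int \<Rightarrow> real) measure) Y. iid_processes M {..<k} Y \<and>
      distr M seq_space (\<lambda>\<omega> n. \<Sum>j<k. Y j \<omega> n) = P"
    using c(3) by blast
qed

lemma is_gma_generatorI: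
  fixes M :: "'a measure"
  assumes rep: "gma_representation M \<xi> P"
  shows "is_gma_generator (distr M seq_space (\<xi> 0)) P"
proof -
  define G where "G = distr M seq_space (\<xi> 0)"
  let ?S = "PiM (UNIV :: int set) (\<lambda>_. seq_space)"
  let ?N = "PiM (UNIV :: int set) (\<lambda>_. G)"
  let ?h = "\<lambda>\<omega> i. \<xi> i \<omega>"
  have iid: "iid_processes M UNIV \<xi>" using rep by (simp add: gma_representation_def)
  note c = iid_processes_canonical[OF iid UNIV_I[of 0], folded G_def, unfolded restrict_UNIV]
  interpret prob_space M using iid by (simp add: iid_processes_def)
  have rv: "\<And>i. \<xi> i \<in> measurable M seq_space"
    using iid by (simp add: iid_processes_def indep_vars_def)
  have m: "?h \<in> measurable M ?S"
    by (rule measurable_PiM_single') (auto intro!: rv simp: PiE_def space_PiM)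
  have co: "(\<lambda>\<omega>. \<omega> i k) \<in> borel_measurable ?S" for i k :: int
    by (rule measurable_compose[where N = seq_space and f = "\<lambda>\<omega>. \<omega> i" and g = "\<lambda>x. x k"])
      (rule measurable_component_singleton, simp)+
  have s: "(\<lambda>\<omega> n. bi_suminf (\<lambda>k. \<omega> (n - k) k)) \<in> measurable ?S seq_space"
    unfolding bi_suminf_def
    by (rule measurable_PiM_single')
      (auto intro!: borel_measurable_add borel_measurable_suminf co simp: PiE_def)
  have ms: "{\<omega> \<in> space ?S. bi_summable (\<lambda>k. \<omega> (n - k) k)} \<in> sets ?S" for n
    unfolding bi_summable_def summable_iff_convergent Cauchy_convergent_iff[symmetric]
    by (intro sets.sets_Collect_conj sets_Collect_Cauchy borel_measurable_sum co)
  have ae: "AE \<omega> in ?N. bi_summable (\<lambda>k. \<omega> (n - k) k)" for n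
    unfolding c(1)[symmetric] using rep AE_distr_iff[OF m ms[of n]]
    by (simp add: gma_representation_def)
  have "distr ?N seq_space (\<lambda>\<omega> n. bi_suminf (\<lambda>k. \<omega> (n - k) k)) = P"
    using rep distr_distr[OF s m] unfolding c(1)[symmetric]
    by (simp add: gma_representation_def o_def)
  hence "gma_representation ?N (\<lambda>i \<omega>. \<omega> i) P"
    using ae c(3) by (simp add: gma_representation_def)
  moreover have "distr ?N seq_space (\<lambda>\<omega>. \<omega> 0) = G"
  proof -
    have "(\<lambda>\<omega>. \<omega> 0) \<in> measurable ?S seq_space" by (rule measurable_component_singleton) simp
    from distr_distr[OF this m] show ?thesis
      unfolding c(1)[symmetric] by (simp add: o_def G_def)
  qed
  ultimately show ?thesis unfolding is_gma_generator_def G_def[symmetric] by blast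
qed

end

theory Submission
  imports Defs
begin

text \<open>Writing \<open>T\<close> for the shift, dissipativity of \<open>Q\<close> amounts to the existence of a section: a
  measurable \<open>W\<close> whose translates \<open>T\<^sup>-\<^sup>n W\<close> are disjoint and cover almost everything.  If
  \<open>r \<ge> 0\<close> tends to \<open>0\<close> along almost every orbit without vanishing on it, the points at which \<open>r\<close> first
  attains its maximum along the orbit form a section.

  If \<open>Q\<close> is dissipative, \<open>r x = min (x\<^sub>0\<^sup>2) 1\<close> qualifies: it is integrable, so it is summable along
  the orbits that meet a wandering set.  The generator is then the infinitely divisible process with
  Levy measure \<open>Q\<close> restricted to \<open>W\<close>; since the Levy exponents add up over the translates of \<open>W\<close>,
  the moving average converges and has the law of \<open>X\<close>.

  Conversely, let \<open>g\<close> be the characteristic functional of an infinitely divisible generator.  As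
  \<open>|g|\<close> to the power \<open>2/k\<close> is again a characteristic functional for every \<open>k\<close>, the functional
  \<open>\<Sum> c\<^sub>a cos \<langle>a, x\<rangle> \<mapsto> \<Sum> c\<^sub>a ln |g(a)|\<close> is nonnegative on nonnegative cosine polynomials \<open>p\<close>
  with \<open>p(0) = 0\<close>, and its translates sum up to \<open>\<integral> p dQ\<close>.  Applied to
  \<open>p x = (1 - cos (s x\<^sub>0)) (1 - \<Prod>\<^sub>n (1 - \<theta> (1 - cos (s x\<^sub>n))))\<close>, whose translates are
  \<open>O(\<theta>)\<close> and have uniformly small tails, this shows \<open>\<Sum>\<^sub>n (1 - cos (s x\<^sub>n)) < \<infinity>\<close> almost
  everywhere.  Two scales \<open>s\<close> with irrational ratio yield a function \<open>r\<close> as above.\<close>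

section \<open>Characteristic functionals of laws on the sequence space\<close>

text \<open>The converse uses no Levy-Khintchine representation of the generator. The modulus
  removes the drift and the choice of a branch of the logarithm; what remains is positivity, which
  controls a cosine polynomial only by pointwise comparison with others. The test polynomial is made
  for two comparisons. It is at most \<open>1 - cos (s * x 0)\<close>, whose values under the
  translated functionals are nonnegative with finite sum, so far translates contribute little. It is
  also at most \<open>2 * \<theta>\<close> times the sum of the \<open>1 - cos (s * x n)\<close>,
  which makes each single translate O(\<theta>), however many factors the product has. Where that
  sum diverges, the product tends to 0 for every \<theta>, so the polynomial increases to
  \<open>1 - cos (s * x 0)\<close>. Sending the number of factors to infinity, then \<theta> to 0,
  then the cut between near and far translates to infinity, shows that
  \<open>1 - cos (s * x 0)\<close> vanishes almost everywhere on the set of divergence. That set is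
  invariant, so every term vanishes there, which contradicts divergence.\<close>

lemma pairing_eq_sum:
  assumes "finite F" "{i. a i \<noteq> 0} \<subseteq> F"
  shows "pairing a x = (\<Sum>i\<in>F. a i * x i)"
  unfolding pairing_def using assms by (intro sum.mono_neutral_left) auto

lemma finitely_supported_lin:
  assumes "a \<in> finitely_supported" "b \<in> finitely_supported"
  shows "(\<lambda>i. s * a i + t * b i) \<in> finitely_supported"
proof -
  have "{i. s * a i + t * b i \<noteq> 0} \<subseteq> {i. a i \<noteq> 0} \<union> {i. b i \<noteq> 0}" by auto
  thus ?thesis using assms by (auto simp: finitely_supported_def intro: finite_subset)
qed

lemma pairing_lin:
  assumes "a \<in> finitely_supported" "b \<in> finitely_supported"
  shows "pairing (\<lambda>i. s * a i + t * b i) x = s * pairing a x + t * pairing b x"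
proof -
  let ?F = "{i. a i \<noteq> 0} \<union> {i. b i \<noteq> 0}"
  have f: "finite ?F" using assms by (auto simp: finitely_supported_def)
  have "pairing (\<lambda>i. s * a i + t * b i) x = (\<Sum>i\<in>?F. (s * a i + t * b i) * x i)"
    by (rule pairing_eq_sum[OF f]) auto
  also have "\<dots> = s * (\<Sum>i\<in>?F. a i * x i) + t * (\<Sum>i\<in>?F. b i * x i)"
    by (simp add: sum_distrib_left sum.distrib[symmetric] algebra_simps)
  also have "(\<Sum>i\<in>?F. a i * x i) = pairing a x" by (rule pairing_eq_sum[symmetric, OF f]) auto
  also have "(\<Sum>i\<in>?F. b i * x i) = pairing b x" by (rule pairing_eq_sum[symmetric, OF f]) auto
  finally show ?thesis .
qed

definition unit_seq :: "int \<Rightarrow> int \<Rightarrow> real" where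
  "unit_seq n = (\<lambda>i. of_bool (i = n))"

lemma unit_seq_finitely_supported [simp, intro]: "unit_seq n \<in> finitely_supported"
  by (simp add: unit_seq_def finitely_supported_def)

lemma zero_finitely_supported [simp, intro]: "(\<lambda>_. 0) \<in> finitely_supported"
  by (simp add: finitely_supported_def)

lemma pairing_unit_seq [simp]: "pairing (unit_seq n) x = x n"
  by (subst pairing_eq_sum[of "{n}"]) (auto simp: unit_seq_def)

lemma pairing_zero_left [simp]: "pairing (\<lambda>_. 0) x = 0"
  by (simp add: pairing_def)

lemma pairing_zero_right [simp]: "pairing a (\<lambda>_. 0) = 0"
  by (simp add: pairing_def)

lemma pairing_diff_right: "pairing a (\<lambda>i. x i - y i) = pairing a x - pairing a y"
  by (simp add: pairing_def algebra_simps sum_subtractf)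

lemma pairing_sum_right: "pairing a (\<lambda>i. \<Sum>j\<in>J. X j i) = (\<Sum>j\<in>J. pairing a (X j))"
  unfolding pairing_def by (simp add: sum_distrib_left) (rule sum.swap)

lemma pairing_scale_left:
  assumes "a \<in> finitely_supported"
  shows "pairing (\<lambda>i. s * a i) x = s * pairing a x"
  using pairing_lin[OF assms zero_finitely_supported, of s 0] by simp

lemma measurable_coord [measurable]: "(\<lambda>x. x i) \<in> borel_measurable seq_space"
  by (rule measurable_component_singleton) simp

lemma pairing_measurable [measurable]: "pairing a \<in> borel_measurable seq_space"
  unfolding pairing_def[abs_def] by measurable

lemma measurable_into_seq_space:
  assumes "\<And>i. (\<lambda>x. f x i) \<in> borel_measurable M"
  shows "f \<in> measurable M seq_space"
  by (rule measurable_PiM_single') (use assms in \<open>auto simp: space_PiM PiE_def\<close>)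

lemma space_seq_space [simp]: "space seq_space = UNIV"
  by (simp add: space_PiM)

text \<open>Weighted by \<open>w\<close> and normalised, both measures push forward under
  \<open>Y\<close> to probability laws on the line, where Levy's uniqueness theorem applies. Total
  mass 0 cannot be normalised and is treated apart.\<close>

lemma distr_weighted_unique:
  fixes Y :: "'a \<Rightarrow> real" and w :: "'a \<Rightarrow> real"
  assumes P: "finite_measure P" and P': "finite_measure P'" and sets: "sets P' = sets P"
    and Y: "Y \<in> borel_measurable P" and w: "w \<in> borel_measurable P"
    and nn: "\<And>x. 0 \<le> w x" and bd: "\<And>x. w x \<le> C"
    and eq: "\<And>t. (CLINT x|P. complex_of_real (w x) * iexp (t * Y x))
               = (CLINT x|P'. complex_of_real (w x) * iexp (t * Y x))"
    and B: "B \<in> sets borel"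
  shows "(LINT x|P. w x * indicator B (Y x)) = (LINT x|P'. w x * indicator B (Y x))"
proof -
  interpret P: finite_measure P by fact
  interpret P': finite_measure P' by fact
  have Y'[measurable]: "Y \<in> borel_measurable P'" "w \<in> borel_measurable P'"
    using Y w sets by (auto cong: measurable_cong_sets)
  note [measurable] = Y w B
  have int: "integrable P w" "integrable P' w"
    by (rule P.integrable_const_bound[of _ C] P'.integrable_const_bound[of _ C];
        use nn bd in \<open>auto simp: abs_of_nonneg\<close>)+
  define c where "c = (LINT x|P. w x)"
  \<comment> \<open>Frequency 0 of the hypothesis equates the total masses, so the same
    \<open>c\<close> normalises both laws.\<close>
  have "complex_of_real c = complex_of_real (LINT x|P'. w x)"
    using eq[of 0] by (simp add: c_def)
  hence c': "c = (LINT x|P'. w x)" using of_real_eq_iff by blast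
  have c0: "c \<ge> 0" unfolding c_def by (simp add: integral_nonneg_AE nn)
  show ?thesis
  proof (cases "c = 0")
    case True
    hence "AE x in P. w x = 0" using integral_nonneg_eq_0_iff_AE[OF int(1)] nn by (auto simp: c_def)
    moreover have "AE x in P'. w x = 0"
      using True c' integral_nonneg_eq_0_iff_AE[OF int(2)] nn by auto
    ultimately have "(LINT x|P. w x * indicator B (Y x)) = 0" "(LINT x|P'. w x * indicator B (Y x)) = 0"
      by (auto intro!: integral_eq_zero_AE)
    thus ?thesis by simp
  next
    case False
    hence cp: "c > 0" using c0 by simp
    define D where "D R = distr (density R (\<lambda>x. ennreal (w x / c))) borel Y" for R
    have key: "real_distribution (D R) \<and> (\<forall>t. char (D R) t = (CLINT x|R. complex_of_real (w x) * iexp (t * Y x)) / c)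
        \<and> measure (D R) B = (LINT x|R. w x * indicator B (Y x)) / c"
      if R: "finite_measure R" and [measurable]: "Y \<in> borel_measurable R" "w \<in> borel_measurable R"
        and iR: "integrable R w" and cR: "c = (LINT x|R. w x)" for R
    proof -
      interpret R: finite_measure R by fact
      have "emeasure (density R (\<lambda>x. ennreal (w x / c))) (space R) = (\<integral>\<^sup>+ x. ennreal (w x / c) \<partial>R)"
        by (subst emeasure_density) (auto intro!: nn_integral_cong)
      also have "\<dots> = ennreal (LINT x|R. w x / c)"
        by (rule nn_integral_eq_integral) (use iR nn cp in auto)
      also have "\<dots> = 1" using cR cp by simp
      finally have pr: "prob_space (density R (\<lambda>x. ennreal (w x / c)))"
        by (intro prob_spaceI) simp
      have rd: "real_distribution (D R)" unfolding D_def
        by (rule prob_space.real_distribution_distr[OF pr]) simp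
      have ch: "char (D R) t = (CLINT x|R. complex_of_real (w x) * iexp (t * Y x)) / c" for t
      proof -
        have "char (D R) t = (CLINT x|density R (\<lambda>x. ennreal (w x / c)). iexp (t * Y x))"
          unfolding char_def D_def by (subst integral_distr) auto
        also have "\<dots> = (CLINT x|R. (w x / c) *\<^sub>R iexp (t * Y x))"
          by (rule integral_density) (use nn cp in auto)
        also have "\<dots> = (CLINT x|R. complex_of_real (w x) * iexp (t * Y x) / c)"
          by (rule Bochner_Integration.integral_cong) (auto simp: scaleR_conv_of_real)
        also have "\<dots> = (CLINT x|R. complex_of_real (w x) * iexp (t * Y x)) / c" by simp
        finally show ?thesis .
      qed
      interpret D: real_distribution "D R" by (rule rd)
      have "measure (D R) B = (LINT x|D R. indicator B x)" by simp
      also have "\<dots> = (LINT x|density R (\<lambda>x. ennreal (w x / c)). indicator B (Y x))"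
        unfolding D_def by (subst integral_distr) auto
      also have "\<dots> = (LINT x|R. (w x / c) *\<^sub>R indicator B (Y x))"
        by (rule integral_density) (use nn cp in auto)
      also have "\<dots> = (LINT x|R. w x * indicator B (Y x)) / c" by simp
      finally show ?thesis using rd ch by blast
    qed
    note k1 = key[OF P Y w int(1) c_def] and k2 = key[OF P' Y' int(2) c']
    have "D P = D P'"
      by (rule Levy_uniqueness) (use k1 k2 eq in \<open>auto intro!: ext\<close>)
    thus ?thesis using k1 k2 cp by simp
  qed
qed

text \<open>Reduction to the one-dimensional uniqueness theorem: coordinates are replaced by indicator
  functions one at a time; the densities \<open>1 + cos (\<langle>a, x\<rangle> + \<theta>)\<close> keep the
  measures nonnegative while carrying the remaining frequencies.\<close>

lemma char_functional_unique:
  assumes P: "prob_space P" "sets P = sets seq_space"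
    and P': "prob_space P'" "sets P' = sets seq_space"
    and eq: "\<And>a. a \<in> finitely_supported \<Longrightarrow>
      (CLINT x|P. iexp (pairing a x)) = (CLINT x|P'. iexp (pairing a x))"
  shows "P = P'"
proof -
  interpret P: prob_space P by fact
  interpret P': prob_space P' by fact
  have sm: "borel_measurable P = borel_measurable seq_space"
           "borel_measurable P' = borel_measurable seq_space"
    by (rule measurable_cong_sets; simp add: P P')+
  \<comment> \<open>Indicators test the coordinates in \<open>J\<close> while the frequency
    \<open>a\<close> stays free. With \<open>J\<close> empty this is the hypothesis, with
    \<open>a = 0\<close> it gives the measures of cylinders. The induction keeps \<open>a\<close>
    arbitrary because each step calls on three other frequencies.\<close>
  have main: "(CLINT x|P. complex_of_real (\<Prod>j\<in>J. indicator (B j) (x j)) * iexp (pairing a x))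
      = (CLINT x|P'. complex_of_real (\<Prod>j\<in>J. indicator (B j) (x j)) * iexp (pairing a x))"
    if "finite J" "\<And>j. B j \<in> sets (borel :: real measure)" "a \<in> finitely_supported" for J B a
    using that(1,3)
  proof (induction J arbitrary: a)
    case empty
    thus ?case using eq by simp
  next
    case (insert j0 J)
    note Bm[measurable] = that(2)
    define \<pi> where "\<pi> x = (\<Prod>j\<in>J. indicator (B j) (x j) :: real)" for x :: "int \<Rightarrow> real"
    have [measurable]: "\<pi> \<in> borel_measurable seq_space" unfolding \<pi>_def[abs_def] by measurable
    have p0: "0 \<le> \<pi> x" and p1: "\<pi> x \<le> 1" for x
      unfolding \<pi>_def by (auto intro!: prod_nonneg prod_le_1 simp: indicator_def)
    note IH = insert.IH[folded \<pi>_def]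
    have int: "integrable P f" "integrable P' f" if "f \<in> borel_measurable seq_space" "\<And>x. norm (f x) \<le> C"
      for f :: "_ \<Rightarrow> 'c::{banach,second_countable_topology}" and C
      by (rule P.integrable_const_bound[of _ C] P'.integrable_const_bound[of _ C]; use that sm in \<open>auto simp: P P' cong: measurable_cong_sets\<close>)+
    have cis: "(LINT x|P. \<pi> x * (1 + cos (pairing b x + \<theta>)) * indicator (B j0) (x j0))
       = (LINT x|P'. \<pi> x * (1 + cos (pairing b x + \<theta>)) * indicator (B j0) (x j0))"
      if b: "b \<in> finitely_supported" for b \<theta>
    proof (rule distr_weighted_unique[where C = 2])
      show "(\<lambda>x. \<pi> x * (1 + cos (pairing b x + \<theta>))) \<in> borel_measurable P" unfolding sm by measurable
      show "(\<lambda>x. x j0) \<in> borel_measurable P" unfolding sm by measurable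
      show "0 \<le> \<pi> x * (1 + cos (pairing b x + \<theta>))" for x 
        using p0[of x] cos_ge_minus_one[of "pairing b x + \<theta>"] by (intro mult_nonneg_nonneg) linarith+
      show "\<pi> x * (1 + cos (pairing b x + \<theta>)) \<le> 2" for x 
        using mult_mono[OF p1[of x], of "1 + cos (pairing b x + \<theta>)" 2] p0[of x]
          cos_ge_minus_one[of "pairing b x + \<theta>"] cos_le_one[of "pairing b x + \<theta>"] by simp
      show "B j0 \<in> sets borel" by (rule Bm)
      show "finite_measure P" "finite_measure P'" by unfold_locales
      show "sets P' = sets P" by (simp add: P P')
      fix t
      define a0 where "a0 = (\<lambda>i. t * unit_seq j0 i)"
      define a1 where "a1 = (\<lambda>i. 1 * b i + t * unit_seq j0 i)"
      define a2 where "a2 = (\<lambda>i. (-1) * b i + t * unit_seq j0 i)"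
      have fs: "a0 \<in> finitely_supported" "a1 \<in> finitely_supported" "a2 \<in> finitely_supported"
        unfolding a0_def a1_def a2_def
        using finitely_supported_lin[OF b unit_seq_finitely_supported, of 0]
          finitely_supported_lin[OF b unit_seq_finitely_supported, of 1]
          finitely_supported_lin[OF b unit_seq_finitely_supported, of "-1"] by simp_all
      have pa: "pairing a0 x = t * x j0" "pairing a1 x = pairing b x + t * x j0" "pairing a2 x = t * x j0 - pairing b x" for x
        unfolding a0_def a1_def a2_def
        using pairing_lin[OF b unit_seq_finitely_supported, of 0 t j0 x] pairing_lin[OF b unit_seq_finitely_supported, of 1 t j0 x]
          pairing_lin[OF b unit_seq_finitely_supported, of "-1" t j0 x] by simp_all
      \<comment> \<open>Euler's formula splits the cosine in the weight, leaving the three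
        frequencies \<open>a0\<close>, \<open>a1\<close>, \<open>a2\<close>, all covered by the
        induction hypothesis.\<close>
      have pw: "complex_of_real (\<pi> x * (1 + cos (pairing b x + \<theta>))) * iexp (t * x j0)
        = \<pi> x * iexp (pairing a0 x) + (iexp \<theta> / 2 * (\<pi> x * iexp (pairing a1 x)) + iexp (-\<theta>) / 2 * (\<pi> x * iexp (pairing a2 x)))"
        (is "?l x = ?r x") for x
      proof -
        have ceq: "complex_of_real (cos u) = (iexp u + iexp (-u)) / 2" for u :: real
          using cos_exp_eq[of "complex_of_real u"] by (simp add: cos_of_real)
        have "?l x = \<pi> x * (1 + (iexp (pairing b x + \<theta>) + iexp (-(pairing b x + \<theta>))) / 2) * iexp (t * x j0)"
          by (simp only: of_real_mult of_real_add of_real_1 ceq)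
        also have "\<dots> = \<pi> x * iexp (t * x j0) + \<pi> x / 2 * (iexp (pairing b x + \<theta>) * iexp (t * x j0)) + \<pi> x / 2 * (iexp (-(pairing b x + \<theta>)) * iexp (t * x j0))"
          by (simp add: algebra_simps add_divide_distrib)
        also have "iexp (pairing b x + \<theta>) * iexp (t * x j0) = iexp \<theta> * iexp (pairing a1 x)"
          by (simp add: pa exp_add[symmetric] algebra_simps)
        also have "iexp (-(pairing b x + \<theta>)) * iexp (t * x j0) = iexp (-\<theta>) * iexp (pairing a2 x)"
          by (simp add: pa exp_add[symmetric] algebra_simps)
        finally show ?thesis by (simp add: pa algebra_simps)
      qed
      have ii: "integrable R (\<lambda>x. complex_of_real (\<pi> x) * iexp (pairing b x))" if "R = P \<or> R = P'" for R b
      proof -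
        have "norm (complex_of_real (\<pi> x) * iexp (pairing b x)) \<le> 1" for x
          using p0[of x] p1[of x] by (simp add: norm_mult)
        moreover have "(\<lambda>x. complex_of_real (\<pi> x) * iexp (pairing b x)) \<in> borel_measurable seq_space" by measurable
        ultimately show ?thesis using int that by blast
      qed
      have "(CLINT x|R. ?l x) = (CLINT x|R. \<pi> x * iexp (pairing a0 x)) + (iexp \<theta> / 2 * (CLINT x|R. \<pi> x * iexp (pairing a1 x)) + iexp (-\<theta>) / 2 * (CLINT x|R. \<pi> x * iexp (pairing a2 x)))"
        if "R = P \<or> R = P'" for R
        unfolding pw using ii[OF that] by simp
      thus "(CLINT x|P. ?l x) = (CLINT x|P'. ?l x)"
        using IH[OF fs(1)] IH[OF fs(2)] IH[OF fs(3)] by simp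
    qed
    have cs: "(LINT x|P. \<pi> x * cos (pairing a x + \<theta>) * indicator (B j0) (x j0))
       = (LINT x|P'. \<pi> x * cos (pairing a x + \<theta>) * indicator (B j0) (x j0))" for \<theta>
    proof -
      have m: "(\<lambda>x. \<pi> x * indicator (B j0) (x j0)) \<in> borel_measurable seq_space"
          "(\<lambda>x. \<pi> x * cos (pairing a x + \<theta>) * indicator (B j0) (x j0)) \<in> borel_measurable seq_space" by measurable
      have b: "norm (\<pi> x * indicator (B j0) (x j0)) \<le> 1" 
           "norm (\<pi> x * cos (pairing a x + \<theta>) * indicator (B j0) (x j0)) \<le> 1" for x
        using p0[of x] p1[of x] mult_mono[OF p1[of x] abs_cos_le_one[of "pairing a x + \<theta>"]] 
        by (auto simp: indicator_def abs_mult)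
      note i1 = int[OF m(1) b(1)] and i2 = int[OF m(2) b(2)]
      \<comment> \<open>At frequency 0 the phase pi/2 kills the cosine. This isolates the constant
        part of the density \<open>1 + cos\<close>, which is then subtracted.\<close>
      have z: "(LINT x|P. \<pi> x * indicator (B j0) (x j0)) = (LINT x|P'. \<pi> x * indicator (B j0) (x j0))"
        using cis[OF zero_finitely_supported, of "pi/2"] by simp
      show ?thesis using cis[OF insert.prems, of \<theta>] i1 i2 z
        by (simp add: algebra_simps)
    qed
    \<comment> \<open>The phases 0 and -pi/2 recover the real and the imaginary part of the
      exponential.\<close>
    have rew: "complex_of_real (\<Prod>j\<in>insert j0 J. indicator (B j) (x j)) * iexp (pairing a x)
      = complex_of_real (\<pi> x * cos (pairing a x + 0) * indicator (B j0) (x j0))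
        + \<i> * complex_of_real (\<pi> x * cos (pairing a x + (-pi/2)) * indicator (B j0) (x j0))" for x
    proof -
      have "cos (pairing a x - pi/2) = sin (pairing a x)" by (simp add: cos_diff)
      hence c: "cos (pairing a x + (-pi/2)) = sin (pairing a x)" by (metis minus_divide_left uminus_add_conv_diff add.commute)
      have "(\<Prod>j\<in>insert j0 J. indicator (B j) (x j)) = indicator (B j0) (x j0) * \<pi> x"
        unfolding \<pi>_def using insert.hyps by simp
      thus ?thesis unfolding c by (simp add: exp_Euler algebra_simps sin_of_real cos_of_real)
    qed
    have i: "integrable R (\<lambda>x. complex_of_real (\<pi> x * cos (pairing a x + \<theta>) * indicator (B j0) (x j0)))"
      if "R = P \<or> R = P'" for R \<theta>
    proof -
      have "norm (complex_of_real (\<pi> x * cos (pairing a x + \<theta>) * indicator (B j0) (x j0))) \<le> 1" for x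
        using p0[of x] p1[of x] mult_mono[OF p1[of x] abs_cos_le_one[of "pairing a x + \<theta>"]] 
        by (auto simp: indicator_def abs_mult norm_mult)
      moreover have "(\<lambda>x. complex_of_real (\<pi> x * cos (pairing a x + \<theta>) * indicator (B j0) (x j0))) \<in> borel_measurable seq_space"
        by measurable
      ultimately show ?thesis using int that by blast
    qed
    have E: "(CLINT x|R. complex_of_real (\<Prod>j\<in>insert j0 J. indicator (B j) (x j)) * iexp (pairing a x))
       = complex_of_real (LINT x|R. \<pi> x * cos (pairing a x + 0) * indicator (B j0) (x j0)) +
        \<i> * complex_of_real (LINT x|R. \<pi> x * cos (pairing a x + (-pi/2)) * indicator (B j0) (x j0))"
      if "R = P \<or> R = P'" for R
      unfolding rew using i[OF that] by (subst Bochner_Integration.integral_add) (auto simp only: integral_complex_of_real integral_mult_right_zero integrable_mult_right)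
    show ?case by (simp only: E[OF disjI1[OF refl]] E[OF disjI2[OF refl]] cs)
  qed
  show "P = P'"
  proof (rule measure_eqI_PiM_infinite[where I = UNIV and M = "\<lambda>_. borel"])
    show "finite_measure P" by unfold_locales
    show "sets P = sets seq_space" "sets P' = sets seq_space" by fact+
    fix A :: "int \<Rightarrow> real set" and J :: "int set" assume J: "finite J" "J \<subseteq> UNIV" "\<And>i. i \<in> J \<Longrightarrow> A i \<in> sets borel"
    \<comment> \<open>\<open>main\<close> asks for Borel sets at every index, hence the default
      \<open>UNIV\<close> outside \<open>J\<close>.\<close>
    define B where "B j = (if j \<in> J then A j else UNIV)" for j
    have B: "B j \<in> sets borel" for j using J by (auto simp: B_def)
    note [measurable] = B
    let ?S = "prod_emb UNIV (\<lambda>_. borel) J (Pi\<^sub>E J A) :: (int \<Rightarrow> real) set"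
    have S: "?S \<in> sets seq_space" using J by (intro sets_PiM_I) auto
    have ind: "(\<Prod>j\<in>J. indicator (B j) (x j)) = indicat_real ?S x" for x
    proof -
      have "(\<Prod>j\<in>J. indicator (B j) (x j) :: real) = (if \<forall>j\<in>J. x j \<in> B j then 1 else 0)"
        using J(1) by (auto simp: indicator_def intro!: prod.neutral split: if_splits) 
      also have "\<dots> = indicator ?S x"
        by (auto simp: indicator_def prod_emb_def B_def PiE_iff extensional_def space_PiM)
      finally show ?thesis .
    qed
    have "(CLINT x|P. complex_of_real (indicator ?S x)) = (CLINT x|P'. complex_of_real (indicator ?S x))"
      using main[of J B "\<lambda>_. 0"] J B unfolding ind by simp
    hence "complex_of_real (measure P ?S) = complex_of_real (measure P' ?S)"
      using S P P' by (simp only: integral_complex_of_real) simp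
    hence "measure P ?S = measure P' ?S" using of_real_eq_iff by blast
    thus "emeasure P ?S = emeasure P' ?S"
      by (simp add: P.emeasure_eq_measure P'.emeasure_eq_measure)
  qed
qed

section \<open>Convergence of series of independent random variables\<close>

text \<open>Decompose by the first time \<open>i\<close> at which the sum passes
  \<open>2 * \<epsilon>\<close>, the event \<open>E i\<close>. Independently of it, the terms from
  \<open>i\<close> up to \<open>n\<close> add up to at most \<epsilon> with probability at least
  1/2, the event \<open>G i\<close>; on both events the full sum still exceeds \<epsilon>.\<close>

lemma (in prob_space) ottaviani_inequality:
  fixes Y :: "nat \<Rightarrow> 'a \<Rightarrow> real"
  assumes ind: "indep_vars (\<lambda>_. borel) Y UNIV"
    and half: "\<And>i. m \<le> i \<Longrightarrow> i \<le> n \<Longrightarrow> prob {\<omega>\<in>space M. \<bar>\<Sum>j\<in>{i..<n}. Y j \<omega>\<bar> > \<epsilon>} \<le> 1/2"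
  shows "prob {\<omega>\<in>space M. \<exists>i\<in>{m..n}. \<bar>\<Sum>j\<in>{m..<i}. Y j \<omega>\<bar> > 2 * \<epsilon>}
    \<le> 2 * prob {\<omega>\<in>space M. \<bar>\<Sum>j\<in>{m..<n}. Y j \<omega>\<bar> > \<epsilon>}"
proof -
  have [measurable]: "Y i \<in> borel_measurable M" for i using ind by (simp add: indep_vars_def)
  define S where "S a b \<omega> = (\<Sum>j\<in>{a..<b}. Y j \<omega>)" for a b \<omega>
  have [measurable]: "S a b \<in> borel_measurable M" for a b unfolding S_def[abs_def] by measurable
  define E where "E i = {\<omega>\<in>space M. \<bar>S m i \<omega>\<bar> > 2 * \<epsilon> \<and> (\<forall>k\<in>{m..<i}. \<bar>S m k \<omega>\<bar> \<le> 2 * \<epsilon>)}" for i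
  define G where "G i = {\<omega>\<in>space M. \<bar>S i n \<omega>\<bar> \<le> \<epsilon>}" for i
  have E[measurable]: "E i \<in> events" for i unfolding E_def by measurable
  have G[measurable]: "G i \<in> events" for i unfolding G_def by measurable
  have indep: "prob (E i \<inter> G i) = prob (E i) * prob (G i)" for i
  proof -
    let ?A = "{m..<i}" and ?B = "{i..<n}"
    let ?YA = "\<lambda>\<omega>. restrict (\<lambda>i. Y i \<omega>) ?A" and ?YB = "\<lambda>\<omega>. restrict (\<lambda>i. Y i \<omega>) ?B"
    have iv: "indep_var (PiM ?A (\<lambda>_. borel)) ?YA (PiM ?B (\<lambda>_. borel)) ?YB"
      by (rule indep_var_restrict[OF ind]) auto
    \<comment> \<open>For \<open>k > i\<close> the sum would use coordinates outside
      \<open>?A\<close>; the default 0 keeps every \<open>s k\<close> measurable, and only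
      \<open>k \<le> i\<close> is evaluated.\<close>
    define s where "s k f = (if k \<le> i then \<Sum>j\<in>{m..<k}. f j else 0)" for k and f :: "nat \<Rightarrow> real"
    have [measurable]: "s k \<in> borel_measurable (PiM ?A (\<lambda>_. borel))" for k
      unfolding s_def[abs_def]
      by (cases "k \<le> i") (auto intro!: borel_measurable_sum measurable_component_singleton)
    let ?XA = "{f\<in>space (PiM ?A (\<lambda>_. borel :: real measure)). \<bar>s i f\<bar> > 2 * \<epsilon> \<and> (\<forall>k\<in>{m..<i}. \<bar>s k f\<bar> \<le> 2 * \<epsilon>)}"
    let ?XB = "{f\<in>space (PiM ?B (\<lambda>_. borel :: real measure)). \<bar>\<Sum>j\<in>{i..<n}. f j\<bar> \<le> \<epsilon>}"
    have XA: "?XA \<in> sets (PiM ?A (\<lambda>_. borel))" by measurable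
    have XB: "?XB \<in> sets (PiM ?B (\<lambda>_. borel))" by measurable
    have "?YA -` ?XA \<inter> space M = E i"
    proof -
      have "s k (restrict (\<lambda>i. Y i \<omega>) ?A) = S m k \<omega>" if "k \<le> i" for k \<omega>
        unfolding S_def s_def using that by (auto intro!: sum.cong)
      thus ?thesis by (auto simp: E_def space_PiM)
    qed
    moreover have "?YB -` ?XB \<inter> space M = G i"
      by (auto simp: G_def S_def space_PiM)
    moreover have "prob ((\<lambda>x. (?YA x, ?YB x)) -` (?XA \<times> ?XB) \<inter> space M) =
        prob (?YA -` ?XA \<inter> space M) * prob (?YB -` ?XB \<inter> space M)"
      by (rule indep_varD[OF iv XA XB])
    moreover have "(\<lambda>x. (?YA x, ?YB x)) -` (?XA \<times> ?XB) \<inter> space M 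
       = (?YA -` ?XA \<inter> space M) \<inter> (?YB -` ?XB \<inter> space M)" by blast
    ultimately show ?thesis by simp
  qed
  have disj: "disjoint_family_on E {m..n}"
    unfolding disjoint_family_on_def
  proof (intro ballI impI)
    have *: "E i \<inter> E k = {}" if "i < k" "i \<in> {m..n}" for i k
    proof -
      have "i \<in> {m..<k}" using that by simp
      thus ?thesis unfolding E_def by (auto simp: not_le[symmetric])
    qed
    fix i k assume "i \<in> {m..n}" "k \<in> {m..n}" "i \<noteq> k"
    thus "E i \<inter> E k = {}" using *[of i k] *[of k i] by (cases "i < k") auto
  qed
  have un: "{\<omega>\<in>space M. \<exists>i\<in>{m..n}. \<bar>S m i \<omega>\<bar> > 2 * \<epsilon>} = (\<Union>i\<in>{m..n}. E i)"
  proof (intro equalityI subsetI)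
    fix \<omega> assume \<omega>: "\<omega> \<in> {\<omega>\<in>space M. \<exists>i\<in>{m..n}. \<bar>S m i \<omega>\<bar> > 2 * \<epsilon>}"
    define i where "i = (LEAST i. i \<in> {m..n} \<and> \<bar>S m i \<omega>\<bar> > 2 * \<epsilon>)"
    have "\<exists>i. i \<in> {m..n} \<and> \<bar>S m i \<omega>\<bar> > 2 * \<epsilon>" using \<omega> by auto
    hence i: "i \<in> {m..n} \<and> \<bar>S m i \<omega>\<bar> > 2 * \<epsilon>" unfolding i_def by (rule LeastI_ex)
    moreover have "\<bar>S m k \<omega>\<bar> \<le> 2 * \<epsilon>" if "k \<in> {m..<i}" for k
      using not_less_Least[of k "\<lambda>i. i \<in> {m..n} \<and> \<bar>S m i \<omega>\<bar> > 2 * \<epsilon>"] that i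
      unfolding i_def[symmetric] by auto
    ultimately have "\<omega> \<in> E i" using \<omega> by (auto simp: E_def)
    thus "\<omega> \<in> (\<Union>i\<in>{m..n}. E i)" using i by blast
  qed (auto simp: E_def)
  have ge: "1/2 \<le> prob (G i)" if "i \<in> {m..n}" for i
  proof -
    have "prob (G i) = 1 - prob {\<omega>\<in>space M. \<bar>S i n \<omega>\<bar> > \<epsilon>}"
      unfolding G_def by (subst prob_compl[symmetric]) (auto intro!: arg_cong[where f = prob])
    thus ?thesis using half[of i] that by (simp add: S_def)
  qed
  have "prob {\<omega>\<in>space M. \<exists>i\<in>{m..n}. \<bar>S m i \<omega>\<bar> > 2 * \<epsilon>} = (\<Sum>i\<in>{m..n}. prob (E i))"
    unfolding un by (rule finite_measure_finite_Union) (use disj in auto)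
  also have "\<dots> \<le> (\<Sum>i\<in>{m..n}. 2 * prob (E i \<inter> G i))"
    unfolding indep
  proof (rule sum_mono)
    fix i assume "i \<in> {m..n}"
    from mult_left_mono[OF ge[OF this], of "prob (E i)"] 
    show "prob (E i) \<le> 2 * (prob (E i) * prob (G i))" by simp
  qed
  also have "\<dots> = 2 * (\<Sum>i\<in>{m..n}. prob (E i \<inter> G i))" by (simp add: sum_distrib_left)
  also have "(\<Sum>i\<in>{m..n}. prob (E i \<inter> G i)) = prob (\<Union>i\<in>{m..n}. E i \<inter> G i)"
    by (rule finite_measure_finite_Union[symmetric])
      (use disj in \<open>auto simp: disjoint_family_on_def\<close>)
  also have "\<dots> \<le> prob {\<omega>\<in>space M. \<bar>S m n \<omega>\<bar> > \<epsilon>}"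
  proof (rule finite_measure_mono)
    show "(\<Union>i\<in>{m..n}. E i \<inter> G i) \<subseteq> {\<omega>\<in>space M. \<bar>S m n \<omega>\<bar> > \<epsilon>}"
    proof
      fix \<omega> assume "\<omega> \<in> (\<Union>i\<in>{m..n}. E i \<inter> G i)"
      then obtain i where i: "i \<in> {m..n}" "\<omega> \<in> E i" "\<omega> \<in> G i" by blast
      have "S m n \<omega> = S m i \<omega> + S i n \<omega>" using i(1) by (simp add: S_def sum.atLeastLessThan_concat)
      thus "\<omega> \<in> {\<omega>\<in>space M. \<bar>S m n \<omega>\<bar> > \<epsilon>}" using i(2,3) by (auto simp: E_def G_def)
    qed
  qed measurable
  finally show ?thesis by (simp add: S_def)
qed

text \<open>Levy's continuity theorem gives weak convergence to the point mass at 0. The test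
  function \<open>min (\<bar>x\<bar> / \<epsilon>) 1\<close> is bounded and continuous, vanishes at
  0 and dominates the indicator of \<open>\<bar>x\<bar> > \<epsilon>\<close>.\<close>

lemma (in prob_space) char_tendsto_1_imp_prob_tendsto_0:
  fixes Z :: "nat \<Rightarrow> 'a \<Rightarrow> real"
  assumes [measurable]: "\<And>n. Z n \<in> borel_measurable M"
    and char: "\<And>t. (\<lambda>n. char (distr M borel (Z n)) t) \<longlonglongrightarrow> 1" and "\<epsilon> > 0"
  shows "(\<lambda>n. prob {\<omega>\<in>space M. \<bar>Z n \<omega>\<bar> > \<epsilon>}) \<longlonglongrightarrow> 0"
proof -
  let ?\<delta> = "return borel (0::real)"
  have rd: "real_distribution (distr M borel (Z n))" for n by (rule real_distribution_distr) simp
  have rd0: "real_distribution ?\<delta>" 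
    by (simp add: real_distribution_def real_distribution_axioms_def prob_space_return)
  have "weak_conv_m (\<lambda>n. distr M borel (Z n)) ?\<delta>"
    by (rule levy_continuity[OF rd rd0]) (use char in \<open>simp add: char_def integral_return\<close>)
  hence "(\<lambda>n. LINT x|distr M borel (Z n). min (\<bar>x\<bar> / \<epsilon>) 1) \<longlonglongrightarrow> (LINT x|?\<delta>. min (\<bar>x\<bar> / \<epsilon>) 1)"
    using \<open>\<epsilon> > 0\<close> by (intro weak_conv_imp_integral_bdd_continuous_conv[where B = 1] rd rd0)
      (auto intro!: continuous_intros)
  moreover have "(LINT x|distr M borel (Z n). min (\<bar>x\<bar> / \<epsilon>) 1) = (LINT \<omega>|M. min (\<bar>Z n \<omega>\<bar> / \<epsilon>) 1)" for n
    by (subst integral_distr) auto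
  ultimately have lim: "(\<lambda>n. LINT \<omega>|M. min (\<bar>Z n \<omega>\<bar> / \<epsilon>) 1) \<longlonglongrightarrow> 0"
    by (simp add: integral_return)
  have "prob {\<omega>\<in>space M. \<bar>Z n \<omega>\<bar> > \<epsilon>} \<le> (LINT \<omega>|M. min (\<bar>Z n \<omega>\<bar> / \<epsilon>) 1)" for n
  proof -
    have "prob {\<omega>\<in>space M. \<bar>Z n \<omega>\<bar> > \<epsilon>} = (LINT \<omega>|M. indicator {\<omega>\<in>space M. \<bar>Z n \<omega>\<bar> > \<epsilon>} \<omega>)"
      by simp
    also have "\<dots> \<le> (LINT \<omega>|M. min (\<bar>Z n \<omega>\<bar> / \<epsilon>) 1)"
      using \<open>\<epsilon> > 0\<close> by (intro integral_mono integrable_const_bound[where B = 1])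
        (auto simp: indicator_def min_def field_simps)
    finally show ?thesis .
  qed
  thus ?thesis
    by (intro tendsto_sandwich[OF _ _ tendsto_const lim]) (auto intro!: always_eventually)
qed

text \<open>Absolutely summable exponents force the characteristic functions of far blocks to 1, so
  the partial sums are Cauchy in probability; Ottaviani's inequality upgrades this to almost sure
  convergence. No moments enter, as befits laws with large jumps.\<close>

lemma (in prob_space) indep_series_converges_AE:
  fixes Y :: "nat \<Rightarrow> 'a \<Rightarrow> real" and \<psi> :: "nat \<Rightarrow> real \<Rightarrow> complex"
  assumes ind: "indep_vars (\<lambda>_. borel) Y UNIV"
    and char: "\<And>i t. char (distr M borel (Y i)) t = exp (\<psi> i t)"
    and summ: "\<And>t. summable (\<lambda>i. norm (\<psi> i t))"
  shows "AE \<omega> in M. summable (\<lambda>i. Y i \<omega>)"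
proof -
  have [measurable]: "Y i \<in> borel_measurable M" for i using ind by (simp add: indep_vars_def)
  define S where "S a b \<omega> = (\<Sum>j\<in>{a..<b}. Y j \<omega>)" for a b \<omega>
  have [measurable]: "S a b \<in> borel_measurable M" for a b unfolding S_def[abs_def] by measurable
  have prob_cauchy: "\<exists>N. \<forall>m\<ge>N. \<forall>n\<ge>m. prob {\<omega>\<in>space M. \<bar>S m n \<omega>\<bar> > \<epsilon>} < \<eta>" if "\<epsilon> > 0" "\<eta> > 0" for \<epsilon> \<eta>
  proof (rule ccontr)
    assume "\<not> ?thesis"
    hence "\<forall>N. \<exists>p. fst p \<ge> N \<and> snd p \<ge> fst p \<and> prob {\<omega>\<in>space M. \<bar>S (fst p) (snd p) \<omega>\<bar> > \<epsilon>} \<ge> \<eta>"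
      by (auto simp: not_less) 
    then obtain p where p: "\<And>N::nat. fst (p N) \<ge> N" "\<And>N. snd (p N) \<ge> fst (p N)"
       "\<And>N. prob {\<omega>\<in>space M. \<bar>S (fst (p N)) (snd (p N)) \<omega>\<bar> > \<epsilon>} \<ge> \<eta>"
      by metis
    \<comment> \<open>If the Cauchy property failed, blocks starting arbitrarily far out would
      exceed \<epsilon> with probability at least \<eta>, although their characteristic functions
      tend to 1.\<close>
    define Z where "Z N = S (fst (p N)) (snd (p N))" for N
    have "(\<lambda>N. char (distr M borel (Z N)) t) \<longlonglongrightarrow> 1" for t
    proof -
      let ?e = "\<lambda>N. \<Sum>j\<in>{fst (p N)..<snd (p N)}. \<psi> j t"
      have c: "char (distr M borel (Z N)) t = exp (?e N)" for N
        unfolding Z_def S_def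
        by (subst char_distr_sum) (auto intro!: indep_vars_subset[OF ind] simp: char exp_sum)
      have "?e \<longlonglongrightarrow> 0"
      proof (rule LIMSEQ_I)
        fix r :: real assume "r > 0"
        then obtain N0 where N0: "\<And>m n. m \<ge> N0 \<Longrightarrow> norm (\<Sum>j\<in>{m..<n}. norm (\<psi> j t)) < r"
          using summ[of t] unfolding summable_Cauchy by blast
        have "norm (?e N - 0) < r" if "N \<ge> N0" for N
        proof -
          have "norm (?e N) \<le> (\<Sum>j\<in>{fst (p N)..<snd (p N)}. norm (\<psi> j t))" by (rule norm_sum)
          also have "\<dots> < r" using N0[of "fst (p N)" "snd (p N)"] p(1)[of N] that by auto
          finally show ?thesis by simp
        qed
        thus "\<exists>no. \<forall>n\<ge>no. norm (?e n - 0) < r" by blast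
      qed
      hence "(\<lambda>N. exp (?e N)) \<longlonglongrightarrow> exp 0" by (rule tendsto_exp)
      thus ?thesis by (simp add: c)
    qed
    hence "(\<lambda>N. prob {\<omega>\<in>space M. \<bar>Z N \<omega>\<bar> > \<epsilon>}) \<longlonglongrightarrow> 0"
      using that by (intro char_tendsto_1_imp_prob_tendsto_0) (auto simp: Z_def)
    hence "\<eta> \<le> 0" by (rule LIMSEQ_le_const) (use p(3) in \<open>auto simp: Z_def\<close>)
    thus False using that by simp
  qed
  have ae: "AE \<omega> in M. \<exists>m. \<forall>i\<ge>m. \<bar>S m i \<omega>\<bar> \<le> 2 * \<epsilon>" if "\<epsilon> > 0" for \<epsilon>
  proof -
    let ?B = "{\<omega>\<in>space M. \<forall>m. \<exists>i\<ge>m. \<bar>S m i \<omega>\<bar> > 2 * \<epsilon>}"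
    have "prob ?B \<le> 2 * \<eta>" if \<eta>: "\<eta> > 0" "\<eta> \<le> 1/2" for \<eta>
    proof -
      obtain N where N: "\<And>m n. m \<ge> N \<Longrightarrow> n \<ge> m \<Longrightarrow> prob {\<omega>\<in>space M. \<bar>S m n \<omega>\<bar> > \<epsilon>} < \<eta>"
        using prob_cauchy[OF \<open>\<epsilon> > 0\<close> \<eta>(1)] by blast
      define A where "A n = {\<omega>\<in>space M. \<exists>i\<in>{N..n}. \<bar>S N i \<omega>\<bar> > 2 * \<epsilon>}" for n
      have [measurable]: "A n \<in> events" for n unfolding A_def by measurable
      have le: "prob (A n) \<le> 2 * \<eta>" if "n \<ge> N" for n
      proof -
        have "prob (A n) \<le> 2 * prob {\<omega>\<in>space M. \<bar>S N n \<omega>\<bar> > \<epsilon>}"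
          unfolding A_def S_def
        proof (rule ottaviani_inequality[OF ind])
          fix i assume "N \<le> i" "i \<le> n"
          thus "prob {\<omega>\<in>space M. \<bar>\<Sum>j\<in>{i..<n}. Y j \<omega>\<bar> > \<epsilon>} \<le> 1/2"
            using N[of i n] \<eta> by (simp add: S_def)
        qed
        also have "\<dots> \<le> 2 * \<eta>" using N[OF order_refl that] by simp
        finally show ?thesis .
      qed
      have "incseq A" by (rule monoI) (auto simp: A_def)
      hence "(\<lambda>n. prob (A n)) \<longlonglongrightarrow> prob (\<Union>n. A n)"
        by (intro finite_Lim_measure_incseq) auto
      hence "prob (\<Union>n. A n) \<le> 2 * \<eta>" by (rule LIMSEQ_le_const2) (use le in auto)
      moreover have "prob ?B \<le> prob (\<Union>n. A n)"
      proof (rule finite_measure_mono)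
        show "?B \<subseteq> (\<Union>n. A n)"
        proof
          fix \<omega> assume "\<omega> \<in> ?B"
          then obtain i where "i \<ge> N" "\<bar>S N i \<omega>\<bar> > 2 * \<epsilon>" "\<omega> \<in> space M" by blast
          hence "\<omega> \<in> A i" by (auto simp: A_def)
          thus "\<omega> \<in> (\<Union>n. A n)" by blast
        qed
      qed measurable
      ultimately show ?thesis by simp
    qed
    note bound = this
    have "prob ?B = 0"
    proof (rule ccontr)
      assume "prob ?B \<noteq> 0"
      hence pos: "prob ?B > 0" by (simp add: less_le)
      \<comment> \<open>The cap 1/2 meets the hypothesis of Ottaviani's inequality; the quarter
        makes \<open>2 * \<eta>\<close> smaller than \<open>prob ?B\<close>.\<close>
      have "prob ?B \<le> 2 * min (1/2) (prob ?B / 4)" by (rule bound) (use pos in auto)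
      also have "\<dots> \<le> 2 * (prob ?B / 4)" by (intro mult_left_mono) auto
      finally show False using pos by simp
    qed
    moreover have "?B \<in> events" by measurable
    ultimately have "AE \<omega> in M. \<omega> \<notin> ?B"
      by (intro AE_not_in) (auto simp: null_sets_def emeasure_eq_measure)
    thus ?thesis using AE_space by eventually_elim (auto simp: not_less)
  qed
  have "AE \<omega> in M. \<forall>k::nat. \<exists>m. \<forall>i\<ge>m. \<bar>S m i \<omega>\<bar> \<le> 2 * (1 / Suc k)"
    by (subst AE_all_countable) (intro allI ae, simp)
  thus ?thesis
  proof eventually_elim
    case (elim \<omega>)
    show ?case unfolding summable_Cauchy
    proof (intro allI impI)
      fix e :: real assume "e > 0"
      then obtain k :: nat where k: "4 * (1 / Suc k) < e"
        using reals_Archimedean[of "e/4"] by (auto simp: field_simps)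
      obtain N where N: "\<And>i. i \<ge> N \<Longrightarrow> \<bar>S N i \<omega>\<bar> \<le> 2 * (1 / Suc k)" using elim by blast
      have "norm (\<Sum>j\<in>{m..<n}. Y j \<omega>) < e" if "m \<ge> N" for m n
      proof (cases "n \<ge> m")
        case True
        have "S N n \<omega> = S N m \<omega> + S m n \<omega>" using that True by (simp add: S_def sum.atLeastLessThan_concat)
        hence "\<bar>S m n \<omega>\<bar> \<le> \<bar>S N n \<omega>\<bar> + \<bar>S N m \<omega>\<bar>" by simp
        also have "\<dots> < e" using N[of n] N[of m] that True k by simp
        finally show ?thesis by (simp add: S_def)
      qed (use \<open>e > 0\<close> in simp)
      thus "\<exists>N. \<forall>m\<ge>N. \<forall>n. norm (sum (\<lambda>i. Y i \<omega>) {m..<n}) < e" by blast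
    qed
  qed
qed

section \<open>Infinitely divisible laws with a given Levy measure\<close>

lemma indep_vars_PiM_coords:
  assumes G: "\<And>i. prob_space (G i)" and I: "I \<noteq> {}"
  shows "prob_space.indep_vars (PiM I G) G (\<lambda>i \<omega>. \<omega> i) I"
    and "i \<in> I \<Longrightarrow> distr (PiM I G) (G i) (\<lambda>\<omega>. \<omega> i) = G i"
proof -
  interpret N: product_prob_space G I
    by (simp add: product_prob_space_def product_prob_space_axioms_def
        product_sigma_finite_def G prob_space_imp_sigma_finite)
  have pN: "prob_space (PiM I G)" by (rule prob_space_PiM) (rule G)
  show comp: "distr (PiM I G) (G i) (\<lambda>\<omega>. \<omega> i) = G i" if "i \<in> I" for i
    by (rule N.PiM_component[OF that])
  have "distr (PiM I G) (PiM I G) (\<lambda>\<omega>. \<lambda>i\<in>I. \<omega> i) = distr (PiM I G) (PiM I G) (\<lambda>\<omega>. \<omega>)"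
    by (intro distr_cong) (auto simp: space_PiM PiE_def extensional_restrict)
  also have "\<dots> = PiM I G" by (rule distr_id)
  also have "\<dots> = PiM I (\<lambda>i. distr (PiM I G) (G i) (\<lambda>\<omega>. \<omega> i))"
    by (intro PiM_cong) (auto simp: comp)
  finally show "prob_space.indep_vars (PiM I G) G (\<lambda>i \<omega>. \<omega> i) I"
    using prob_space.indep_vars_iff_distr_eq_PiM'[OF pN I, where M' = G and X = "\<lambda>i \<omega>. \<omega> i"] by auto
qed

lemma indep_coords_seq_space:
  fixes G :: "'i \<Rightarrow> (int \<Rightarrow> real) measure"
  assumes G: "\<And>i. prob_space (G i)" "\<And>i. sets (G i) = sets seq_space" and I: "I \<noteq> {}"
  shows "prob_space.indep_vars (PiM I G) (\<lambda>_. seq_space) (\<lambda>i \<omega>. \<omega> i) I"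
    and "i \<in> I \<Longrightarrow> distr (PiM I G) seq_space (\<lambda>\<omega>. \<omega> i) = G i"
proof -
  interpret P: prob_space "PiM I G" by (rule prob_space_PiM) (rule G)
  note c = indep_vars_PiM_coords[OF G(1) I]
  show "P.indep_vars (\<lambda>_. seq_space) (\<lambda>i \<omega>. \<omega> i) I"
    by (rule P.indep_vars_compose2[OF c(1), of "\<lambda>_ x. x"]) (simp add: measurable_ident_sets G)
  show "distr (PiM I G) seq_space (\<lambda>\<omega>. \<omega> i) = G i" if "i \<in> I"
    using c(2)[OF that] distr_cong[OF refl G(2)[symmetric, of i], of "PiM I G" "\<lambda>\<omega>. \<omega> i" "\<lambda>\<omega>. \<omega> i"] by simp
qed

text \<open>Every process has its own frequency \<open>b j\<close>, since in a moving average the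
  copy with index \<open>j\<close> is tested with a frequency shifted by \<open>j\<close>.\<close>

lemma (in prob_space) cf_indep_sum:
  assumes ind: "indep_vars (\<lambda>_. seq_space) Y I" and J: "finite J" "J \<subseteq> I"
  shows "(CLINT \<omega>|M. iexp (\<Sum>j\<in>J. pairing (b j) (Y j \<omega>))) = (\<Prod>j\<in>J. CLINT x|distr M seq_space (Y j). iexp (pairing (b j) x))"
proof -
  have [measurable]: "j \<in> J \<Longrightarrow> Y j \<in> measurable M seq_space" for j using ind J by (auto simp: indep_vars_def)
  have iv: "indep_vars (\<lambda>_. borel) (\<lambda>j \<omega>. iexp (pairing (b j) (Y j \<omega>))) J"
    by (rule indep_vars_compose2[OF indep_vars_subset[OF ind J(2)]]) measurable
  have "(CLINT \<omega>|M. iexp (\<Sum>j\<in>J. pairing (b j) (Y j \<omega>))) = (CLINT \<omega>|M. (\<Prod>j\<in>J. iexp (pairing (b j) (Y j \<omega>))))"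
    by (simp add: exp_sum[OF J(1), symmetric] sum_distrib_left)
  also have "\<dots> = (\<Prod>j\<in>J. CLINT \<omega>|M. iexp (pairing (b j) (Y j \<omega>)))"
    by (rule indep_vars_lebesgue_integral[OF J(1) iv]) (auto intro!: integrable_const_bound[where B = 1])
  also have "\<dots> = (\<Prod>j\<in>J. CLINT x|distr M seq_space (Y j). iexp (pairing (b j) x))"
    by (intro prod.cong refl) (subst integral_distr, auto)
  finally show ?thesis .
qed

section \<open>The Levy kernel and its integrability\<close>

definition levy_kernel :: "(int \<Rightarrow> real) \<Rightarrow> (int \<Rightarrow> real) \<Rightarrow> complex" where
  "levy_kernel a x = iexp (pairing a x) - 1 - \<i> * complex_of_real (pairing a (trunc x))"

text \<open>The class has to contain the restriction of \<open>Q\<close> to a section, which need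
  not be shift invariant; integrability is therefore asked at each coordinate instead of at 0
  alone.\<close>

definition levy_measure :: "(int \<Rightarrow> real) measure \<Rightarrow> bool" where
  "levy_measure R \<longleftrightarrow> sets R = sets seq_space \<and> sigma_finite_measure R \<and>
     (\<forall>k. (\<integral>\<^sup>+ x. ennreal (min ((x k)\<^sup>2) 1) \<partial>R) < \<infinity>)"

lemma trunc_eq: "trunc x i = max (-1) (min (x i) 1)"
  by (simp add: trunc_def)

lemma trunc_measurable [measurable]: "(\<lambda>x. trunc x i) \<in> borel_measurable seq_space"
  unfolding trunc_eq by measurable

lemma pairing_trunc_measurable [measurable]: "(\<lambda>x. pairing a (trunc x)) \<in> borel_measurable seq_space"
  unfolding pairing_def by measurable

lemma levy_kernel_measurable [measurable]: "levy_kernel a \<in> borel_measurable seq_space"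
  unfolding levy_kernel_def[abs_def] by measurable

text \<open>There are two regimes. If all coordinates seen by \<open>a\<close> are at most 1 in
  modulus, truncation leaves them alone, and the Taylor remainder with Cauchy-Schwarz gives a
  quadratic bound. Otherwise the sum of minima is at least 1, and a constant bounds the kernel. The
  witness adds the two constants.\<close>

lemma levy_kernel_bound:
  assumes a: "a \<in> finitely_supported"
  shows "\<exists>C. \<forall>x. norm (levy_kernel a x) \<le> C * (\<Sum>i | a i \<noteq> 0. min ((x i)\<^sup>2) 1)"
proof (intro exI allI)
  let ?F = "{i. a i \<noteq> 0}"
  let ?C = "(\<Sum>i\<in>?F. (a i)\<^sup>2) + (2 + (\<Sum>i\<in>?F. \<bar>a i\<bar>))"
  fix x :: "int \<Rightarrow> real"
  let ?m = "\<Sum>i\<in>?F. min ((x i)\<^sup>2) 1"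
  have fin: "finite ?F" using a by (simp add: finitely_supported_def)
  have m0: "?m \<ge> 0" by (intro sum_nonneg) auto
  have C0: "(\<Sum>i\<in>?F. (a i)\<^sup>2) \<ge> 0" "(\<Sum>i\<in>?F. \<bar>a i\<bar>) \<ge> 0" by (intro sum_nonneg; simp)+
  show "norm (levy_kernel a x) \<le> ?C * ?m"
  proof (cases "\<forall>i\<in>?F. \<bar>x i\<bar> \<le> 1")
    case True
    let ?u = "pairing a x"
    have tr: "pairing a (trunc x) = ?u"
      unfolding pairing_def using True by (intro sum.cong) (auto simp: trunc_def)
    have sq: "(x i)\<^sup>2 \<le> 1" if "i \<in> ?F" for i using True that by (simp add: abs_square_le_1)
    have "norm (levy_kernel a x) = norm (iexp ?u - (\<Sum>k\<le>1. (\<i> * ?u)^k / fact k))"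
      unfolding levy_kernel_def tr by (simp add: algebra_simps)
    also have "\<dots> \<le> \<bar>?u\<bar>^2 / 2" using iexp_approx1[of ?u 1] by (simp add: numeral_2_eq_2)
    also have "\<dots> \<le> ?u\<^sup>2" by simp
    also have "\<dots> \<le> (\<Sum>i\<in>?F. (a i)\<^sup>2) * (\<Sum>i\<in>?F. (x i)\<^sup>2)"
      unfolding pairing_def by (rule Cauchy_Schwarz_ineq_sum)
    also have "(\<Sum>i\<in>?F. (x i)\<^sup>2) = ?m" using sq by (intro sum.cong) (auto simp: min_def intro: antisym)
    also have "(\<Sum>i\<in>?F. (a i)\<^sup>2) * ?m \<le> ?C * ?m"
      using C0 m0 by (intro mult_right_mono) auto
    finally show ?thesis .
  next
    case False
    then obtain i where i: "i \<in> ?F" "\<bar>x i\<bar> > 1" by (auto simp: not_le)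
    hence "1 = min ((x i)\<^sup>2) 1" using one_less_power[of "\<bar>x i\<bar>" 2] by (simp add: min_def)
    also have "\<dots> \<le> ?m" by (rule member_le_sum[OF i(1) _ fin]) auto
    finally have m1: "1 \<le> ?m" .
    have "\<bar>pairing a (trunc x)\<bar> \<le> (\<Sum>i\<in>?F. \<bar>a i\<bar> * \<bar>trunc x i\<bar>)"
      unfolding pairing_def by (rule order_trans[OF sum_abs]) (simp add: abs_mult)
    also have "\<dots> \<le> (\<Sum>i\<in>?F. \<bar>a i\<bar>)"
      by (intro sum_mono mult_left_le) (auto simp: trunc_def)
    finally have p: "\<bar>pairing a (trunc x)\<bar> \<le> (\<Sum>i\<in>?F. \<bar>a i\<bar>)" .
    have "norm (levy_kernel a x) \<le> norm (iexp (pairing a x)) + norm (1::complex) + norm (\<i> * complex_of_real (pairing a (trunc x)))"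
      unfolding levy_kernel_def by (intro order_trans[OF norm_triangle_ineq4] add_mono) auto
    also have "\<dots> \<le> 2 + (\<Sum>i\<in>?F. \<bar>a i\<bar>)" using p by (simp add: norm_mult)
    also have "\<dots> \<le> ?C" using C0 by simp
    also have "\<dots> \<le> ?C * ?m"
    proof -
      have "0 \<le> ?C" using C0 by simp
      from mult_left_mono[OF m1 this] show ?thesis by (simp only: mult_1_right)
    qed
    finally show ?thesis .
  qed
qed

lemma levy_measure_integrable_min:
  assumes "levy_measure R"
  shows "integrable R (\<lambda>x. min ((x k)\<^sup>2) 1)"
proof (rule integrableI_nonneg)
  have [measurable]: "(\<lambda>x. x k) \<in> borel_measurable R"
    using assms by (simp add: levy_measure_def cong: measurable_cong_sets)
  show "(\<lambda>x. min ((x k)\<^sup>2) 1) \<in> borel_measurable R" by measurable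
qed (use assms in \<open>auto simp: levy_measure_def\<close>)

lemma integrable_levy_kernel:
  assumes R: "levy_measure R" and a: "a \<in> finitely_supported"
  shows "integrable R (levy_kernel a)"
proof -
  obtain C where C: "\<And>x. norm (levy_kernel a x) \<le> C * (\<Sum>i | a i \<noteq> 0. min ((x i)\<^sup>2) 1)"
    using levy_kernel_bound[OF a] by blast
  show ?thesis
  proof (rule Bochner_Integration.integrable_bound)
    show "integrable R (\<lambda>x. C * (\<Sum>i | a i \<noteq> 0. min ((x i)\<^sup>2) 1))"
      by (intro integrable_mult_right Bochner_Integration.integrable_sum levy_measure_integrable_min R)
    show "levy_kernel a \<in> borel_measurable R"
      using R by (simp add: levy_measure_def cong: measurable_cong_sets)
    show "AE x in R. norm (levy_kernel a x) \<le> norm (C * (\<Sum>i | a i \<noteq> 0. min ((x i)\<^sup>2) 1))"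
      using order_trans[OF C abs_ge_self] by auto
  qed
qed

section \<open>Compound Poisson laws\<close>

lemma poisson_generating_function:
  assumes c: "c > 0" and z: "norm z \<le> 1"
  shows "(CLINT n|measure_pmf (poisson_pmf c). z ^ n) = exp (c * (z - 1))"
proof -
  let ?f = "\<lambda>n. pmf (poisson_pmf c) n *\<^sub>R z ^ n"
  have "(\<lambda>n. (c * z) ^ n /\<^sub>R fact n) sums exp (c * z)" by (rule exp_converges)
  hence "(\<lambda>n. exp (- complex_of_real c) * ((c * z) ^ n /\<^sub>R fact n)) sums (exp (- complex_of_real c) * exp (c * z))"
    by (rule sums_mult)
  moreover have "exp (- complex_of_real c) * ((c * z) ^ n /\<^sub>R fact n) = ?f n" for n
    using c by (simp add: scaleR_conv_of_real power_mult_distrib exp_of_real[symmetric] field_simps)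
  moreover have "exp (- complex_of_real c) * exp (c * z) = exp (c * (z - 1))"
    by (simp add: exp_add[symmetric] algebra_simps)
  ultimately have s: "?f sums exp (c * (z - 1))" by simp
  have "integrable (measure_pmf (poisson_pmf c)) (\<lambda>n. z ^ n)"
    using z by (intro measure_pmf.integrable_const_bound[where B = 1]) (auto simp: norm_power power_le_one)
  hence i: "integrable (count_space UNIV) ?f"
    unfolding measure_pmf_eq_density by (subst (asm) integrable_density) auto
  have "(CLINT n|measure_pmf (poisson_pmf c). z ^ n) = (CLINT n|count_space UNIV. ?f n)"
    unfolding measure_pmf_eq_density by (subst integral_density) auto
  also have "\<dots> = exp (c * (z - 1))"
    using sums_integral_count_space_nat[OF i] s sums_unique2 by blast
  finally show ?thesis .
qed

text \<open>Add up a Poisson number, with mean the total mass \<open>c\<close> of \<open>L\<close>,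
  of independent jumps of law \<open>L / c\<close>. Conditioning on the number of jumps gives the
  Poisson generating function at \<open>\<phi> a\<close>. For \<open>c = 0\<close> the point mass at
  the zero sequence serves.\<close>

lemma compound_poisson_exists:
  assumes L: "finite_measure L" and sL: "sets L = sets seq_space"
  shows "\<exists>P. prob_space P \<and> sets P = sets seq_space \<and>
    (\<forall>a. (CLINT x|P. iexp (pairing a x)) = exp (CLINT x|L. iexp (pairing a x) - 1))"
proof -
  interpret L: finite_measure L by fact
  have mL: "borel_measurable L = borel_measurable seq_space" 
    by (rule measurable_cong_sets) (simp_all add: sL)
  have spL: "space L = UNIV" using sets_eq_imp_space_eq[OF sL] by simp
  define c where "c = measure L UNIV"
  show ?thesis
  proof (cases "c = 0")
    case True
    have "emeasure L (space L) = 0" using True spL by (simp add: c_def L.emeasure_eq_measure)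
    hence "AE x in L. False" by (subst AE_iff_measurable[where N = "space L"]) auto
    hence "(CLINT x|L. iexp (pairing a x) - 1) = 0" for a
      by (intro integral_eq_zero_AE) auto
    thus ?thesis
      by (intro exI[of _ "return seq_space (\<lambda>_. 0)"]) (auto simp: prob_space_return integral_return)
  next
    case False
    hence c: "c > 0" unfolding c_def by (simp add: less_le)
    define D where "D = density L (\<lambda>_. ennreal (1 / c))"
    have "emeasure D (space D) = ennreal (1 / c) * ennreal c"
      unfolding D_def using c sets.top[of L] by (simp add: emeasure_density_const spL c_def L.emeasure_eq_measure)
    also have "\<dots> = 1" using c by (simp add: ennreal_mult[symmetric])
    finally have pD: "prob_space D" by (rule prob_spaceI)
    interpret D: prob_space D by (rule pD)
    have sD: "sets D = sets seq_space" by (simp add: D_def sL)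
    have mD: "borel_measurable D = borel_measurable seq_space"
      by (rule measurable_cong_sets) (simp_all add: sD)
    define \<phi> where "\<phi> a = (CLINT x|D. iexp (pairing a x))" for a
    have \<phi>: "\<phi> a = (CLINT x|L. iexp (pairing a x)) / c" for a
    proof -
      have "\<phi> a = (CLINT x|L. (1 / c) *\<^sub>R iexp (pairing a x))"
        unfolding \<phi>_def D_def using c by (intro integral_density) (auto simp: mL)
      thus ?thesis by (simp add: scaleR_conv_of_real)
    qed
    have \<phi>1: "norm (\<phi> a) \<le> 1" for a
    proof -
      have "norm (\<phi> a) \<le> (LINT x|D. norm (iexp (pairing a x)))" unfolding \<phi>_def by (rule integral_norm_bound)
      thus ?thesis by (simp add: D.prob_space)
    qed
    let ?N = "measure_pmf (poisson_pmf c)" and ?Z = "PiM (UNIV :: nat set) (\<lambda>_. D)"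
    interpret Z: prob_space ?Z by (rule prob_space_PiM) (rule pD)
    interpret NZ: pair_prob_space ?N ?Z by unfold_locales
    define S where "S p i = (\<Sum>j<fst p. snd p j i)" for p :: "nat \<times> (nat \<Rightarrow> int \<Rightarrow> real)" and i
    have co[measurable]: "(\<lambda>\<omega>. \<omega> j) \<in> measurable ?Z seq_space" for j :: nat
      using measurable_component_singleton[of j UNIV "\<lambda>_. D"] measurable_cong_sets[OF refl sD] by blast
    have co2[measurable]: "(\<lambda>\<omega>. \<omega> j i) \<in> borel_measurable ?Z" for j :: nat and i
      using measurable_compose[OF co measurable_coord] .
    have S[measurable]: "S \<in> measurable (?N \<Otimes>\<^sub>M ?Z) seq_space"
    proof (rule measurable_into_seq_space)
      fix i
      have "(\<lambda>p. \<Sum>j<fst p. snd p j i) \<in> borel_measurable (?N \<Otimes>\<^sub>M ?Z)"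
      proof (rule measurable_compose_countable'[where I = UNIV and g = fst])
        show "(\<lambda>p. \<Sum>j<n. snd p j i) \<in> borel_measurable (?N \<Otimes>\<^sub>M ?Z)" for n by measurable
        show "fst \<in> (?N \<Otimes>\<^sub>M ?Z) \<rightarrow>\<^sub>M count_space UNIV" by measurable
      qed auto
      thus "(\<lambda>p. S p i) \<in> borel_measurable (?N \<Otimes>\<^sub>M ?Z)" by (simp add: S_def case_prod_beta)
    qed
    define P where "P = distr (?N \<Otimes>\<^sub>M ?Z) seq_space S"
    have "(CLINT x|P. iexp (pairing a x)) = exp (CLINT x|L. iexp (pairing a x) - 1)" for a
    proof -
      have iz: "integrable (?N \<Otimes>\<^sub>M ?Z) (\<lambda>p. iexp (pairing a (S p)))"
        by (rule NZ.integrable_const_bound[of _ 1]) auto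
      have ind: "Z.indep_vars (\<lambda>_. seq_space) (\<lambda>j \<omega>. \<omega> j) UNIV"
        by (rule indep_coords_seq_space(1)) (use pD sD in auto)
      have dz: "distr ?Z seq_space (\<lambda>\<omega>. \<omega> j) = D" for j :: nat
        by (rule indep_coords_seq_space(2)) (use pD sD in auto)
      have "(CLINT x|P. iexp (pairing a x)) = (CLINT p|?N \<Otimes>\<^sub>M ?Z. iexp (pairing a (S p)))"
        unfolding P_def by (subst integral_distr) auto
      also have "\<dots> = (CLINT n|?N. CLINT \<omega>|?Z. iexp (pairing a (S (n, \<omega>))))"
        by (rule NZ.integral_fst'[symmetric, OF iz])
      also have "\<dots> = (CLINT n|?N. \<phi> a ^ n)"
      proof (rule Bochner_Integration.integral_cong)
        fix n
        have "(CLINT \<omega>|?Z. iexp (pairing a (S (n, \<omega>)))) = (CLINT \<omega>|?Z. iexp (\<Sum>j<n. pairing a (\<omega> j)))"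
        proof -
          have "S (n, \<omega>) = (\<lambda>i. \<Sum>j<n. \<omega> j i)" for \<omega> by (rule ext) (simp add: S_def)
          thus ?thesis by (simp only: pairing_sum_right)
        qed
        also have "\<dots> = (\<Prod>j<n. CLINT x|distr ?Z seq_space (\<lambda>\<omega>. \<omega> j). iexp (pairing a x))"
          by (rule Z.cf_indep_sum[OF ind]) auto
        also have "\<dots> = \<phi> a ^ n" unfolding dz \<phi>_def by simp
        finally show "(CLINT \<omega>|?Z. iexp (pairing a (S (n, \<omega>)))) = \<phi> a ^ n" .
      qed simp
      also have "\<dots> = exp (c * (\<phi> a - 1))" by (rule poisson_generating_function) (use c \<phi>1 in auto)
      also have "c * (\<phi> a - 1) = (CLINT x|L. iexp (pairing a x)) - c" using c by (simp add: \<phi> field_simps)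
      also have "\<dots> = (CLINT x|L. iexp (pairing a x) - 1)"
        by (subst Bochner_Integration.integral_diff)
          (auto intro!: L.integrable_const_bound[where B = 1] simp: mL c_def spL scaleR_conv_of_real)
      finally show ?thesis .
    qed
    moreover have "prob_space P" unfolding P_def by (rule NZ.prob_space_distr) measurable
    ultimately show ?thesis by (intro exI[of _ P]) (simp add: P_def)
  qed
qed

text \<open>These two facts let exponents be added over a partition: the uniform bound yields
  convergence of the random series, and dominated convergence identifies the limit.
  \<open>F' n\<close> will be \<open>{..<n}\<close> for a sigma-finite partition and
  \<open>{- int n..int n}\<close> for the translates of a section.\<close>

lemma
  fixes f :: "'a \<Rightarrow> complex"
  assumes f: "integrable M f" and A: "\<And>j. A j \<in> sets M" and disj: "disjoint_family A"
  shows sum_norm_integral_disjoint_le: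
      "finite F \<Longrightarrow> (\<Sum>j\<in>F. norm (CLINT x|M. indicator (A j) x *\<^sub>R f x)) \<le> (LINT x|M. norm (f x))"
    and sum_integral_disjoint_tendsto:
      "(\<And>n. finite (F' n)) \<Longrightarrow> (AE x in M. \<exists>N. \<forall>n\<ge>N. \<exists>j\<in>F' n. x \<in> A j) \<Longrightarrow>
       (\<lambda>n. \<Sum>j\<in>F' n. CLINT x|M. indicator (A j) x *\<^sub>R f x) \<longlonglongrightarrow> (CLINT x|M. f x)"
proof -
  note [measurable] = A borel_measurable_integrable[OF f]
  have i: "integrable M (\<lambda>x. indicator (A j) x *\<^sub>R f x)" for j
    by (rule integrable_mult_indicator[OF A f])
  have ind: "(\<Sum>j\<in>F. indicator (A j) x) = indicat_real (\<Union>j\<in>F. A j) x" if "finite F" for F x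
    by (rule indicator_UN_disjoint[OF that, symmetric]) (use disj in \<open>auto simp: disjoint_family_on_def\<close>)
  show "(\<Sum>j\<in>F. norm (CLINT x|M. indicator (A j) x *\<^sub>R f x)) \<le> (LINT x|M. norm (f x))" if "finite F"
  proof -
    have "(\<Sum>j\<in>F. norm (CLINT x|M. indicator (A j) x *\<^sub>R f x)) \<le> (\<Sum>j\<in>F. LINT x|M. norm (indicator (A j) x *\<^sub>R f x))"
      by (intro sum_mono integral_norm_bound)
    also have "\<dots> = (LINT x|M. (\<Sum>j\<in>F. norm (indicator (A j) x *\<^sub>R f x)))"
      by (rule Bochner_Integration.integral_sum[symmetric]) (intro integrable_norm i)
    also have "\<dots> = (LINT x|M. indicator (\<Union>j\<in>F. A j) x * norm (f x))"
      by (simp add: ind[OF that, symmetric] sum_distrib_right)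
    also have "\<dots> \<le> (LINT x|M. norm (f x))"
    proof (rule integral_mono)
      have "(\<Union>j\<in>F. A j) \<in> sets M" using that A by (intro sets.finite_UN) auto
      thus "integrable M (\<lambda>x. indicator (\<Union>j\<in>F. A j) x * norm (f x))"
        using integrable_mult_indicator[of "\<Union>j\<in>F. A j" M "\<lambda>x. norm (f x)"] f that by auto
    qed (use f in \<open>auto simp: indicator_def\<close>)
    finally show ?thesis .
  qed
  show "(\<lambda>n. \<Sum>j\<in>F' n. CLINT x|M. indicator (A j) x *\<^sub>R f x) \<longlonglongrightarrow> (CLINT x|M. f x)"
    if F: "\<And>n. finite (F' n)" "AE x in M. \<exists>N. \<forall>n\<ge>N. \<exists>j\<in>F' n. x \<in> A j"
  proof -
    have "(\<Sum>j\<in>F' n. CLINT x|M. indicator (A j) x *\<^sub>R f x) = (CLINT x|M. indicator (\<Union>j\<in>F' n. A j) x *\<^sub>R f x)" for n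
      by (subst Bochner_Integration.integral_sum[symmetric]) (simp_all add: i ind[OF F(1), symmetric] scaleR_sum_left)
    moreover have "(\<lambda>n. CLINT x|M. indicator (\<Union>j\<in>F' n. A j) x *\<^sub>R f x) \<longlonglongrightarrow> (CLINT x|M. f x)"
    proof (rule integral_dominated_convergence[where w = "\<lambda>x. norm (f x)"])
      show "AE x in M. (\<lambda>n. indicator (\<Union>j\<in>F' n. A j) x *\<^sub>R f x) \<longlonglongrightarrow> f x"
        using F(2)
      proof eventually_elim
        case (elim x)
        then obtain N where N: "\<And>n. n \<ge> N \<Longrightarrow> x \<in> (\<Union>j\<in>F' n. A j)" by auto
        have "eventually (\<lambda>n. indicator (\<Union>j\<in>F' n. A j) x *\<^sub>R f x = f x) sequentially"
          unfolding eventually_sequentially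
          by (rule exI[of _ N]) (intro allI impI, subst indicator_simps(1), erule N, simp)
        thus ?case by (rule tendsto_eventually)
      qed
      show "(\<lambda>x. indicator (\<Union>j\<in>F' n. A j) x *\<^sub>R f x) \<in> borel_measurable M" for n
        using F(1)[of n] by measurable
    qed (use f in \<open>auto simp: indicator_def\<close>)
    ultimately show ?thesis by simp
  qed
qed

text \<open>On a set of finite measure the truncation is integrable by itself, so the compensator is
  a deterministic drift \<open>d\<close>. Subtracting it from the compound Poisson process turns the
  exponent into the integral of \<open>levy_kernel\<close>.\<close>

lemma levy_law_piece_exists:
  assumes R: "levy_measure R" and A: "A \<in> sets R" "emeasure R A \<noteq> \<infinity>"
  shows "\<exists>P. prob_space P \<and> sets P = sets seq_space \<and> (\<forall>a\<in>finitely_supported.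
    (CLINT x|P. iexp (pairing a x)) = exp (CLINT x|R. indicator A x *\<^sub>R levy_kernel a x))"
proof -
  have sR: "sets R = sets seq_space" using R by (simp add: levy_measure_def)
  note [measurable_cong] = sR
  define L where "L = density R (indicator A)"
  have sL: "sets L = sets seq_space" by (simp add: L_def sR)
  note [measurable_cong] = sL
  have "emeasure L (space L) = emeasure R A"
    using A sets.sets_into_space[OF A(1)] by (simp add: L_def emeasure_density nn_integral_indicator Int_absorb1 Int_absorb2 flip: indicator_inter_arith)
  hence fL: "finite_measure L" using A(2) by (intro finite_measureI) simp
  interpret L: finite_measure L by (rule fL)
  obtain P where P: "prob_space P" "sets P = sets seq_space"
    "\<And>a. (CLINT x|P. iexp (pairing a x)) = exp (CLINT x|L. iexp (pairing a x) - 1)"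
    using compound_poisson_exists[OF fL sL] by blast
  note [measurable_cong] = P(2)
  interpret P: prob_space P by (rule P(1))
  define d where "d i = (LINT x|L. trunc x i)" for i
  have sh[measurable]: "(\<lambda>x i. x i - d i) \<in> measurable P seq_space"
    by (rule measurable_into_seq_space) measurable
  have "(CLINT x|distr P seq_space (\<lambda>x i. x i - d i). iexp (pairing a x)) = exp (CLINT x|R. indicator A x *\<^sub>R levy_kernel a x)"
    if a: "a \<in> finitely_supported" for a
  proof -
    have it: "integrable L (\<lambda>x. trunc x i)" for i
      by (rule L.integrable_const_bound[where B = 1]) (auto simp: trunc_def)
    have ip: "integrable L (\<lambda>x. pairing a (trunc x))" unfolding pairing_def
      by (intro Bochner_Integration.integrable_sum integrable_mult_right it)
    have pd: "pairing a d = (LINT x|L. pairing a (trunc x))"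
      unfolding pairing_def d_def by (subst Bochner_Integration.integral_sum) (simp_all add: it)
    have ie: "integrable L (\<lambda>x. iexp (pairing a x) - 1)"
      by (intro Bochner_Integration.integrable_diff L.integrable_const_bound[where B = 1]) auto
    have "(CLINT x|distr P seq_space (\<lambda>x i. x i - d i). iexp (pairing a x)) = (CLINT x|P. iexp (pairing a (\<lambda>i. x i - d i)))"
      by (subst integral_distr) auto
    also have "\<dots> = (CLINT x|P. exp (- \<i> * pairing a d) * iexp (pairing a x))"
      by (simp add: pairing_diff_right exp_add[symmetric] algebra_simps)
    also have "\<dots> = exp (- \<i> * pairing a d) * exp (CLINT x|L. iexp (pairing a x) - 1)"
      by (simp only: integral_mult_right_zero P(3))
    also have "\<dots> = exp ((CLINT x|L. iexp (pairing a x) - 1) - \<i> * (CLINT x|L. complex_of_real (pairing a (trunc x))))"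
      unfolding pd integral_complex_of_real by (simp add: exp_add[symmetric] algebra_simps)
    also have "(CLINT x|L. iexp (pairing a x) - 1) - \<i> * (CLINT x|L. complex_of_real (pairing a (trunc x))) = (CLINT x|L. levy_kernel a x)"
      unfolding levy_kernel_def using ip ie
      by (subst Bochner_Integration.integral_diff) auto
    also have "\<dots> = (CLINT x|density R (\<lambda>x. ennreal (indicator A x)). levy_kernel a x)"
      unfolding L_def by (simp add: ennreal_indicator)
    also have "\<dots> = (CLINT x|R. indicator A x *\<^sub>R levy_kernel a x)"
      using A by (intro integral_density) auto
    finally show ?thesis .
  qed
  thus ?thesis
    by (intro exI[of _ "distr P seq_space (\<lambda>x i. x i - d i)"]) (auto intro!: P.prob_space_distr)
qed

lemma (in prob_space) char_coord_eq:
  assumes [measurable]: "X \<in> measurable M seq_space"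
  shows "char (distr M borel (\<lambda>\<omega>. X \<omega> k)) t = (CLINT x|distr M seq_space X. iexp (pairing (\<lambda>i. t * unit_seq k i) x))"
proof -
  have "pairing (\<lambda>i. t * unit_seq k i) x = t * x k" for x
    using pairing_scale_left[OF unit_seq_finitely_supported] by simp
  thus ?thesis unfolding char_def by (simp add: integral_distr)
qed

text \<open>Independent processes for the pieces of a partition into sets of finite measure are
  added up. Although the drifts alone need not be summable, the compensated kernel is integrable
  over the whole space, so the exponents are absolutely summable and the series converges in every
  coordinate.\<close>

lemma levy_law_exists:
  assumes R: "levy_measure R"
  shows "\<exists>P. prob_space P \<and> sets P = sets seq_space \<and> (\<forall>a\<in>finitely_supported.
    (CLINT x|P. iexp (pairing a x)) = exp (CLINT x|R. levy_kernel a x))"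
proof -
  have sR: "sets R = sets seq_space" using R by (simp add: levy_measure_def)
  note [measurable_cong] = sR
  interpret sigma_finite_measure R using R by (simp add: levy_measure_def)
  obtain A :: "nat \<Rightarrow> (int \<Rightarrow> real) set" where A: "range A \<subseteq> sets R" "(\<Union>i. A i) = space R"
    "\<And>i. emeasure R (A i) \<noteq> \<infinity>" "disjoint_family A"
    using sigma_finite_disjoint by blast
  define \<kappa> where "\<kappa> j a = (CLINT x|R. indicator (A j) x *\<^sub>R levy_kernel a x)" for j a
  have "\<forall>j. \<exists>P. prob_space P \<and> sets P = sets seq_space \<and> (\<forall>a\<in>finitely_supported.
    (CLINT x|P. iexp (pairing a x)) = exp (\<kappa> j a))"
    unfolding \<kappa>_def using A by (intro allI levy_law_piece_exists[OF R]) auto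
  then obtain \<nu> where \<nu>: "\<And>j. prob_space (\<nu> j)" "\<And>j. sets (\<nu> j) = sets seq_space"
    "\<And>j a. a \<in> finitely_supported \<Longrightarrow> (CLINT x|\<nu> j. iexp (pairing a x)) = exp (\<kappa> j a)"
    by metis
  have A': "A j \<in> sets R" for j using A(1) by auto
  have sum\<kappa>: "summable (\<lambda>j. norm (\<kappa> j a))" if "a \<in> finitely_supported" for a
    unfolding \<kappa>_def
    by (rule summableI_nonneg_bounded[OF norm_ge_zero sum_norm_integral_disjoint_le[OF integrable_levy_kernel[OF R that] A' A(4)]]) simp
  have lim\<kappa>: "(\<lambda>n. \<Sum>j<n. \<kappa> j a) \<longlonglongrightarrow> (CLINT x|R. levy_kernel a x)" if "a \<in> finitely_supported" for a
    unfolding \<kappa>_def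
  proof (rule sum_integral_disjoint_tendsto[OF integrable_levy_kernel[OF R that] A' A(4)])
    have "\<exists>N. \<forall>n\<ge>N. \<exists>j\<in>{..<n}. x \<in> A j" if x: "x \<in> space R" for x
    proof -
      obtain j where "x \<in> A j" using x A(2) by blast
      thus ?thesis by (intro exI[of _ "Suc j"]) auto
    qed
    thus "AE x in R. \<exists>N. \<forall>n\<ge>N. \<exists>j\<in>{..<n}. x \<in> A j" by auto
  qed simp
  let ?\<Omega> = "PiM (UNIV :: nat set) \<nu>"
  interpret \<Omega>: prob_space ?\<Omega> by (rule prob_space_PiM) (rule \<nu>)
  have ind: "\<Omega>.indep_vars (\<lambda>_. seq_space) (\<lambda>j \<omega>. \<omega> j) UNIV"
    by (rule indep_coords_seq_space(1)) (use \<nu> in auto)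
  have dist: "distr ?\<Omega> seq_space (\<lambda>\<omega>. \<omega> j) = \<nu> j" for j
    by (rule indep_coords_seq_space(2)) (use \<nu> in auto)
  have co[measurable]: "(\<lambda>\<omega>. \<omega> j) \<in> measurable ?\<Omega> seq_space" for j
    using ind by (simp add: \<Omega>.indep_vars_def)
  have co2[measurable]: "(\<lambda>\<omega>. \<omega> j i) \<in> borel_measurable ?\<Omega>" for j i
    using measurable_compose[OF co measurable_coord] .
  have "AE \<omega> in ?\<Omega>. summable (\<lambda>j. \<omega> j k)" for k
  proof (rule \<Omega>.indep_series_converges_AE)
    show "\<Omega>.indep_vars (\<lambda>_. borel) (\<lambda>j \<omega>. \<omega> j k) UNIV"
      by (rule \<Omega>.indep_vars_compose2[OF ind, of "\<lambda>_ x. x k"]) simp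
    have fs: "(\<lambda>i. t * unit_seq k i) \<in> finitely_supported" for t
      using finitely_supported_lin[OF unit_seq_finitely_supported zero_finitely_supported] by simp
    show "char (distr ?\<Omega> borel (\<lambda>\<omega>. \<omega> j k)) t = exp (\<kappa> j (\<lambda>i. t * unit_seq k i))" for j t
      by (subst \<Omega>.char_coord_eq[OF co]) (simp add: dist \<nu>(3)[OF fs])
    show "summable (\<lambda>j. norm (\<kappa> j (\<lambda>i. t * unit_seq k i)))" for t
      by (rule sum\<kappa>[OF fs])
  qed
  hence conv: "AE \<omega> in ?\<Omega>. \<forall>k. summable (\<lambda>j. \<omega> j k)"
    by (subst AE_all_countable) auto
  define \<xi> where "\<xi> \<omega> k = (\<Sum>j. \<omega> j k)" for \<omega> :: "nat \<Rightarrow> int \<Rightarrow> real" and k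
  have \<xi>[measurable]: "\<xi> \<in> measurable ?\<Omega> seq_space"
    by (rule measurable_into_seq_space) (simp add: \<xi>_def borel_measurable_suminf)
  have "(CLINT x|distr ?\<Omega> seq_space \<xi>. iexp (pairing a x)) = exp (CLINT x|R. levy_kernel a x)"
    if a: "a \<in> finitely_supported" for a
  proof -
    have "(\<lambda>n. CLINT \<omega>|?\<Omega>. iexp (\<Sum>j<n. pairing a (\<omega> j))) \<longlonglongrightarrow> (CLINT \<omega>|?\<Omega>. iexp (pairing a (\<xi> \<omega>)))"
    proof (rule integral_dominated_convergence[where w = "\<lambda>_. 1"])
      show "AE \<omega> in ?\<Omega>. (\<lambda>n. iexp (\<Sum>j<n. pairing a (\<omega> j))) \<longlonglongrightarrow> iexp (pairing a (\<xi> \<omega>))"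
        using conv
      proof eventually_elim
        case (elim \<omega>)
        have "(\<lambda>n. pairing a (\<lambda>k. \<Sum>j<n. \<omega> j k)) \<longlonglongrightarrow> pairing a (\<xi> \<omega>)"
          unfolding pairing_def \<xi>_def using elim
          by (intro tendsto_intros summable_LIMSEQ) auto
        thus ?case by (intro tendsto_intros) (simp add: pairing_sum_right)
      qed
    qed (auto intro!: \<Omega>.integrable_const)
    moreover have "(CLINT \<omega>|?\<Omega>. iexp (\<Sum>j<n. pairing a (\<omega> j))) = exp (\<Sum>j<n. \<kappa> j a)" for n
      by (subst \<Omega>.cf_indep_sum[OF ind]) (auto simp: dist \<nu>(3)[OF a] exp_sum)
    ultimately have "(\<lambda>n. exp (\<Sum>j<n. \<kappa> j a)) \<longlonglongrightarrow> (CLINT \<omega>|?\<Omega>. iexp (pairing a (\<xi> \<omega>)))" by simp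
    moreover have "(\<lambda>n. exp (\<Sum>j<n. \<kappa> j a)) \<longlonglongrightarrow> exp (CLINT x|R. levy_kernel a x)"
      by (intro tendsto_intros lim\<kappa> a)
    ultimately have "(CLINT \<omega>|?\<Omega>. iexp (pairing a (\<xi> \<omega>))) = exp (CLINT x|R. levy_kernel a x)"
      by (rule LIMSEQ_unique)
    thus ?thesis by (simp add: integral_distr)
  qed
  thus ?thesis
    by (intro exI[of _ "distr ?\<Omega> seq_space \<xi>"]) (auto intro!: \<Omega>.prob_space_distr)
qed

section \<open>Dissipativity and sections of the shift\<close>

text \<open>The power \<open>T^n\<close> of the shift for every integer \<open>n\<close>, as a group
  action; it spares the case split on the sign made by \<open>translate\<close>.\<close>

definition shift_by :: "int \<Rightarrow> (int \<Rightarrow> real) \<Rightarrow> int \<Rightarrow> real" where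
  "shift_by n x = (\<lambda>i. x (i + n))"

lemma shift_by_shift_by [simp]: "shift_by m (shift_by n x) = shift_by (m + n) x"
  by (simp add: shift_by_def algebra_simps)

lemma shift_by_0 [simp]: "shift_by 0 x = x"
  by (simp add: shift_by_def)

lemma shift_by_apply: "shift_by n x i = x (i + n)"
  by (simp add: shift_by_def)

lemma shift_by_measurable [measurable]: "shift_by n \<in> measurable seq_space seq_space"
  by (rule measurable_into_seq_space) (simp add: shift_by_def)

lemma shift_eq_shift_by: "shift = shift_by 1"
  by (simp add: shift_def shift_by_def fun_eq_iff)

lemma shift_funpow: "(shift ^^ n) = shift_by (int n)"
  by (induction n) (auto simp: fun_eq_iff shift_def shift_by_def algebra_simps)

lemma translate_shift:
  assumes "space M = UNIV"
  shows "translate M shift A = (\<lambda>n. shift_by n -` A)"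
proof (rule ext)
  fix n
  show "translate M shift A n = shift_by n -` A"
  proof (cases "n \<ge> 0")
    case True
    thus ?thesis using assms by (simp add: translate_def shift_funpow)
  next
    case False
    have "shift_by (- n) ` A = shift_by n -` A"
    proof (intro equalityI subsetI)
      fix x assume "x \<in> shift_by n -` A"
      hence "shift_by (- n) (shift_by n x) \<in> shift_by (- n) ` A" by blast
      thus "x \<in> shift_by (- n) ` A" by simp
    qed auto
    thus ?thesis using False by (simp add: translate_def shift_funpow)
  qed
qed

lemma distr_shift_by:
  assumes "measure_preserving Q shift" and sQ: "sets Q = sets seq_space"
  shows "distr Q seq_space (shift_by n) = Q"
proof -
  note [measurable_cong] = sQ
  have "distr Q Q shift = distr Q seq_space (shift_by 1)"
    unfolding shift_eq_shift_by by (intro distr_cong) (auto simp: sQ)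
  hence 1: "distr Q seq_space (shift_by 1) = Q" using assms by (simp add: measure_preserving_def)
  have nat: "distr Q seq_space (shift_by (int n)) = Q" for n
  proof (induction n)
    case 0
    have "distr Q seq_space (\<lambda>x. x) = distr Q Q (\<lambda>x. x)" by (intro distr_cong) (auto simp: sQ)
    thus ?case by (simp add: distr_id shift_by_0[abs_def])
  next
    case (Suc n)
    have "Q = distr (distr Q seq_space (shift_by 1)) seq_space (shift_by (int n))"
      unfolding 1 by (rule Suc.IH[symmetric])
    also have "\<dots> = distr Q seq_space (shift_by (int n) \<circ> shift_by 1)"
      by (rule distr_distr) measurable
    also have "shift_by (int n) \<circ> shift_by 1 = shift_by (int (Suc n))"
      by (simp add: fun_eq_iff algebra_simps)
    finally show ?case by simp
  qed
  show ?thesis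
  proof (cases "n \<ge> 0")
    case True
    thus ?thesis using nat[of "nat n"] by simp
  next
    case False
    define m where "m = nat (- n)"
    \<comment> \<open>\<open>Q\<close> is first written as its own image under
      \<open>shift_by (int m)\<close>, which \<open>shift_by n\<close> then undoes.\<close>
    have "distr Q seq_space (shift_by n) = distr (distr Q seq_space (shift_by (int m))) seq_space (shift_by n)"
      by (simp add: nat)
    also have "\<dots> = distr Q seq_space (shift_by n \<circ> shift_by (int m))"
      by (rule distr_distr) measurable
    also have "shift_by n \<circ> shift_by (int m) = shift_by (int 0)"
      using False by (simp add: fun_eq_iff m_def)
    finally show ?thesis by (simp only: nat)
  qed
qed

lemma section_exists:
  fixes r :: "(int \<Rightarrow> real) \<Rightarrow> real"
  assumes [measurable]: "r \<in> borel_measurable seq_space"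
  shows "\<exists>W\<in>sets seq_space. disjoint_family (\<lambda>n. shift_by n -` W) \<and>
    (\<forall>x. (\<forall>c>0. finite {n. c \<le> r (shift_by n x)}) \<longrightarrow> (\<exists>n. r (shift_by n x) > 0) \<longrightarrow> (\<exists>n. shift_by n x \<in> W))"
proof -
  \<comment> \<open>the points at which \<open>r\<close> attains for the first time its maximum along the orbit\<close>
  define W where "W = {x\<in>space seq_space. (\<forall>m. m \<ge> 0 \<or> r (shift_by m x) < r x) \<and> (\<forall>m. m \<le> 0 \<or> r (shift_by m x) \<le> r x)}"
  have WD: "x \<in> W \<longleftrightarrow> (\<forall>m<0. r (shift_by m x) < r x) \<and> (\<forall>m>0. r (shift_by m x) \<le> r x)" for x
    by (auto simp: W_def not_le[symmetric])
  have rm: "(\<lambda>x. r (shift_by m x)) \<in> borel_measurable seq_space" for m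
    by (rule measurable_compose[OF shift_by_measurable]) simp
  have "W \<in> sets seq_space" unfolding W_def
    by (intro sets.sets_Collect_conj sets.sets_Collect_countable_All sets.sets_Collect_disj
        sets.sets_Collect_const borel_measurable_less borel_measurable_le rm assms)
  moreover have "disjoint_family (\<lambda>n. shift_by n -` W)"
  proof -
    \<comment> \<open>Two first maxima at \<open>n < m\<close> on one orbit are incompatible: seen
      from \<open>n\<close>, the value at \<open>m\<close> is not larger; seen from
      \<open>m\<close>, the value at \<open>n\<close> is strictly smaller.\<close>
    have "False" if "n < m" "shift_by n x \<in> W" "shift_by m x \<in> W" for n m x
    proof -
      from that(2) have "r (shift_by (m - n) (shift_by n x)) \<le> r (shift_by n x)"
        unfolding WD using that(1) by (metis zero_less_diff diff_gt_0_iff_gt)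
      moreover from that(3) have "r (shift_by (n - m) (shift_by m x)) < r (shift_by m x)"
        unfolding WD using that(1) by (metis diff_less_0_iff_less)
      ultimately show False by simp
    qed
    thus ?thesis unfolding disjoint_family_on_def by (metis (no_types) Int_emptyI linorder_neqE_linordered_idom vimage_eq)
  qed
  moreover have "\<exists>n. shift_by n x \<in> W"
    if fin: "\<forall>c>0. finite {n. c \<le> r (shift_by n x)}" and ex: "r (shift_by n0 x) > 0" for x n0
  proof -
    define f where "f n = r (shift_by n x)" for n
    \<comment> \<open>The level \<open>f n0\<close> is positive, hence reached only finitely often;
      the maximum over these times is the maximum over the whole orbit.\<close>
    define S where "S = {n. f n0 \<le> f n}"
    have S: "finite S" "n0 \<in> S" using fin ex by (auto simp: S_def f_def)
    define v where "v = Max (f ` S)"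
    have v: "f n \<le> v" for n
    proof (cases "n \<in> S")
      case True thus ?thesis using S by (auto simp: v_def)
    next
      case False
      hence "f n \<le> f n0" by (simp add: S_def)
      also have "f n0 \<le> v" using S by (auto simp: v_def)
      finally show ?thesis .
    qed
    define S' where "S' = {n\<in>S. f n = v}"
    have "v \<in> f ` S" unfolding v_def by (rule Max_in) (use S in auto)
    hence S': "finite S'" "S' \<noteq> {}" using S by (auto simp: S'_def)
    define n where "n = Min S'"
    have n: "n \<in> S'" using S' by (simp add: n_def)
    have lt: "f m < v" if "m < n" for m
    proof (rule ccontr)
      assume "\<not> f m < v"
      hence "f m = v" using v[of m] by simp
      moreover from this have "m \<in> S" using v[of n0] by (simp add: S_def)
      ultimately have "m \<in> S'" by (simp add: S'_def)
      hence "n \<le> m" using S' by (simp add: n_def)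
      thus False using that by simp
    qed
    have fn: "f n = v" using n by (simp add: S'_def)
    have "shift_by n x \<in> W"
      unfolding WD using lt v fn by (auto simp: f_def[symmetric])
    thus ?thesis by blast
  qed
  ultimately show ?thesis by blast
qed

text \<open>Every translate of \<open>W\<close> is itself wandering, and countably many of them
  cover almost everything. A set that contains all wandering sets up to null sets therefore has full
  measure.\<close>

lemma dissipative_if_section:
  assumes Q: "measure_preserving Q shift" "sets Q = sets seq_space"
    and W: "W \<in> sets seq_space" "disjoint_family (\<lambda>n. shift_by n -` W)"
    and ae: "AE x in Q. \<exists>n. shift_by n x \<in> W"
  shows "dissipative Q shift"
proof -
  have sp: "space Q = UNIV" using sets_eq_imp_space_eq[OF Q(2)] by simp
  have meas: "shift_by n -` W \<in> sets Q" for n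
    using measurable_sets[OF shift_by_measurable W(1), of n] by (simp add: Q)
  have wand: "wandering Q shift (shift_by n -` W)" for n
  proof -
    have "disjoint_family (\<lambda>m. shift_by m -` (shift_by n -` W))"
    proof -
      have "shift_by m -` (shift_by n -` W) = shift_by (n + m) -` W" for m
        by auto
      moreover have "disjoint_family (\<lambda>m. shift_by (n + m) -` W)"
        using W(2) by (auto simp: disjoint_family_on_def)
      ultimately show ?thesis by simp
    qed
    thus ?thesis using meas by (simp add: wandering_def translate_shift[OF sp])
  qed
  have N: "UNIV - (\<Union>n. shift_by n -` W) \<in> null_sets Q"
  proof -
    have "UNIV - (\<Union>n. shift_by n -` W) \<in> sets Q"
      using sets.compl_sets[of "\<Union>n. shift_by n -` W" Q] meas sp by auto
    moreover have "AE x in Q. x \<notin> UNIV - (\<Union>n. shift_by n -` W)" using ae by eventually_elim auto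
    ultimately show ?thesis using AE_iff_null_sets by blast
  qed
  have "is_measurable_union Q {A. wandering Q shift A} UNIV"
    unfolding is_measurable_union_def
  proof (intro conjI ballI impI)
    show "UNIV \<in> sets Q" using sets.top[of Q] sp by simp
    fix E assume E: "E \<in> sets Q" "\<forall>A\<in>{A. wandering Q shift A}. A - E \<in> null_sets Q"
    have "(\<Union>n. shift_by n -` W - E) \<in> null_sets Q" using wand E(2) by (intro null_sets_UN) auto
    hence "(\<Union>n. shift_by n -` W - E) \<union> (UNIV - (\<Union>n. shift_by n -` W)) \<in> null_sets Q" using N by blast
    moreover have "UNIV - E \<in> sets Q" using E(1) sets.compl_sets[of E Q] sp by simp
    ultimately show "UNIV - E \<in> null_sets Q" by (rule null_sets_subset) auto
  qed auto
  thus ?thesis using Q sp unfolding dissipative_def by (intro conjI exI[of _ UNIV]) auto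
qed

section \<open>From dissipativity to a section\<close>

lemma nn_integral_shift_by:
  assumes Q: "measure_preserving Q shift" "sets Q = sets seq_space"
    and [measurable]: "f \<in> borel_measurable seq_space"
  shows "(\<integral>\<^sup>+ x. f (shift_by n x) \<partial>Q) = (\<integral>\<^sup>+ x. f x \<partial>Q)"
proof -
  note [measurable_cong] = Q(2)
  have "(\<integral>\<^sup>+ x. f x \<partial>Q) = (\<integral>\<^sup>+ x. f x \<partial>distr Q seq_space (shift_by n))" by (simp add: distr_shift_by Q)
  also have "\<dots> = (\<integral>\<^sup>+ x. f (shift_by n x) \<partial>Q)" by (rule nn_integral_distr) measurable
  finally show ?thesis by simp
qed

lemma finite_ge_if_tendsto_0:
  fixes f :: "int \<Rightarrow> real"
  assumes "(\<lambda>n. f (int n)) \<longlonglongrightarrow> 0" "(\<lambda>n. f (- int n - 1)) \<longlonglongrightarrow> 0" "c > 0"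
  shows "finite {n. c \<le> f n}"
proof -
  obtain N1 where N1: "\<And>n. n \<ge> N1 \<Longrightarrow> f (int n) < c"
    using order_tendstoD(2)[OF assms(1,3)] by (auto simp: eventually_sequentially)
  obtain N2 where N2: "\<And>n. n \<ge> N2 \<Longrightarrow> f (- int n - 1) < c"
    using order_tendstoD(2)[OF assms(2,3)] by (auto simp: eventually_sequentially)
  have "{n. c \<le> f n} \<subseteq> {- int N2 .. int N1}"
  proof
    fix n assume n: "n \<in> {n. c \<le> f n}"
    have "n \<le> int N1" 
    proof (rule ccontr)
      assume "\<not> n \<le> int N1"
      hence "f (int (nat n)) < c" by (intro N1) auto
      thus False using n \<open>\<not> n \<le> int N1\<close> by simp
    qed
    moreover have "- int N2 \<le> n"
    proof (rule ccontr)
      assume *: "\<not> - int N2 \<le> n"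
      hence "f (- int (nat (- n - 1)) - 1) < c" by (intro N2) auto
      thus False using n * by simp
    qed
    ultimately show "n \<in> {- int N2 .. int N1}" by simp
  qed
  thus ?thesis by (rule finite_subset) simp
qed

lemma AE_neq_zero:
  assumes "stationary_Levy_measure Q"
  shows "AE x in Q. x \<noteq> (\<lambda>_. 0)"
proof -
  have "{\<lambda>_. 0} = {x\<in>space seq_space. \<forall>i. x i = 0}" by auto
  also have "\<dots> \<in> sets seq_space" by measurable
  finally have "{\<lambda>_. 0} \<in> null_sets Q" using assms by (auto simp: stationary_Levy_measure_def null_sets_def)
  from AE_not_in[OF this] show ?thesis by simp
qed

text \<open>The wandering sets may form an uncountable family, so null sets cannot be collected over
  it. Instead one measurable set \<open>E\<close>, where the orbit sum \<open>s\<close> is finite,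
  contains each wandering set up to a null set, and the minimality of the measurable union puts
  \<open>D\<close> into \<open>E\<close>.\<close>

lemma section_if_dissipative:
  assumes Q: "stationary_Levy_measure Q" and diss: "dissipative Q shift"
  shows "\<exists>W\<in>sets seq_space. disjoint_family (\<lambda>n. shift_by n -` W) \<and> (AE x in Q. \<exists>n. shift_by n x \<in> W)"
proof -
  have mp: "measure_preserving Q shift" and sQ: "sets Q = sets seq_space"
    using Q by (auto simp: stationary_Levy_measure_def)
  have sp: "space Q = UNIV" using sets_eq_imp_space_eq[OF sQ] by simp
  note [measurable_cong] = sQ
  define f where "f x = min ((x 0)\<^sup>2) (1::real)" for x :: "int \<Rightarrow> real"
  have fm[measurable]: "f \<in> borel_measurable seq_space" unfolding f_def[abs_def] by measurable
  have f0: "f x \<ge> 0" for x by (simp add: f_def)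
  define s where "s x = (\<Sum>n. ennreal (f (shift_by (int n) x))) + (\<Sum>n. ennreal (f (shift_by (- int n - 1) x)))" for x
  have [measurable]: "s \<in> borel_measurable seq_space" unfolding s_def[abs_def] by measurable
  define E where "E = {x\<in>space Q. s x < \<infinity>}"
  have E: "E \<in> sets Q" unfolding E_def by measurable
  have null: "A - E \<in> null_sets Q" if "wandering Q shift A" for A
  proof -
    have [measurable]: "A \<in> sets seq_space" and disj: "disjoint_family (\<lambda>n. shift_by n -` A)"
      using that by (auto simp: wandering_def translate_shift[OF sp] sQ)
    \<comment> \<open>Invariance moves the shift from \<open>f\<close> to \<open>A\<close>; the
      translates of \<open>A\<close> are disjoint, so their indicators add up to at most 1. An
      injective \<open>g\<close> serves for either half of the orbit.\<close>
    have half: "(\<integral>\<^sup>+ x. indicator A x * (\<Sum>n. ennreal (f (shift_by (g n) x))) \<partial>Q) \<le> (\<integral>\<^sup>+ x. ennreal (f x) \<partial>Q)"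
      if g: "inj g" for g :: "nat \<Rightarrow> int"
    proof -
      have "(\<integral>\<^sup>+ x. indicator A x * (\<Sum>n. ennreal (f (shift_by (g n) x))) \<partial>Q)
         = (\<Sum>n. \<integral>\<^sup>+ x. indicator A x * ennreal (f (shift_by (g n) x)) \<partial>Q)"
        by (simp add: nn_integral_suminf[symmetric])
      also have "\<dots> = (\<Sum>n. \<integral>\<^sup>+ x. indicator (shift_by (- g n) -` A) x * ennreal (f x) \<partial>Q)"
      proof (rule suminf_cong)
        fix n
        have [measurable]: "shift_by (- g n) -` A \<in> sets seq_space"
          using measurable_sets[OF shift_by_measurable \<open>A \<in> sets seq_space\<close>, of "- g n"] by simp
        show "(\<integral>\<^sup>+ x. indicator A x * ennreal (f (shift_by (g n) x)) \<partial>Q) = (\<integral>\<^sup>+ x. indicator (shift_by (- g n) -` A) x * ennreal (f x) \<partial>Q)"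
          by (subst nn_integral_shift_by[OF mp sQ, of "\<lambda>x. indicator (shift_by (- g n) -` A) x * ennreal (f x)" "g n", symmetric])
            (auto simp: indicator_def)
      qed
      also have "\<dots> = (\<integral>\<^sup>+ x. (\<Sum>n. indicator (shift_by (- g n) -` A) x * ennreal (f x)) \<partial>Q)"
      proof (rule nn_integral_suminf[symmetric])
        fix n
        have [measurable]: "shift_by (- g n) -` A \<in> sets seq_space"
          using measurable_sets[OF shift_by_measurable \<open>A \<in> sets seq_space\<close>, of "- g n"] by simp
        show "(\<lambda>x. indicator (shift_by (- g n) -` A) x * ennreal (f x)) \<in> borel_measurable Q" by measurable
      qed
      also have "\<dots> \<le> (\<integral>\<^sup>+ x. ennreal (f x) \<partial>Q)"
      proof (rule nn_integral_mono)
        fix x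
        have "disjoint_family (\<lambda>n. shift_by (- g n) -` A)"
          unfolding disjoint_family_on_def
        proof (intro ballI impI)
          fix m n :: nat assume "m \<noteq> n"
          hence "- g m \<noteq> - g n" using g by (auto dest: injD)
          thus "shift_by (- g m) -` A \<inter> shift_by (- g n) -` A = {}"
            using disj unfolding disjoint_family_on_def by blast
        qed
        hence "(\<Sum>n. indicator (shift_by (- g n) -` A) x :: ennreal) = indicator (\<Union>n. shift_by (- g n) -` A) x"
          by (rule suminf_indicator)
        thus "(\<Sum>n. indicator (shift_by (- g n) -` A) x * ennreal (f x)) \<le> ennreal (f x)"
          by (simp add: ennreal_suminf_multc indicator_def)
      qed
      finally show ?thesis .
    qed
    have "(\<integral>\<^sup>+ x. indicator A x * s x \<partial>Q) \<le> (\<integral>\<^sup>+ x. ennreal (f x) \<partial>Q) + (\<integral>\<^sup>+ x. ennreal (f x) \<partial>Q)"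
    proof -
      have "(\<integral>\<^sup>+ x. indicator A x * s x \<partial>Q) = (\<integral>\<^sup>+ x. indicator A x * (\<Sum>n. ennreal (f (shift_by (int n) x))) \<partial>Q)
         + (\<integral>\<^sup>+ x. indicator A x * (\<Sum>n. ennreal (f (shift_by (- int n - 1) x))) \<partial>Q)"
        unfolding s_def distrib_left by (rule nn_integral_add) measurable
      also have "\<dots> \<le> (\<integral>\<^sup>+ x. ennreal (f x) \<partial>Q) + (\<integral>\<^sup>+ x. ennreal (f x) \<partial>Q)"
        by (intro add_mono half) (auto simp: inj_def)
      finally show ?thesis .
    qed
    also have "\<dots> < \<infinity>" using Q by (simp add: stationary_Levy_measure_def f_def)
    finally have "AE x in Q. indicator A x * s x \<noteq> \<infinity>"
      by (intro nn_integral_noteq_infinite) auto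
    hence "AE x in Q. x \<notin> A - E"
      by eventually_elim (auto simp: E_def sp less_top)
    moreover have "A - E \<in> sets Q" using E by measurable
    ultimately show ?thesis using AE_iff_null_sets by blast
  qed
  obtain D where D: "is_measurable_union Q {A. wandering Q shift A} D" "space Q - D \<in> null_sets Q"
    using diss by (auto simp: dissipative_def)
  hence "D - E \<in> null_sets Q" using null E by (auto simp: is_measurable_union_def)
  from this D(2) have aeE: "AE x in Q. x \<in> E"
    using AE_not_in[of "D - E" Q] AE_not_in[of "space Q - D" Q] by (auto simp: sp)
  obtain W where W: "W \<in> sets seq_space" "disjoint_family (\<lambda>n. shift_by n -` W)"
    and WE: "\<forall>x. (\<forall>c>0. finite {n. c \<le> f (shift_by n x)}) \<longrightarrow> (\<exists>n. f (shift_by n x) > 0) \<longrightarrow> (\<exists>n. shift_by n x \<in> W)"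
    using bexE[OF section_exists[OF fm]] by metis
  have "AE x in Q. \<exists>n. shift_by n x \<in> W"
    using aeE AE_neq_zero[OF Q]
  proof eventually_elim
    case (elim x)
    have "(\<lambda>n. f (shift_by (g n) x)) \<longlonglongrightarrow> 0" if "(\<Sum>n. ennreal (f (shift_by (g n) x))) < \<infinity>" for g
      using that f0 by (intro summable_LIMSEQ_zero summable_suminf_not_top) auto
    hence "\<forall>c>0. finite {n. c \<le> f (shift_by n x)}"
      using elim(1) by (intro allI impI finite_ge_if_tendsto_0) (auto simp: E_def s_def)
    moreover obtain n where "x n \<noteq> 0" using elim(2) by (auto simp: fun_eq_iff)
    hence "f (shift_by n x) > 0" by (simp add: f_def shift_by_apply)
    ultimately show ?case using WE by blast
  qed
  thus ?thesis using W by blast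
qed

section \<open>Characteristic functionals of generalized moving averages\<close>

text \<open>The adjoint of a shift is the opposite shift; time lags of the copies thereby become
  shifts of the frequency.\<close>

lemma pairing_shift_by:
  assumes "a \<in> finitely_supported"
  shows "pairing (shift_by j a) x = pairing a (shift_by (- j) x)"
proof -
  have "pairing a (shift_by (- j) x) = (\<Sum>i | a i \<noteq> 0. a i * x (i - j))"
    by (simp add: pairing_def shift_by_def)
  also have "\<dots> = (\<Sum>i | a (i + j) \<noteq> 0. a (i + j) * x i)"
    by (rule sum.reindex_bij_witness[of _ "\<lambda>i. i + j" "\<lambda>i. i - j"]) auto
  finally show ?thesis by (simp add: pairing_def shift_by_def)
qed

lemma finitely_supported_shift_by:
  assumes "a \<in> finitely_supported"
  shows "shift_by j a \<in> finitely_supported"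
proof -
  have "{i. shift_by j a i \<noteq> 0} = (\<lambda>i. i - j) ` {i. a i \<noteq> 0}"
    by (auto simp: shift_by_def image_def)
  thus ?thesis using assms by (simp add: finitely_supported_def)
qed

lemma sum_int_interval_split:
  fixes f :: "int \<Rightarrow> 'a::comm_monoid_add"
  shows "sum f {- int q..<int p} = (\<Sum>k<p. f (int k)) + (\<Sum>k<q. f (- int k - 1))"
proof -
  have "{- int q..<int p} = int ` {..<p} \<union> (\<lambda>k. - int k - 1) ` {..<q}" (is "_ = ?A \<union> ?B")
  proof (intro equalityI subsetI)
    fix i assume i: "i \<in> {- int q..<int p}"
    show "i \<in> ?A \<union> ?B"
    proof (cases "i \<ge> 0")
      case True thus ?thesis using i by (intro UnI1 image_eqI[of _ _ "nat i"]) auto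
    next
      case False thus ?thesis using i by (intro UnI2 image_eqI[of _ _ "nat (- i - 1)"]) auto
    qed
  qed auto
  moreover have "sum f (?A \<union> ?B) = sum f ?A + sum f ?B" by (rule sum.union_disjoint) auto
  moreover have "sum f ?A = (\<Sum>k<p. f (int k))" by (subst sum.reindex) (auto simp: inj_on_def)
  moreover have "sum f ?B = (\<Sum>k<q. f (- int k - 1))" by (subst sum.reindex) (auto simp: inj_on_def)
  ultimately show ?thesis by simp
qed

text \<open>Windows centred at \<open>n\<close> arise because a copy with index \<open>j\<close> in
  \<open>{- int J..int J}\<close> reaches time \<open>n\<close> through the lag
  \<open>k = n - j\<close>. The numbers of nonnegative and of negative lags in the window are
  \<open>?p J\<close> and \<open>?q J\<close> once \<open>J\<close> is at least
  \<open>\<bar>n\<bar>\<close>.\<close>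

lemma bi_summable_tendsto:
  assumes "bi_summable f"
  shows "(\<lambda>J. \<Sum>k\<in>{n - int J..n + int J}. f k) \<longlonglongrightarrow> bi_suminf f"
proof -
  let ?p = "\<lambda>J. nat (n + int J + 1)" and ?q = "\<lambda>J. nat (int J - n)"
  have p: "filterlim ?p at_top sequentially" "filterlim ?q at_top sequentially"
    unfolding filterlim_at_top eventually_sequentially
  proof -
    have "Z \<le> ?p J" "Z \<le> ?q J" if "Z + nat \<bar>n\<bar> \<le> J" for Z J using that by linarith+
    thus "\<forall>Z. \<exists>N. \<forall>J\<ge>N. Z \<le> ?p J" "\<forall>Z. \<exists>N. \<forall>J\<ge>N. Z \<le> ?q J" by blast+
  qed
  have "(\<lambda>J. (\<Sum>k<?p J. f (int k)) + (\<Sum>k<?q J. f (- int k - 1))) \<longlonglongrightarrow> bi_suminf f"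
    unfolding bi_suminf_def using assms
    by (intro tendsto_add filterlim_compose[OF summable_LIMSEQ p(1)] filterlim_compose[OF summable_LIMSEQ p(2)])
      (auto simp: bi_summable_def)
  moreover have "eventually (\<lambda>J. (\<Sum>k<?p J. f (int k)) + (\<Sum>k<?q J. f (- int k - 1)) = (\<Sum>k\<in>{n - int J..n + int J}. f k)) sequentially"
    unfolding eventually_sequentially
  proof (intro exI[of _ "nat \<bar>n\<bar>"] allI impI)
    fix J assume "nat \<bar>n\<bar> \<le> J"
    hence "{n - int J..n + int J} = {- int (?q J)..<int (?p J)}" by auto
    thus "(\<Sum>k<?p J. f (int k)) + (\<Sum>k<?q J. f (- int k - 1)) = (\<Sum>k\<in>{n - int J..n + int J}. f k)"
      by (simp only: sum_int_interval_split)
  qed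
  ultimately show ?thesis by (rule Lim_transform_eventually)
qed

text \<open>Keep only the copies with index in \<open>{- int J..int J}\<close>. The copy
  \<open>j\<close> enters the moving average shifted by \<open>- j\<close>, hence is tested with
  \<open>shift_by j a\<close>. Independence gives the product; almost sure convergence at finitely
  many times and dominated convergence give the limit.\<close>

lemma cf_gma_tendsto:
  assumes rep: "gma_representation M \<xi> P" and a: "a \<in> finitely_supported"
  shows "(\<lambda>J. \<Prod>j\<in>{- int J..int J}. CLINT x|distr M seq_space (\<xi> 0). iexp (pairing (shift_by j a) x))
    \<longlonglongrightarrow> (CLINT x|P. iexp (pairing a x))"
proof -
  have iid: "iid_processes M UNIV \<xi>" and P: "P = distr M seq_space (\<lambda>\<omega> n. bi_suminf (\<lambda>k. \<xi> (n - k) \<omega> k))"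
    and bs: "\<And>n. AE \<omega> in M. bi_summable (\<lambda>k. \<xi> (n - k) \<omega> k)"
    using rep by (auto simp: gma_representation_def)
  interpret prob_space M using iid by (simp add: iid_processes_def)
  have ind: "indep_vars (\<lambda>_. seq_space) \<xi> UNIV" and dist: "\<And>j. distr M seq_space (\<xi> j) = distr M seq_space (\<xi> 0)"
    using iid by (auto simp: iid_processes_def)
  have rv[measurable]: "\<xi> j \<in> measurable M seq_space" for j using ind by (simp add: indep_vars_def)
  have rv2[measurable]: "(\<lambda>\<omega>. \<xi> j \<omega> k) \<in> borel_measurable M" for j k
    using measurable_compose[OF rv measurable_coord] .
  let ?X = "\<lambda>\<omega> n. bi_suminf (\<lambda>k. \<xi> (n - k) \<omega> k)"
  have X[measurable]: "?X \<in> measurable M seq_space"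
    by (rule measurable_into_seq_space) (simp add: bi_suminf_def borel_measurable_suminf)
  have "(\<lambda>J. CLINT \<omega>|M. iexp (\<Sum>j\<in>{- int J..int J}. pairing (shift_by j a) (\<xi> j \<omega>))) \<longlonglongrightarrow> (CLINT \<omega>|M. iexp (pairing a (?X \<omega>)))"
  proof (rule integral_dominated_convergence[where w = "\<lambda>_. 1"])
    have "AE \<omega> in M. \<forall>n. bi_summable (\<lambda>k. \<xi> (n - k) \<omega> k)"
      using bs by (subst AE_all_countable) auto
    thus "AE \<omega> in M. (\<lambda>J. iexp (\<Sum>j\<in>{- int J..int J}. pairing (shift_by j a) (\<xi> j \<omega>))) \<longlonglongrightarrow> iexp (pairing a (?X \<omega>))"
    proof eventually_elim
      case (elim \<omega>)
      have "(\<lambda>J. \<Sum>j\<in>{- int J..int J}. \<xi> j \<omega> (n - j)) \<longlonglongrightarrow> ?X \<omega> n" for n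
      proof -
        have "(\<Sum>j\<in>{- int J..int J}. \<xi> j \<omega> (n - j)) = (\<Sum>k\<in>{n - int J..n + int J}. \<xi> (n - k) \<omega> k)" for J
          by (rule sum.reindex_bij_witness[of _ "\<lambda>k. n - k" "\<lambda>j. n - j"]) auto
        thus ?thesis using bi_summable_tendsto[of _ n] elim by simp
      qed
      hence "(\<lambda>J. pairing a (\<lambda>n. \<Sum>j\<in>{- int J..int J}. shift_by (- j) (\<xi> j \<omega>) n)) \<longlonglongrightarrow> pairing a (?X \<omega>)"
        unfolding pairing_def by (intro tendsto_intros) (simp add: shift_by_def)
      hence "(\<lambda>J. \<Sum>j\<in>{- int J..int J}. pairing (shift_by j a) (\<xi> j \<omega>)) \<longlonglongrightarrow> pairing a (?X \<omega>)"
        by (simp add: pairing_sum_right pairing_shift_by[OF a])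
      thus ?case by (intro tendsto_intros)
    qed
  qed (auto intro!: integrable_const)
  moreover have "(CLINT \<omega>|M. iexp (\<Sum>j\<in>{- int J..int J}. pairing (shift_by j a) (\<xi> j \<omega>)))
     = (\<Prod>j\<in>{- int J..int J}. CLINT x|distr M seq_space (\<xi> 0). iexp (pairing (shift_by j a) x))" for J
  proof -
    have "(CLINT \<omega>|M. iexp (\<Sum>j\<in>{- int J..int J}. pairing (shift_by j a) (\<xi> j \<omega>)))
       = (\<Prod>j\<in>{- int J..int J}. CLINT x|distr M seq_space (\<xi> j). iexp (pairing (shift_by j a) x))"
      by (rule cf_indep_sum[OF ind]) auto
    also have "\<dots> = (\<Prod>j\<in>{- int J..int J}. CLINT x|distr M seq_space (\<xi> 0). iexp (pairing (shift_by j a) x))"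
      by (rule prod.cong[OF refl], subst dist, rule refl)
    finally show ?thesis .
  qed
  moreover have "(CLINT x|P. iexp (pairing a x)) = (CLINT \<omega>|M. iexp (pairing a (?X \<omega>)))"
    unfolding P by (subst integral_distr) auto
  ultimately show ?thesis by simp
qed

section \<open>Cosine polynomials and positivity\<close>

definition cos_poly :: "(real \<times> (int \<Rightarrow> real)) list \<Rightarrow> (int \<Rightarrow> real) \<Rightarrow> real" where
  "cos_poly p x = (\<Sum>(c, a)\<leftarrow>p. c * cos (pairing a x))"

text \<open>Polynomials are kept as lists because this functional reads the coefficients. For the
  functionals of interest, on polynomials vanishing at 0, positivity will make the value depend on
  the function alone.\<close>

definition cos_coeff_sum :: "((int \<Rightarrow> real) \<Rightarrow> real) \<Rightarrow> (real \<times> (int \<Rightarrow> real)) list \<Rightarrow> real" where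
  "cos_coeff_sum l p = (\<Sum>(c, a)\<leftarrow>p. c * l a)"

definition fs_frequencies :: "(real \<times> (int \<Rightarrow> real)) list \<Rightarrow> bool" where
  "fs_frequencies p \<longleftrightarrow> (\<forall>(c, a)\<in>set p. a \<in> finitely_supported)"

lemma cos_poly_simps [simp]:
  "cos_poly [] x = 0" "cos_poly ((c, a) # p) x = c * cos (pairing a x) + cos_poly p x"
  "cos_poly (p @ q) x = cos_poly p x + cos_poly q x"
  by (simp_all add: cos_poly_def)

lemma cos_coeff_sum_simps [simp]:
  "cos_coeff_sum l [] = 0" "cos_coeff_sum l ((c, a) # p) = c * l a + cos_coeff_sum l p"
  "cos_coeff_sum l (p @ q) = cos_coeff_sum l p + cos_coeff_sum l q"
  by (simp_all add: cos_coeff_sum_def)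

lemma fs_frequencies_simps [simp]:
  "fs_frequencies []" "fs_frequencies ((c, a) # p) \<longleftrightarrow> a \<in> finitely_supported \<and> fs_frequencies p"
  "fs_frequencies (p @ q) \<longleftrightarrow> fs_frequencies p \<and> fs_frequencies q"
  by (auto simp: fs_frequencies_def)

definition cos_scale :: "real \<Rightarrow> (real \<times> (int \<Rightarrow> real)) list \<Rightarrow> (real \<times> (int \<Rightarrow> real)) list" where
  "cos_scale s p = map (\<lambda>(c, a). (s * c, a)) p"

lemma cos_scale_simps [simp]:
  "cos_poly (cos_scale s p) x = s * cos_poly p x"
  "cos_coeff_sum l (cos_scale s p) = s * cos_coeff_sum l p"
  "fs_frequencies (cos_scale s p) \<longleftrightarrow> fs_frequencies p"
  by (induction p; auto simp: cos_scale_def algebra_simps)+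

text \<open>The product-to-sum formula makes the cosine polynomials an algebra, so the test
  functions of the converse, which are products, stay within reach of
  \<open>cos_coeff_sum\<close>.\<close>

lemma cos_poly_mult_exists:
  assumes "fs_frequencies p" "fs_frequencies q"
  shows "\<exists>r. fs_frequencies r \<and> (\<forall>x. cos_poly r x = cos_poly p x * cos_poly q x)"
proof -
  have mono: "\<exists>r. fs_frequencies r \<and> (\<forall>x. cos_poly r x = c * cos (pairing a x) * cos_poly q x)"
    if a: "a \<in> finitely_supported" and q: "fs_frequencies q" for c a q
    using q
  proof (induction q)
    case Nil
    show ?case by (intro exI[of _ "[]"]) simp
  next
    case (Cons h q)
    obtain d b where h: "h = (d, b)" by (cases h)
    have b: "b \<in> finitely_supported" "fs_frequencies q" using Cons.prems by (simp_all add: h)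
    obtain r where r: "fs_frequencies r" "\<And>x. cos_poly r x = c * cos (pairing a x) * cos_poly q x"
      using Cons.IH b(2) by blast
    let ?s = "(c * d / 2, \<lambda>i. 1 * a i + 1 * b i) # (c * d / 2, \<lambda>i. 1 * a i + (-1) * b i) # r"
    have "fs_frequencies ?s" 
      unfolding fs_frequencies_simps using r(1) finitely_supported_lin[OF a b(1)] by blast
    moreover have "cos_poly ?s x = c * cos (pairing a x) * cos_poly (h # q) x" for x
      unfolding h cos_poly_simps pairing_lin[OF a b(1)] r(2)
      by (simp add: cos_add cos_diff algebra_simps)
    ultimately show ?case by blast
  qed
  show ?thesis using assms(1)
  proof (induction p)
    case Nil
    show ?case by (intro exI[of _ "[]"]) simp
  next
    case (Cons h p)
    obtain c a where h: "h = (c, a)" by (cases h)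
    obtain r1 where r1: "fs_frequencies r1" "\<And>x. cos_poly r1 x = c * cos (pairing a x) * cos_poly q x"
      using mono assms(2) Cons.prems h by fastforce
    obtain r2 where r2: "fs_frequencies r2" "\<And>x. cos_poly r2 x = cos_poly p x * cos_poly q x"
      using Cons h by auto
    show ?case
      by (intro exI[of _ "r1 @ r2"]) (simp add: r1 r2 h algebra_simps)
  qed
qed

lemma cos_poly_prod_exists:
  assumes "finite I" "\<And>i. i \<in> I \<Longrightarrow> fs_frequencies (p i)"
  shows "\<exists>r. fs_frequencies r \<and> (\<forall>x. cos_poly r x = (\<Prod>i\<in>I. cos_poly (p i) x))"
  using assms
proof (induction I)
  case empty
  show ?case by (intro exI[of _ "[(1, \<lambda>_. 0)]"]) simp
next
  case (insert i I)
  obtain r where r: "fs_frequencies r" "\<And>x. cos_poly r x = (\<Prod>i\<in>I. cos_poly (p i) x)"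
    using insert by auto
  show ?case using cos_poly_mult_exists[of "p i" r] insert r by auto
qed

lemma cos_poly_integral_shifted:
  assumes K: "prob_space K" "sets K = sets seq_space"
  defines "C \<equiv> \<lambda>a. LINT x|K. cos (pairing a x)" and "S \<equiv> \<lambda>a. LINT x|K. sin (pairing a x)"
  shows "integrable K (\<lambda>y. cos_poly p (\<lambda>i. x i - y i)) \<and>
    (LINT y|K. cos_poly p (\<lambda>i. x i - y i)) = (\<Sum>(c, a)\<leftarrow>p. c * (cos (pairing a x) * C a + sin (pairing a x) * S a))"
proof -
  interpret K: prob_space K by fact
  note [measurable_cong] = K(2)
  have ic: "integrable K (\<lambda>x. cos (pairing a x))" "integrable K (\<lambda>x. sin (pairing a x))" for a
    by (rule K.integrable_const_bound[where B = 1]; simp)+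
  show ?thesis
  proof (induction p)
    case (Cons h p)
    obtain c a where h: "h = (c, a)" by (cases h)
    have *: "cos_poly (h # p) (\<lambda>i. x i - y i) = c * (cos (pairing a x) * cos (pairing a y) + sin (pairing a x) * sin (pairing a y))
        + cos_poly p (\<lambda>i. x i - y i)" for y
      by (simp add: h pairing_diff_right cos_diff)
    show ?case unfolding * using Cons ic by (simp add: h C_def S_def)
  qed simp
qed

text \<open>The squared modulus is the characteristic functional of \<open>X - Y\<close> for
  independent \<open>X\<close> and \<open>Y\<close> of law \<open>K\<close>, so the sum is the
  expectation of the polynomial at \<open>X - Y\<close>; \<open>h\<close> is its conditional
  expectation given \<open>X\<close>.\<close>

lemma cos_poly_char_functional_nonneg:
  assumes K: "prob_space K" "sets K = sets seq_space" and pos: "\<And>x. cos_poly p x \<ge> 0"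
  shows "cos_coeff_sum (\<lambda>a. (norm (CLINT x|K. iexp (pairing a x)))\<^sup>2) p \<ge> 0"
proof -
  interpret K: prob_space K by fact
  note [measurable_cong] = K(2)
  define C where "C a = (LINT x|K. cos (pairing a x))" for a
  define S where "S a = (LINT x|K. sin (pairing a x))" for a
  have ic: "integrable K (\<lambda>x. cos (pairing a x))" "integrable K (\<lambda>x. sin (pairing a x))" for a
    by (rule K.integrable_const_bound[where B = 1]; simp)+
  have nrm: "(norm (CLINT x|K. iexp (pairing a x)))\<^sup>2 = (C a)\<^sup>2 + (S a)\<^sup>2" for a
  proof -
    have i: "integrable K (\<lambda>x. iexp (pairing a x))" by (rule K.integrable_const_bound[where B = 1]) simp_all
    have "Re (CLINT x|K. iexp (pairing a x)) = C a" "Im (CLINT x|K. iexp (pairing a x)) = S a"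
      using integral_Re[OF i] integral_Im[OF i] by (simp_all add: C_def S_def Re_exp Im_exp)
    thus ?thesis by (simp add: cmod_power2)
  qed
  define h where "h x = (\<Sum>(c, a)\<leftarrow>p. c * (cos (pairing a x) * C a + sin (pairing a x) * S a))" for x
  have h0: "h x \<ge> 0" for x
  proof -
    have "h x = (LINT y|K. cos_poly p (\<lambda>i. x i - y i))"
      unfolding h_def C_def S_def using cos_poly_integral_shifted[OF K] by simp
    also have "\<dots> \<ge> 0" by (simp add: integral_nonneg_AE pos)
    finally show ?thesis .
  qed
  have "integrable K (\<lambda>x. (\<Sum>(c, a)\<leftarrow>q. c * (cos (pairing a x) * C a + sin (pairing a x) * S a))) \<and>
     (LINT x|K. (\<Sum>(c, a)\<leftarrow>q. c * (cos (pairing a x) * C a + sin (pairing a x) * S a))) = cos_coeff_sum (\<lambda>a. (C a)\<^sup>2 + (S a)\<^sup>2) q" for q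
  proof (induction q)
    case (Cons h q)
    obtain c a where h: "h = (c, a)" by (cases h)
    show ?case using Cons ic by (simp add: h C_def[symmetric] S_def[symmetric] power2_eq_square)
  qed simp
  hence "cos_coeff_sum (\<lambda>a. (C a)\<^sup>2 + (S a)\<^sup>2) p = (LINT x|K. h x)" by (simp add: h_def)
  also have "\<dots> \<ge> 0" by (simp add: integral_nonneg_AE h0)
  finally show ?thesis by (simp add: nrm)
qed

section \<open>Logarithms of infinitely divisible characteristic functionals\<close>

lemma infinitely_divisible_root:
  assumes "infinitely_divisible G" "k \<ge> 1"
  shows "\<exists>K. prob_space K \<and> sets K = sets seq_space \<and>
    (\<forall>a. (CLINT x|G. iexp (pairing a x)) = (CLINT x|K. iexp (pairing a x)) ^ k)"
proof -
  obtain M :: "(nat \<Rightarrow> int \<Rightarrow> real) measure" and Y where iid: "iid_processes M {..<k} Y"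
    and G: "distr M seq_space (\<lambda>\<omega> n. \<Sum>j<k. Y j \<omega> n) = G"
    using assms unfolding infinitely_divisible_def by blast
  interpret prob_space M using iid by (simp add: iid_processes_def)
  have ind: "indep_vars (\<lambda>_. seq_space) Y {..<k}" using iid by (simp add: iid_processes_def)
  have rv: "Y j \<in> measurable M seq_space" if "j < k" for j using ind that by (simp add: indep_vars_def)
  define K where "K = distr M seq_space (Y 0)"
  have dist: "distr M seq_space (Y j) = K" if "j < k" for j
    using iid that unfolding iid_processes_def K_def by (metis gr_implies_not0 lessThan_iff neq0_conv)
  have m: "(\<lambda>\<omega> n. \<Sum>j<k. Y j \<omega> n) \<in> measurable M seq_space"
    by (rule measurable_into_seq_space) (auto intro!: borel_measurable_sum measurable_compose[OF rv measurable_coord])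
  have "(CLINT x|G. iexp (pairing a x)) = (CLINT x|K. iexp (pairing a x)) ^ k" for a
  proof -
    have "(CLINT x|G. iexp (pairing a x)) = (CLINT \<omega>|M. iexp (\<Sum>j<k. pairing a (Y j \<omega>)))"
      unfolding G[symmetric] by (subst integral_distr[OF m]) (simp_all only: pairing_sum_right, measurable)
    also have "\<dots> = (\<Prod>j<k. CLINT x|distr M seq_space (Y j). iexp (pairing a x))"
      by (rule cf_indep_sum[OF ind]) auto
    also have "\<dots> = (CLINT x|K. iexp (pairing a x)) ^ k" by (simp add: dist)
    finally show ?thesis .
  qed
  moreover have "prob_space K" unfolding K_def by (rule prob_space_distr) (use assms rv in auto)
  ultimately show ?thesis by (intro exI[of _ K]) (simp add: K_def)
qed

lemma tendsto_scaled_exp: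
  fixes L :: real
  shows "(\<lambda>k. real (Suc k) * (exp (L / real (Suc k)) - 1)) \<longlonglongrightarrow> L"
proof -
  have "((\<lambda>t. (exp (L * t) - 1) / t) \<longlongrightarrow> L) (at 0)"
  proof -
    have "((\<lambda>t. exp (L * t)) has_real_derivative L) (at 0)" by (auto intro!: derivative_eq_intros)
    from DERIV_D[OF this] show ?thesis by simp
  qed
  moreover have "filterlim (\<lambda>k. inverse (real (Suc k))) (at 0) sequentially"
    unfolding filterlim_at using LIMSEQ_inverse_real_of_nat by auto
  ultimately have "((\<lambda>k. (exp (L * inverse (real (Suc k))) - 1) / inverse (real (Suc k))) \<longlonglongrightarrow> L)"
    by (rule filterlim_compose)
  thus ?thesis by (simp add: field_simps)
qed

lemma cos_coeff_sum_tendsto: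
  assumes "\<And>a. a \<in> finitely_supported \<Longrightarrow> (\<lambda>k. l k a) \<longlonglongrightarrow> l' a" "fs_frequencies p"
  shows "(\<lambda>k. cos_coeff_sum (l k) p) \<longlonglongrightarrow> cos_coeff_sum l' p"
  using assms(2) by (induction p) (auto intro!: tendsto_intros assms(1))

text \<open>For the root of order \<open>n = Suc k\<close> the squared modulus is
  \<open>exp (2 * L a / n)\<close>, and \<open>n * (exp (2 * L a / n) - 1)\<close> tends to
  \<open>2 * L a\<close>. Positivity holds for every \<open>n\<close> and passes to the
  limit.\<close>

lemma cos_coeff_sum_ln_cf_nonneg:
  assumes G: "infinitely_divisible G"
    and nz: "\<And>a. a \<in> finitely_supported \<Longrightarrow> (CLINT x|G. iexp (pairing a x)) \<noteq> 0"
    and p: "fs_frequencies p" "\<And>x. cos_poly p x \<ge> 0" "cos_poly p (\<lambda>_. 0) = 0"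
  shows "cos_coeff_sum (\<lambda>a. ln (norm (CLINT x|G. iexp (pairing a x)))) p \<ge> 0"
proof -
  define L where "L a = ln (norm (CLINT x|G. iexp (pairing a x)))" for a
  have "\<forall>k. \<exists>K. prob_space K \<and> sets K = sets seq_space \<and>
    (\<forall>a. (CLINT x|G. iexp (pairing a x)) = (CLINT x|K. iexp (pairing a x)) ^ Suc k)"
    by (intro allI infinitely_divisible_root[OF G]) simp
  then obtain K where K: "\<And>k. prob_space (K k)" "\<And>k. sets (K k) = sets seq_space"
    "\<And>k a. (CLINT x|G. iexp (pairing a x)) = (CLINT x|K k. iexp (pairing a x)) ^ Suc k"
    by metis
  \<comment> \<open>The constant -1 contributes a multiple of the value of \<open>p\<close> at the
    zero sequence, which is 0.\<close>
  have csum: "cos_coeff_sum (\<lambda>a. real (Suc k) * (l a - 1)) p = real (Suc k) * cos_coeff_sum l p" for k l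
  proof -
    have "cos_coeff_sum (\<lambda>a. s * (l a - 1)) q = s * cos_coeff_sum l q - s * cos_poly q (\<lambda>_. 0)" for s q
      by (induction q) (auto simp: algebra_simps)
    thus ?thesis using p(3) by simp
  qed
  have "(\<lambda>k. cos_coeff_sum (\<lambda>a. real (Suc k) * ((norm (CLINT x|K k. iexp (pairing a x)))\<^sup>2 - 1)) p)
    \<longlonglongrightarrow> cos_coeff_sum (\<lambda>a. 2 * L a) p"
  proof (rule cos_coeff_sum_tendsto[OF _ p(1)])
    fix a assume a: "a \<in> finitely_supported"
    have "(norm (CLINT x|K k. iexp (pairing a x)))\<^sup>2 = exp (2 * L a / real (Suc k))" for k
    proof -
      let ?z = "norm (CLINT x|K k. iexp (pairing a x))"
      have z: "norm (CLINT x|G. iexp (pairing a x)) = ?z ^ Suc k" using K(3)[of a k] by (simp only: norm_power)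
      hence zp: "?z > 0" using nz[OF a] by (metis norm_ge_zero order_le_less power_0_Suc zero_less_norm_iff less_irrefl)
      have "L a = real (Suc k) * ln ?z" unfolding L_def z by (rule ln_realpow)
      hence "2 * L a / real (Suc k) = 2 * ln ?z" by simp
      also have "exp \<dots> = ?z\<^sup>2" using zp by (simp add: exp_double)
      finally show ?thesis by simp
    qed
    thus "(\<lambda>k. real (Suc k) * ((norm (CLINT x|K k. iexp (pairing a x)))\<^sup>2 - 1)) \<longlonglongrightarrow> 2 * L a"
      by (simp only: tendsto_scaled_exp)
  qed
  hence "0 \<le> cos_coeff_sum (\<lambda>a. 2 * L a) p"
  proof (rule LIMSEQ_le_const, intro exI[of _ 0] allI impI)
    fix k
    show "0 \<le> cos_coeff_sum (\<lambda>a. real (Suc k) * ((norm (CLINT x|K k. iexp (pairing a x)))\<^sup>2 - 1)) p"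
      unfolding csum using cos_poly_char_functional_nonneg[OF K(1,2)[of k] p(2)] by (intro mult_nonneg_nonneg) auto
  qed
  also have "cos_coeff_sum (\<lambda>a. 2 * L a) q = 2 * cos_coeff_sum L q" for q
    by (induction q) (auto simp: algebra_simps)
  finally show ?thesis by (simp add: L_def[abs_def])
qed

section \<open>Orbits under the Levy measure of a moving average\<close>

lemma levy_measure_stationary:
  assumes "stationary_Levy_measure Q"
  shows "levy_measure Q"
proof -
  have Q: "measure_preserving Q shift" "sets Q = sets seq_space" "sigma_finite_measure Q"
    using assms by (auto simp: stationary_Levy_measure_def)
  have "(\<integral>\<^sup>+ x. ennreal (min ((x k)\<^sup>2) 1) \<partial>Q) < \<infinity>" for k
    using nn_integral_shift_by[OF Q(1,2), of "\<lambda>x. ennreal (min ((x 0)\<^sup>2) 1)" k] assms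
    by (simp add: shift_by_apply stationary_Levy_measure_def)
  thus ?thesis using Q by (simp add: levy_measure_def)
qed

lemma
  assumes R: "levy_measure R" and a: "a \<in> finitely_supported"
  shows integrable_cos_pairing: "integrable R (\<lambda>x. cos (pairing a x) - 1)"
    and Re_integral_levy_kernel: "Re (CLINT x|R. levy_kernel a x) = (LINT x|R. cos (pairing a x) - 1)"
proof -
  note i = integrable_levy_kernel[OF R a]
  have "Re (levy_kernel a x) = cos (pairing a x) - 1" for x by (simp add: levy_kernel_def Re_exp)
  thus "integrable R (\<lambda>x. cos (pairing a x) - 1)"
    and "Re (CLINT x|R. levy_kernel a x) = (LINT x|R. cos (pairing a x) - 1)"
    using integrable_Re[OF i] integral_Re[OF i] by simp_all
qed

lemma one_minus_prod_le_sum: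
  fixes t :: "'i \<Rightarrow> real"
  assumes "finite I" "\<And>i. i \<in> I \<Longrightarrow> 0 \<le> t i" "\<And>i. i \<in> I \<Longrightarrow> t i \<le> 1"
  shows "1 - (\<Prod>i\<in>I. 1 - t i) \<le> (\<Sum>i\<in>I. t i)"
  using assms
proof (induction I)
  case (insert i I)
  have P: "0 \<le> (\<Prod>i\<in>I. 1 - t i)" "(\<Prod>i\<in>I. 1 - t i) \<le> 1"
    using insert.prems by (auto intro!: prod_nonneg prod_le_1)
  have "t i * (\<Prod>i\<in>I. 1 - t i) \<le> t i" using P insert.prems by (intro mult_left_le) auto
  thus ?case using insert by (simp add: algebra_simps)
qed simp

text \<open>\<open>L\<close> plays the role of \<open>ln |g|\<close> for the characteristic functional \<open>g\<close> of the generator,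
  and \<open>cos_coeff_sum L p\<close> that of the integral of \<open>p\<close> against its (never constructed) Levy measure.\<close>

lemma AE_orbit_sum_bounded:
  fixes L :: "(int \<Rightarrow> real) \<Rightarrow> real" and s :: real
  assumes R: "levy_measure Q" and mp: "measure_preserving Q shift" and L0: "L (\<lambda>_. 0) = 0"
    and lim: "\<And>a. a \<in> finitely_supported \<Longrightarrow>
      (\<lambda>J. \<Sum>j\<in>{- int J..int J}. L (shift_by j a)) \<longlonglongrightarrow> (LINT x|Q. cos (pairing a x) - 1)"
    and pos: "\<And>p. fs_frequencies p \<Longrightarrow> (\<And>x. cos_poly p x \<ge> 0) \<Longrightarrow> cos_poly p (\<lambda>_. 0) = 0 \<Longrightarrow> cos_coeff_sum L p \<ge> 0"
  shows "AE x in Q. \<exists>k::nat. \<forall>N. (\<Sum>n\<in>{- int N..int N}. 1 - cos (s * x n)) \<le> k"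
proof -
  have sQ: "sets Q = sets seq_space" using R by (simp add: levy_measure_def)
  note [measurable_cong] = sQ
  have sp: "space Q = UNIV" using sets_eq_imp_space_eq[OF sQ] by simp
  \<comment> \<open>\<open>\<Lambda> j p\<close> stands for the integral of \<open>p\<close> against
    the Levy measure of the copy \<open>j\<close>, that is, of \<open>p\<close> composed with
    \<open>shift_by (- j)\<close> against that of the generator.\<close>
  define \<Lambda> where "\<Lambda> j p = cos_coeff_sum (\<lambda>a. L (shift_by j a)) p" for j p
  have \<Lambda>_nonneg: "\<Lambda> j p \<ge> 0" if p: "fs_frequencies p" "\<And>x. cos_poly p x \<ge> 0" "cos_poly p (\<lambda>_. 0) = 0" for j p
  proof -
    define p' where "p' = map (\<lambda>(c, a). (c, shift_by j a)) p"
    have e: "cos_poly p' x = cos_poly p (shift_by (- j) x)" for x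
      unfolding p'_def using p(1) by (induction p) (auto simp: pairing_shift_by)
    have f: "fs_frequencies p'" unfolding p'_def using p(1)
      by (induction p) (auto simp: finitely_supported_shift_by)
    have "shift_by (- j) (\<lambda>_. 0) = (\<lambda>_. 0)" by (simp add: shift_by_def)
    hence "cos_coeff_sum L p' \<ge> 0" by (intro pos f) (auto simp: e p)
    also have "cos_coeff_sum L p' = \<Lambda> j p" unfolding p'_def \<Lambda>_def by (induction p) auto
    finally show ?thesis .
  qed
  \<comment> \<open>Positivity of the difference: from here on the functions matter and not their
    expansions.\<close>
  have \<Lambda>_mono: "\<Lambda> j p \<le> \<Lambda> j q" if "fs_frequencies p" "fs_frequencies q" "\<And>x. cos_poly p x \<le> cos_poly q x"
      "cos_poly p (\<lambda>_. 0) = 0" "cos_poly q (\<lambda>_. 0) = 0" for j p q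
    using \<Lambda>_nonneg[of "q @ cos_scale (-1) p" j] that by (simp add: \<Lambda>_def)
  have \<Lambda>_lim: "(\<lambda>J. \<Sum>j\<in>{- int J..int J}. \<Lambda> j p) \<longlonglongrightarrow> (LINT x|Q. cos_poly p x)" and \<Lambda>_int: "integrable Q (cos_poly p)"
    if p: "fs_frequencies p" "cos_poly p (\<lambda>_. 0) = 0" for p
  proof -
    have "integrable Q (\<lambda>x. cos_poly p x - cos_poly p (\<lambda>_. 0)) \<and>
      ((\<lambda>J. \<Sum>j\<in>{- int J..int J}. \<Lambda> j p) \<longlonglongrightarrow> (LINT x|Q. cos_poly p x - cos_poly p (\<lambda>_. 0)))"
      using p(1)
    proof (induction p)
      case (Cons h p)
      obtain c a where h: "h = (c, a)" by (cases h)
      have a: "a \<in> finitely_supported" and IH: "integrable Q (\<lambda>x. cos_poly p x - cos_poly p (\<lambda>_. 0))"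
         "(\<lambda>J. \<Sum>j\<in>{- int J..int J}. \<Lambda> j p) \<longlonglongrightarrow> (LINT x|Q. cos_poly p x - cos_poly p (\<lambda>_. 0))"
        using Cons by (auto simp: h)
      note i = integrable_cos_pairing[OF R a]
      have e: "cos_poly (h # p) x - cos_poly (h # p) (\<lambda>_. 0) = c * (cos (pairing a x) - 1) + (cos_poly p x - cos_poly p (\<lambda>_. 0))" for x
        by (simp add: h algebra_simps)
      have "(\<lambda>J. c * (\<Sum>j\<in>{- int J..int J}. L (shift_by j a)) + (\<Sum>j\<in>{- int J..int J}. \<Lambda> j p))
        \<longlonglongrightarrow> c * (LINT x|Q. cos (pairing a x) - 1) + (LINT x|Q. cos_poly p x - cos_poly p (\<lambda>_. 0))"
        by (intro tendsto_intros lim a IH)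
      also have "c * (LINT x|Q. cos (pairing a x) - 1) + (LINT x|Q. cos_poly p x - cos_poly p (\<lambda>_. 0))
         = (LINT x|Q. cos_poly (h # p) x - cos_poly (h # p) (\<lambda>_. 0))"
        unfolding e using i IH(1) by (subst Bochner_Integration.integral_add) auto
      also have "(\<lambda>J. c * (\<Sum>j\<in>{- int J..int J}. L (shift_by j a)) + (\<Sum>j\<in>{- int J..int J}. \<Lambda> j p)) = (\<lambda>J. \<Sum>j\<in>{- int J..int J}. \<Lambda> j (h # p))"
        by (simp add: \<Lambda>_def h sum.distrib sum_distrib_left)
      moreover have "integrable Q (\<lambda>x. cos_poly (h # p) x - cos_poly (h # p) (\<lambda>_. 0))"
        unfolding e using i IH(1) by auto
      ultimately show ?case by simp
    qed (simp add: \<Lambda>_def)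
    thus "(\<lambda>J. \<Sum>j\<in>{- int J..int J}. \<Lambda> j p) \<longlonglongrightarrow> (LINT x|Q. cos_poly p x)" "integrable Q (cos_poly p)"
      by (simp_all add: p(2))
  qed
  define c where "c n x = 1 - cos (s * x n)" for n :: int and x :: "int \<Rightarrow> real"
  have c[measurable]: "c n \<in> borel_measurable seq_space" for n unfolding c_def[abs_def] by measurable
  have c0: "0 \<le> c n x" and c2: "c n x \<le> 2" for n x
    using cos_le_one[of "s * x n"] cos_ge_minus_one[of "s * x n"] unfolding c_def by linarith+
  have cz: "c n (\<lambda>_. 0) = 0" for n by (simp add: c_def)
  define C where "C n = [(1::real, \<lambda>_. 0), (-1, \<lambda>i. s * unit_seq n i)]" for n :: int
  have fs_unit: "(\<lambda>i. s * unit_seq n i) \<in> finitely_supported" for n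
    using finitely_supported_lin[OF unit_seq_finitely_supported zero_finitely_supported, of s n 0] by simp
  have C: "fs_frequencies (C n)" "cos_poly (C n) x = c n x" for n x
    using pairing_scale_left[OF unit_seq_finitely_supported[of n], of s x] fs_unit by (simp_all add: C_def c_def)
  \<comment> \<open>\<open>b j\<close> is the share of the copy \<open>j\<close> in the integral
    \<open>K\<close> of \<open>c 0\<close>. The shares are nonnegative and add up to
    \<open>K\<close>; their tails will control the far copies.\<close>
  define b where "b j = \<Lambda> j (C 0)" for j
  have \<Lambda>C: "\<Lambda> j (C n) = b (j - n)" for j n
  proof -
    have "shift_by j (\<lambda>i. s * unit_seq n i) = shift_by (j - n) (\<lambda>i. s * unit_seq 0 i)"
      by (auto simp: shift_by_def unit_seq_def fun_eq_iff)
    moreover have "shift_by j (\<lambda>_. 0) = (\<lambda>_. 0)" for j by (simp add: shift_by_def)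
    ultimately show ?thesis by (simp add: b_def \<Lambda>_def C_def)
  qed
  have b0: "b j \<ge> 0" for j unfolding b_def by (rule \<Lambda>_nonneg) (auto simp: C c0 cz)
  define K where "K = (LINT x|Q. c 0 x)"
  have limb: "(\<lambda>J. \<Sum>j\<in>{- int J..int J}. b j) \<longlonglongrightarrow> K"
    unfolding b_def K_def using \<Lambda>_lim[of "C 0"] by (simp add: C cz)
  have int_c0: "integrable Q (c 0)" 
  proof -
    have "cos_poly (C 0) = c 0" by (rule ext) (rule C)
    thus ?thesis using \<Lambda>_int[of "C 0"] by (simp add: C cz)
  qed
  have sumb: "(\<Sum>j\<in>F. b j) \<le> K" if "finite F" for F
  proof (rule LIMSEQ_le_const[OF limb])
    obtain J where J: "F \<subseteq> {- int J..int J}"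
    proof -
      have "F \<subseteq> {- int (nat (\<Sum>i\<in>F. \<bar>i\<bar>))..int (nat (\<Sum>i\<in>F. \<bar>i\<bar>))}"
      proof
        fix i assume "i \<in> F"
        hence "\<bar>i\<bar> \<le> (\<Sum>i\<in>F. \<bar>i\<bar>)" by (rule member_le_sum) (use \<open>finite F\<close> in auto)
        thus "i \<in> {- int (nat (\<Sum>i\<in>F. \<bar>i\<bar>))..int (nat (\<Sum>i\<in>F. \<bar>i\<bar>))}" by auto
      qed
      thus ?thesis by (rule that)
    qed
    show "\<exists>N. \<forall>n\<ge>N. sum b F \<le> (\<Sum>j\<in>{- int n..int n}. b j)"
    proof (intro exI[of _ J] allI impI)
      fix n assume "J \<le> n"
      hence "{- int J..int J} \<subseteq> {- int n..int n}" by auto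
      with J have "F \<subseteq> {- int n..int n}" by blast
      thus "sum b F \<le> (\<Sum>j\<in>{- int n..int n}. b j)" by (intro sum_mono2) (auto simp: b0)
    qed
  qed
  define S where "S N x = (\<Sum>n\<in>{- int N..int N}. c n x)" for N x
  have [measurable]: "S N \<in> borel_measurable seq_space" for N unfolding S_def[abs_def] by measurable
  have Sz: "S N (\<lambda>_. 0) = 0" for N by (simp add: S_def cz)
  \<comment> \<open>\<open>v\<close> is at most \<open>\<theta> * S\<close>, yet tends to 1 wherever
    \<open>S\<close> is unbounded. The cap 1/2 on \<theta> keeps the factors in
    \<open>[0, 1]\<close>, since \<open>c\<close> can reach 2.\<close>
  define v where "v \<theta> N x = 1 - (\<Prod>n\<in>{- int N..int N}. 1 - \<theta> * c n x)" for \<theta> N x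
  have [measurable]: "v \<theta> N \<in> borel_measurable seq_space" for \<theta> N unfolding v_def[abs_def] by measurable
  have \<theta>c: "0 \<le> \<theta> * c n x" "\<theta> * c n x \<le> 1" if "0 < \<theta>" "\<theta> \<le> 1/2" for \<theta> n x
    using that c0[of n x] c2[of n x] mult_mono[of \<theta> "1/2" "c n x" 2] by auto
  have v01: "0 \<le> v \<theta> N x" "v \<theta> N x \<le> 1" if "0 < \<theta>" "\<theta> \<le> 1/2" for \<theta> N x
    unfolding v_def using \<theta>c[OF that] by (auto intro!: prod_nonneg prod_le_1)
  have vS: "v \<theta> N x \<le> \<theta> * S N x" if "0 < \<theta>" "\<theta> \<le> 1/2" for \<theta> N x
    unfolding v_def S_def sum_distrib_left by (rule one_minus_prod_le_sum) (use \<theta>c[OF that] in auto)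
  have vz: "v \<theta> N (\<lambda>_. 0) = 0" for \<theta> N by (simp add: v_def cz)
  \<comment> \<open>The \<open>2 * m + 1\<close> copies with \<open>\<bar>j\<bar> \<le> m\<close>
    are bounded by \<open>2 * \<theta> * K\<close> each, the others by their shares
    \<open>b j\<close>. The right-hand side does not depend on \<open>N\<close>.\<close>
  have bound: "(LINT x|Q. c 0 x * v \<theta> N x) \<le> (2 * real m + 1) * (2 * \<theta> * K) + (K - (\<Sum>j\<in>{- int m..int m}. b j))"
    and int_cv: "integrable Q (\<lambda>x. c 0 x * v \<theta> N x)"
    if \<theta>: "0 < \<theta>" "\<theta> \<le> 1/2" for \<theta> N and m :: nat
  proof -
    have "\<exists>V. fs_frequencies V \<and> (\<forall>x. cos_poly V x = v \<theta> N x)"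
    proof -
      have fs1: "fs_frequencies ([(1, \<lambda>_. 0)] @ cos_scale (- \<theta>) (C n))" for n by (simp add: C)
      obtain r where "fs_frequencies r" "\<And>x. cos_poly r x = (\<Prod>n\<in>{- int N..int N}. cos_poly ([(1, \<lambda>_. 0)] @ cos_scale (- \<theta>) (C n)) x)"
        using cos_poly_prod_exists[of "{- int N..int N}" "\<lambda>n. [(1, \<lambda>_. 0)] @ cos_scale (- \<theta>) (C n)"] fs1 by blast
      thus ?thesis by (intro exI[of _ "[(1, \<lambda>_. 0)] @ cos_scale (-1) r"]) (simp add: C v_def)
    qed
    then obtain V where V: "fs_frequencies V" "\<And>x. cos_poly V x = v \<theta> N x" by blast
    obtain F where F: "fs_frequencies F" "\<And>x. cos_poly F x = c 0 x * v \<theta> N x"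
      using cos_poly_mult_exists[OF C(1)[of 0] V(1)] by (auto simp: C V)
    have Fz: "cos_poly F (\<lambda>_. 0) = 0" by (simp add: F vz)
    \<comment> \<open>The shares of the various \<open>c n\<close> in one copy are values of
      \<open>b\<close> at distinct places, hence add up to at most \<open>K\<close>, uniformly in
      \<open>N\<close> and \<open>j\<close>.\<close>
    have hV: "\<Lambda> j V \<le> \<theta> * K" for j
    proof -
      define q where "q = concat (map (\<lambda>n. cos_scale \<theta> (C n)) [- int N..int N])"
      have q: "fs_frequencies q" "cos_poly q x = \<theta> * S N x" "\<Lambda> j q = \<theta> * (\<Sum>n\<in>{- int N..int N}. \<Lambda> j (C n))" for x
      proof -
        have "fs_frequencies (concat (map (\<lambda>n. cos_scale \<theta> (C n)) ns)) \<and>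
          cos_poly (concat (map (\<lambda>n. cos_scale \<theta> (C n)) ns)) x = \<theta> * (\<Sum>n\<leftarrow>ns. c n x) \<and>
          \<Lambda> j (concat (map (\<lambda>n. cos_scale \<theta> (C n)) ns)) = \<theta> * (\<Sum>n\<leftarrow>ns. \<Lambda> j (C n))" for ns
          by (induction ns) (auto simp: C \<Lambda>_def algebra_simps)
        moreover have "(\<Sum>n\<leftarrow>[- int N..int N]. f n) = (\<Sum>n\<in>{- int N..int N}. f n :: real)" for f
          by (simp add: sum_list_distinct_conv_sum_set)
        ultimately show "fs_frequencies q" "cos_poly q x = \<theta> * S N x" "\<Lambda> j q = \<theta> * (\<Sum>n\<in>{- int N..int N}. \<Lambda> j (C n))"
          by (simp_all add: q_def S_def)
      qed
      have "\<Lambda> j V \<le> \<Lambda> j q"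
        by (rule \<Lambda>_mono) (auto simp: V q vS[OF \<theta>] vz Sz)
      also have "\<dots> = \<theta> * (\<Sum>n\<in>{- int N..int N}. b (j - n))" by (simp add: q \<Lambda>C)
      also have "(\<Sum>n\<in>{- int N..int N}. b (j - n)) = (\<Sum>n\<in>(\<lambda>n. j - n) ` {- int N..int N}. b n)"
        by (subst sum.reindex) (auto simp: inj_on_def)
      also have "\<theta> * \<dots> \<le> \<theta> * K" using \<theta> by (intro mult_left_mono sumb) auto
      finally show ?thesis .
    qed
    have hF: "\<Lambda> j F \<le> 2 * \<Lambda> j V" for j
    proof -
      have "\<Lambda> j F \<le> \<Lambda> j (cos_scale 2 V)"
        by (rule \<Lambda>_mono) (auto simp: F V vz intro!: mult_right_mono c2 v01[OF \<theta>])
      thus ?thesis by (simp add: \<Lambda>_def)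
    qed
    have FV: "\<Lambda> j F \<le> 2 * \<theta> * K" for j using hF[of j] hV[of j] by linarith
    have Fb: "\<Lambda> j F \<le> b j" for j unfolding b_def
      by (rule \<Lambda>_mono) (auto simp: F C vz cz intro!: mult_left_le v01[OF \<theta>] c0)
    show "integrable Q (\<lambda>x. c 0 x * v \<theta> N x)" 
    proof -
      have "cos_poly F = (\<lambda>x. c 0 x * v \<theta> N x)" by (rule ext) (rule F)
      thus ?thesis using \<Lambda>_int[OF F(1) Fz] by simp
    qed
    have "(\<lambda>J. \<Sum>j\<in>{- int J..int J}. \<Lambda> j F) \<longlonglongrightarrow> (LINT x|Q. c 0 x * v \<theta> N x)"
      using \<Lambda>_lim[OF F(1) Fz] by (simp add: F)
    thus "(LINT x|Q. c 0 x * v \<theta> N x) \<le> (2 * real m + 1) * (2 * \<theta> * K) + (K - (\<Sum>j\<in>{- int m..int m}. b j))"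
    proof (rule LIMSEQ_le_const2, intro exI[of _ m] allI impI)
      fix J assume J: "m \<le> J"
      let ?A = "{- int m..int m}" and ?B = "{- int J..int J}"
      have sub: "?A \<subseteq> ?B" using J by auto
      have "(\<Sum>j\<in>?B. \<Lambda> j F) = (\<Sum>j\<in>?B - ?A. \<Lambda> j F) + (\<Sum>j\<in>?A. \<Lambda> j F)"
        by (rule sum.subset_diff[OF sub]) simp
      also have "(\<Sum>j\<in>?A. \<Lambda> j F) \<le> (\<Sum>j\<in>?A. 2 * \<theta> * K)" by (intro sum_mono FV)
      also have "\<dots> = (2 * real m + 1) * (2 * \<theta> * K)" by simp
      also have "(\<Sum>j\<in>?B - ?A. \<Lambda> j F) \<le> (\<Sum>j\<in>?B - ?A. b j)" by (intro sum_mono Fb)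
      also have "\<dots> = (\<Sum>j\<in>?B. b j) - (\<Sum>j\<in>?A. b j)" by (rule sum_diff) (use sub in auto)
      also have "(\<Sum>j\<in>?B. b j) \<le> K" by (rule sumb) simp
      finally show "(\<Sum>j\<in>?B. \<Lambda> j F) \<le> (2 * real m + 1) * (2 * \<theta> * K) + (K - (\<Sum>j\<in>?A. b j))" by simp
    qed
  qed
  define Z where "Z = {x\<in>space seq_space. \<forall>k::nat. \<exists>N. S N x > real k}"
  have ZD: "x \<in> Z \<longleftrightarrow> (\<forall>k::nat. \<exists>N. S N x > real k)" for x by (simp add: Z_def)
  have Z[measurable]: "Z \<in> sets seq_space" unfolding Z_def by measurable
  have S_mono: "S N x \<le> S N' x" if "N \<le> N'" for N N' x
    unfolding S_def using that by (intro sum_mono2) (auto simp: c0)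
  have vlim: "(\<lambda>N. v \<theta> N x) \<longlonglongrightarrow> 1" if "x \<in> Z" "0 < \<theta>" "\<theta> \<le> 1/2" for x \<theta>
  proof -
    have "filterlim (\<lambda>N. S N x) at_top sequentially"
      unfolding filterlim_at_top eventually_sequentially
    proof
      fix r
      obtain k :: nat where k: "r \<le> real k" using real_arch_simple by blast
      obtain N where N: "S N x > real k" using \<open>x \<in> Z\<close> ZD[of x] by blast
      have "r \<le> S n x" if "N \<le> n" for n using S_mono[OF that, of x] k N by linarith
      thus "\<exists>N. \<forall>n\<ge>N. r \<le> S n x" by blast
    qed
    hence "filterlim (\<lambda>N. \<theta> * S N x) at_top sequentially"
      by (rule filterlim_tendsto_pos_mult_at_top[OF tendsto_const that(2)])
    hence "(\<lambda>N. exp (- (\<theta> * S N x))) \<longlonglongrightarrow> 0"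
      by (intro filterlim_compose[OF exp_at_bot]) (simp add: filterlim_uminus_at_bot)
    hence l: "(\<lambda>N. 1 - exp (- (\<theta> * S N x))) \<longlonglongrightarrow> 1" using tendsto_diff[OF tendsto_const] by fastforce
    have "1 - exp (- (\<theta> * S N x)) \<le> v \<theta> N x" for N
    proof -
      have "(\<Prod>n\<in>{- int N..int N}. 1 - \<theta> * c n x) \<le> (\<Prod>n\<in>{- int N..int N}. exp (- (\<theta> * c n x)))"
        using \<theta>c[OF that(2,3), of _ x] exp_ge_add_one_self[of "- (\<theta> * c _ x)"] by (intro prod_mono) auto
      also have "\<dots> = exp (- (\<theta> * S N x))"
        by (simp add: exp_sum[symmetric] S_def sum_distrib_left sum_negf)
      finally show ?thesis by (simp add: v_def)
    qed
    thus ?thesis by (intro tendsto_sandwich[OF _ _ l tendsto_const]) (auto intro!: always_eventually v01 that)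
  qed
  define I where "I = (LINT x|Q. c 0 x * indicator Z x)"
  have int_cZ: "integrable Q (\<lambda>x. c 0 x * indicator Z x)"
    by (rule Bochner_Integration.integrable_bound[OF int_c0]) (auto simp: indicator_def)
  \<comment> \<open>\<open>N\<close> tends to infinity with \<theta> and \<open>m\<close> fixed; on
    \<open>Z\<close> the factor \<open>v\<close> tends to 1.\<close>
  have I1: "I \<le> (2 * real m + 1) * (2 * \<theta> * K) + (K - (\<Sum>j\<in>{- int m..int m}. b j))"
    if \<theta>: "0 < \<theta>" "\<theta> \<le> 1/2" for \<theta> and m :: nat
  proof -
    have "(\<lambda>N. LINT x|Q. c 0 x * indicator Z x * v \<theta> N x) \<longlonglongrightarrow> I" unfolding I_def
    proof (rule integral_dominated_convergence[where w = "c 0"])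
      show "AE x in Q. (\<lambda>N. c 0 x * indicator Z x * v \<theta> N x) \<longlonglongrightarrow> c 0 x * indicator Z x"
      proof (rule AE_I2)
        fix x
        show "(\<lambda>N. c 0 x * indicator Z x * v \<theta> N x) \<longlonglongrightarrow> c 0 x * indicator Z x"
          using tendsto_mult[OF tendsto_const vlim[OF _ \<theta>], of x "c 0 x"] by (cases "x \<in> Z") auto
      qed
      show "AE x in Q. norm (c 0 x * indicator Z x * v \<theta> N x) \<le> c 0 x" for N
        using v01[OF \<theta>] c0 by (auto simp: indicator_def abs_mult intro!: mult_left_le)
    qed (use int_c0 in auto)
    moreover have "(LINT x|Q. c 0 x * indicator Z x * v \<theta> N x) \<le> (2 * real m + 1) * (2 * \<theta> * K) + (K - (\<Sum>j\<in>{- int m..int m}. b j))" for N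
    proof (rule order_trans[OF integral_mono bound[OF \<theta>]])
      show "integrable Q (\<lambda>x. c 0 x * indicator Z x * v \<theta> N x)"
        by (rule Bochner_Integration.integrable_bound[OF int_cv[OF \<theta>]]) (auto simp: indicator_def)
      show "c 0 x * indicator Z x * v \<theta> N x \<le> c 0 x * v \<theta> N x" for x
        using v01[OF \<theta>, of N x] c0[of 0 x] by (auto simp: indicator_def)
    qed (rule int_cv[OF \<theta>])
    ultimately show ?thesis by (intro LIMSEQ_le_const2) auto
  qed
  \<comment> \<open>Now \<theta> tends to 0 along \<open>1 / (n + 2)\<close>, which respects the cap
    1/2, with \<open>m\<close> still fixed; letting \<open>m\<close> grow afterwards removes the
    tail of \<open>b\<close>.\<close>
  have I2: "I \<le> K - (\<Sum>j\<in>{- int m..int m}. b j)" for m :: nat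
  proof (rule LIMSEQ_le_const)
    have "(\<lambda>n. inverse (real (Suc (Suc n)))) \<longlonglongrightarrow> 0"
      using LIMSEQ_Suc[OF LIMSEQ_inverse_real_of_nat] .
    hence "(\<lambda>n. (2 * real m + 1) * (2 * inverse (real (Suc (Suc n))) * K) + (K - (\<Sum>j\<in>{- int m..int m}. b j)))
      \<longlonglongrightarrow> (2 * real m + 1) * (2 * 0 * K) + (K - (\<Sum>j\<in>{- int m..int m}. b j))"
      by (intro tendsto_intros)
    thus "(\<lambda>n. (2 * real m + 1) * (2 * inverse (real (Suc (Suc n))) * K) + (K - (\<Sum>j\<in>{- int m..int m}. b j)))
      \<longlonglongrightarrow> K - (\<Sum>j\<in>{- int m..int m}. b j)" by simp
    show "\<exists>N. \<forall>n\<ge>N. I \<le> (2 * real m + 1) * (2 * inverse (real (Suc (Suc n))) * K) + (K - (\<Sum>j\<in>{- int m..int m}. b j))"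
      by (intro exI[of _ 0] allI impI I1) (auto simp: field_simps)
  qed
  have "I \<le> 0"
  proof (rule LIMSEQ_le_const)
    show "(\<lambda>m. K - (\<Sum>j\<in>{- int m..int m}. b j)) \<longlonglongrightarrow> 0"
      using tendsto_diff[OF tendsto_const limb, of K] by simp
  qed (use I2 in auto)
  moreover have "I \<ge> 0" unfolding I_def by (rule integral_nonneg_AE) (auto simp: c0)
  ultimately have "I = 0" by simp
  hence "AE x in Q. c 0 x * indicator Z x = 0"
    using integral_nonneg_eq_0_iff_AE[OF int_cZ] by (simp add: I_def c0)
  hence ae: "AE x in Q. x \<in> Z \<longrightarrow> c 0 x = 0" by eventually_elim (auto simp: indicator_def split: if_splits)
  \<comment> \<open>So far only coordinate 0 is controlled on \<open>Z\<close>. Invariance of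
    \<open>Q\<close> and of \<open>Z\<close> carries this to all coordinates; then every orbit sum
    is 0, contrary to the definition of \<open>Z\<close>.\<close>
  have "AE x in Q. shift_by n x \<in> Z \<longrightarrow> c 0 (shift_by n x) = 0" for n
  proof -
    have "AE x in distr Q seq_space (shift_by n). x \<in> Z \<longrightarrow> c 0 x = 0"
      unfolding distr_shift_by[OF mp sQ] by (rule ae)
    thus ?thesis by (rule AE_distrD[rotated]) measurable
  qed
  hence "AE x in Q. \<forall>n. shift_by n x \<in> Z \<longrightarrow> c 0 (shift_by n x) = 0"
    by (subst AE_all_countable) auto
  hence "AE x in Q. x \<notin> Z"
  proof eventually_elim
    case (elim x)
    show ?case
    proof
      assume xZ: "x \<in> Z"
      have "shift_by n x \<in> Z" for n unfolding ZD
      proof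
        fix k :: nat
        obtain N where N: "S N x > real k" using xZ ZD[of x] by blast
        have "S N x = (\<Sum>i\<in>(\<lambda>i. i - n) ` {- int N..int N}. c (i + n) x)"
          by (subst sum.reindex) (auto simp: S_def inj_on_def)
        also have "\<dots> \<le> (\<Sum>i\<in>{- int (N + nat \<bar>n\<bar>)..int (N + nat \<bar>n\<bar>)}. c (i + n) x)"
          by (rule sum_mono2) (auto simp: c0)
        also have "\<dots> = S (N + nat \<bar>n\<bar>) (shift_by n x)" by (simp add: S_def c_def shift_by_apply)
        finally show "\<exists>N. S N (shift_by n x) > real k" using N by (intro exI[of _ "N + nat \<bar>n\<bar>"]) linarith
      qed
      hence "c 0 (shift_by n x) = 0" for n using elim by blast
      hence "c n x = 0" for n by (simp add: c_def shift_by_apply)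
      hence "S N x = 0" for N by (simp add: S_def)
      thus False using xZ ZD[of x] by (metis less_irrefl of_nat_0)
    qed
  qed
  thus ?thesis by eventually_elim (auto simp: ZD not_less S_def c_def)
qed

text \<open>Markov's inequality for the counting measure bounds the size of every finite
  subset.\<close>

lemma finite_ge_if_sums_bounded:
  fixes f :: "int \<Rightarrow> real"
  assumes f: "\<And>n. f n \<ge> 0" "\<And>N. (\<Sum>n\<in>{- int N..int N}. f n) \<le> K" and c: "c > 0"
  shows "finite {n. c \<le> f n}"
proof -
  have "card G \<le> nat \<lceil>K / c\<rceil>" if G: "G \<subseteq> {n. c \<le> f n}" "finite G" for G
  proof -
    obtain N :: nat where N: "G \<subseteq> {- int N..int N}"
    proof
      show "G \<subseteq> {- int (nat (\<Sum>i\<in>G. \<bar>i\<bar>))..int (nat (\<Sum>i\<in>G. \<bar>i\<bar>))}"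
      proof
        fix i assume "i \<in> G"
        hence "\<bar>i\<bar> \<le> (\<Sum>i\<in>G. \<bar>i\<bar>)" by (rule member_le_sum) (use G in auto)
        thus "i \<in> {- int (nat (\<Sum>i\<in>G. \<bar>i\<bar>))..int (nat (\<Sum>i\<in>G. \<bar>i\<bar>))}" by auto
      qed
    qed
    have "real (card G) * c = (\<Sum>n\<in>G. c)" by simp
    also have "\<dots> \<le> (\<Sum>n\<in>G. f n)" by (rule sum_mono) (use G in auto)
    also have "\<dots> \<le> (\<Sum>n\<in>{- int N..int N}. f n)" by (rule sum_mono2) (use N f in auto)
    also have "\<dots> \<le> K" by (rule f)
    finally have "real (card G) \<le> K / c" using c by (simp add: pos_le_divide_eq)
    thus ?thesis by linarith
  qed
  from finite_if_finite_subsets_card_bdd[of "{n. c \<le> f n}", OF this] show ?thesis by blast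
qed

section \<open>The equivalence\<close>

lemma cf_stationary_IDp_process:
  assumes "stationary_IDp_process M X Q" "a \<in> finitely_supported"
  shows "(CLINT x|distr M seq_space X. iexp (pairing a x)) = exp (CLINT x|Q. levy_kernel a x)"
proof -
  have [measurable]: "X \<in> measurable M seq_space"
    using assms by (simp add: stationary_IDp_process_def stationary_process_def)
  have "(CLINT x|distr M seq_space X. iexp (pairing a x)) = (CLINT \<omega>|M. iexp (pairing a (X \<omega>)))"
    by (rule integral_distr) measurable
  also have "\<dots> = exp (CLINT x|Q. levy_kernel a x)"
    using assms by (simp add: stationary_IDp_process_def levy_kernel_def)
  finally show ?thesis .
qed

section \<open>Dissipativity of the Levy measure of a moving average\<close>

lemma cos_eq_1_irrational:
  fixes x s :: real
  assumes "cos x = 1" "cos (s * x) = 1" "s \<notin> \<rat>"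
  shows "x = 0"
proof (rule ccontr)
  assume x: "x \<noteq> 0"
  obtain m :: int where m: "x = real_of_int m * 2 * pi" using assms(1) cos_one_2pi_int by blast
  obtain n :: int where n: "s * x = real_of_int n * 2 * pi" using assms(2) cos_one_2pi_int by blast
  have "s = n / m" using m n x by (simp add: field_simps)
  thus False using assms(3) by auto
qed

lemma dissipative_if_gma:
  assumes X: "stationary_IDp_process M X Q" and gma: "gma_with_ID_generator M X"
  shows "dissipative Q shift"
proof -
  have Q: "stationary_Levy_measure Q" using X by (simp add: stationary_IDp_process_def)
  have mp: "measure_preserving Q shift" and sQ: "sets Q = sets seq_space"
    using Q by (auto simp: stationary_Levy_measure_def)
  note R = levy_measure_stationary[OF Q]
  obtain G where G: "is_gma_generator G (distr M seq_space X)" "infinitely_divisible G"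
    using gma unfolding gma_with_ID_generator_def by blast
  obtain N :: "(int \<Rightarrow> int \<Rightarrow> real) measure" and \<xi> where
    rep: "gma_representation N \<xi> (distr M seq_space X)" and G\<xi>: "distr N seq_space (\<xi> 0) = G"
    using G(1) unfolding is_gma_generator_def by blast
  have pG: "prob_space G" unfolding G\<xi>[symmetric]
    using rep by (intro prob_space.prob_space_distr)
      (auto simp: gma_representation_def iid_processes_def prob_space.indep_vars_def)
  define g where "g a = (CLINT x|G. iexp (pairing a x))" for a
  define L where "L a = ln (norm (g a))" for a
  have limg: "(\<lambda>J. \<Prod>j\<in>{- int J..int J}. g (shift_by j a)) \<longlonglongrightarrow> exp (CLINT x|Q. levy_kernel a x)"
    if "a \<in> finitely_supported" for a
    using cf_gma_tendsto[OF rep that] cf_stationary_IDp_process[OF X that] by (simp add: G\<xi> g_def)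
  \<comment> \<open>A zero of \<open>g\<close> would annihilate all partial products through the
    factor \<open>j = 0\<close>, whereas their limit is an exponential.\<close>
  have nz: "g a \<noteq> 0" if a: "a \<in> finitely_supported" for a
  proof
    assume "g a = 0"
    hence "(\<Prod>j\<in>{- int J..int J}. g (shift_by j a)) = 0" for J
      by (intro prod_zero) (auto intro!: bexI[of _ 0])
    with limg[OF a] have "(\<lambda>J::nat. 0) \<longlonglongrightarrow> exp (CLINT x|Q. levy_kernel a x)" by simp
    hence "exp (CLINT x|Q. levy_kernel a x) = 0" using LIMSEQ_unique tendsto_const by metis
    thus False by simp
  qed
  \<comment> \<open>Moduli turn the convergent products into real sums; only the real part of the
    Levy exponent, free of the truncation term, is left.\<close>
  have lim: "(\<lambda>J. \<Sum>j\<in>{- int J..int J}. L (shift_by j a)) \<longlonglongrightarrow> (LINT x|Q. cos (pairing a x) - 1)"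
    if a: "a \<in> finitely_supported" for a
  proof -
    have "(\<lambda>J. ln (norm (\<Prod>j\<in>{- int J..int J}. g (shift_by j a)))) \<longlonglongrightarrow> ln (norm (exp (CLINT x|Q. levy_kernel a x)))"
      by (intro tendsto_intros limg a) simp
    moreover have "ln (norm (\<Prod>j\<in>{- int J..int J}. g (shift_by j a))) = (\<Sum>j\<in>{- int J..int J}. L (shift_by j a))" for J
      unfolding L_def prod_norm[symmetric]
      by (rule ln_prod) (use nz[OF finitely_supported_shift_by[OF a]] in auto)
    moreover have "ln (norm (exp (CLINT x|Q. levy_kernel a x))) = (LINT x|Q. cos (pairing a x) - 1)"
      by (simp add: Re_integral_levy_kernel[OF R a])
    ultimately show ?thesis by simp
  qed
  have L0: "L (\<lambda>_. 0) = 0"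
    using prob_space.prob_space[OF pG] by (simp add: L_def g_def)
  have bounded: "AE x in Q. \<exists>k::nat. \<forall>N. (\<Sum>n\<in>{- int N..int N}. 1 - cos (s * x n)) \<le> k" for s
  proof (rule AE_orbit_sum_bounded[OF R mp L0 lim])
    show "cos_coeff_sum L p \<ge> 0" if "fs_frequencies p" "\<And>x. cos_poly p x \<ge> 0" "cos_poly p (\<lambda>_. 0) = 0" for p
      using cos_coeff_sum_ln_cf_nonneg[OF G(2) nz[unfolded g_def] that] by (simp add: L_def[abs_def] g_def)
  qed
  obtain s :: real where s: "s \<notin> \<rat>"
    using uncountable_UNIV_real countable_rat by (metis UNIV_eq_I)
  \<comment> \<open>One scale would not do: \<open>1 - cos (x 0)\<close> vanishes at every multiple
    of \<open>2 * pi\<close>, so it can vanish along the whole orbit of a nonzero sequence.\<close>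
  define r where "r x = (1 - cos (x 0)) + (1 - cos (s * x 0))" for x :: "int \<Rightarrow> real"
  have r: "r \<in> borel_measurable seq_space" unfolding r_def[abs_def] by measurable
  obtain W where W: "W \<in> sets seq_space" "disjoint_family (\<lambda>n. shift_by n -` W)"
    and WE: "\<forall>x. (\<forall>c>0. finite {n. c \<le> r (shift_by n x)}) \<longrightarrow> (\<exists>n. r (shift_by n x) > 0) \<longrightarrow> (\<exists>n. shift_by n x \<in> W)"
    using bexE[OF section_exists[OF r]] by metis
  have "AE x in Q. \<exists>n. shift_by n x \<in> W"
    using bounded[of 1] bounded[of s] AE_neq_zero[OF Q]
  proof eventually_elim
    case (elim x)
    obtain k1 k2 :: nat where k: "\<And>N. (\<Sum>n\<in>{- int N..int N}. 1 - cos (1 * x n)) \<le> k1"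
      "\<And>N. (\<Sum>n\<in>{- int N..int N}. 1 - cos (s * x n)) \<le> k2"
      using elim(1,2) by blast
    have "finite {n. c \<le> r (shift_by n x)}" if "c > 0" for c
    proof (rule finite_subset)
      show "{n. c \<le> r (shift_by n x)} \<subseteq> {n. c / 2 \<le> 1 - cos (1 * x n)} \<union> {n. c / 2 \<le> 1 - cos (s * x n)}"
        by (auto simp: r_def shift_by_apply)
      show "finite ({n. c / 2 \<le> 1 - cos (1 * x n)} \<union> {n. c / 2 \<le> 1 - cos (s * x n)})"
        using that by (intro finite_UnI finite_ge_if_sums_bounded[OF _ k(1)] finite_ge_if_sums_bounded[OF _ k(2)]) auto
    qed
    moreover have "\<exists>n. r (shift_by n x) > 0"
    proof -
      obtain n where "x n \<noteq> 0" using elim(3) by (auto simp: fun_eq_iff)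
      hence "cos (x n) \<noteq> 1 \<or> cos (s * x n) \<noteq> 1" using cos_eq_1_irrational s by blast
      hence "cos (x n) < 1 \<or> cos (s * x n) < 1" by (auto simp: less_le)
      moreover have "r (shift_by n x) = (1 - cos (x n)) + (1 - cos (s * x n))"
        by (simp add: r_def shift_by_apply)
      ultimately have "r (shift_by n x) > 0"
        using cos_le_one[of "x n"] cos_le_one[of "s * x n"] by argo
      thus ?thesis by blast
    qed
    ultimately show ?case using WE by blast
  qed
  thus ?thesis by (rule dissipative_if_section[OF mp sQ W])
qed

section \<open>The moving average over a section\<close>

lemma levy_law_weighted_exists:
  assumes Q: "levy_measure Q" and f: "f \<in> borel_measurable seq_space" "\<And>x. 0 \<le> f x" "\<And>x. f x \<le> 1"
  shows "\<exists>P. prob_space P \<and> sets P = sets seq_space \<and> (\<forall>a\<in>finitely_supported.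
    (CLINT x|P. iexp (pairing a x)) = exp (CLINT x|Q. f x *\<^sub>R levy_kernel a x))"
proof -
  have sQ: "sets Q = sets seq_space" using Q by (simp add: levy_measure_def)
  note [measurable_cong] = sQ
  note [measurable] = f(1)
  interpret sigma_finite_measure Q using Q by (simp add: levy_measure_def)
  \<comment> \<open>A density, in place of a restriction, serves both the generator, with weight
    \<open>indicator W\<close>, and its roots, with that weight divided by \<open>k\<close>.\<close>
  define R where "R = density Q (\<lambda>x. ennreal (f x))"
  have "levy_measure R" unfolding levy_measure_def
  proof (intro conjI allI)
    show "sets R = sets seq_space" by (simp add: R_def sQ)
    show "sigma_finite_measure R" unfolding R_def by (subst sigma_finite_iff_density_finite) auto
    fix k
    have "(\<integral>\<^sup>+ x. ennreal (min ((x k)\<^sup>2) 1) \<partial>R) = (\<integral>\<^sup>+ x. ennreal (f x) * ennreal (min ((x k)\<^sup>2) 1) \<partial>Q)"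
      unfolding R_def by (rule nn_integral_density) measurable
    also have "\<dots> \<le> (\<integral>\<^sup>+ x. ennreal (min ((x k)\<^sup>2) 1) \<partial>Q)"
    proof (rule nn_integral_mono)
      fix x
      have "f x * min ((x k)\<^sup>2) 1 \<le> min ((x k)\<^sup>2) 1" by (rule mult_left_le_one_le) (auto simp: f)
      thus "ennreal (f x) * ennreal (min ((x k)\<^sup>2) 1) \<le> ennreal (min ((x k)\<^sup>2) 1)"
        by (subst ennreal_mult[symmetric]) (auto simp: f intro!: ennreal_leI)
    qed
    also have "\<dots> < \<infinity>" using Q by (simp add: levy_measure_def)
    finally show "(\<integral>\<^sup>+ x. ennreal (min ((x k)\<^sup>2) 1) \<partial>R) < \<infinity>" .
  qed
  moreover have "(CLINT x|R. levy_kernel a x) = (CLINT x|Q. f x *\<^sub>R levy_kernel a x)" for a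
    unfolding R_def by (rule integral_density) (auto simp: f)
  ultimately show ?thesis using levy_law_exists[of R] by simp
qed

lemma iid_processes_PiM:
  fixes G :: "(int \<Rightarrow> real) measure" and I :: "'i set"
  assumes G: "prob_space G" "sets G = sets seq_space" and I: "I \<noteq> {}"
  shows "iid_processes (PiM I (\<lambda>_. G)) I (\<lambda>i \<omega>. \<omega> i)"
  unfolding iid_processes_def
  using indep_coords_seq_space[of "\<lambda>_. G" I] assms by (auto intro!: prob_space_PiM)

lemma (in prob_space) indep_vars_inj_reindex:
  assumes ind: "indep_vars (\<lambda>_. N) Y I" and g: "inj_on g L" "g ` L \<subseteq> I"
  shows "indep_vars (\<lambda>_. N) (\<lambda>j. Y (g j)) L"
proof -
  have "indep_vars (\<lambda>j. PiM {g j} (\<lambda>_. N)) (\<lambda>j \<omega>. restrict (\<lambda>i. Y i \<omega>) {g j}) L"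
    by (rule indep_vars_restrict[OF ind]) (use g in \<open>auto simp: disjoint_family_on_def inj_on_def\<close>)
  from indep_vars_compose2[OF this, of "\<lambda>j f. f (g j)" "\<lambda>_. N"] show ?thesis by simp
qed

text \<open>Characteristic functionals determine laws, so the sum of \<open>k\<close> independent
  processes of law \<open>K k\<close> has law \<open>G\<close> as soon as the functionals
  match.\<close>

lemma infinitely_divisible_if_roots:
  assumes G: "prob_space G" "sets G = sets seq_space"
    and K: "\<And>k. k \<ge> 1 \<Longrightarrow> prob_space (K k)" "\<And>k. k \<ge> 1 \<Longrightarrow> sets (K k) = sets seq_space"
    and cf: "\<And>k a. k \<ge> 1 \<Longrightarrow> a \<in> finitely_supported \<Longrightarrow>
      (CLINT x|K k. iexp (pairing a x)) ^ k = (CLINT x|G. iexp (pairing a x))"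
  shows "infinitely_divisible G"
proof (rule infinitely_divisibleI)
  fix k :: nat assume k: "k \<ge> 1"
  hence ne: "{..<k} \<noteq> {}" by (simp add: lessThan_empty_iff)
  show iid: "iid_processes (PiM {..<k} (\<lambda>_. K k)) {..<k} (\<lambda>j \<omega>. \<omega> j)"
    by (rule iid_processes_PiM[OF K(1,2)[OF k] ne])
  interpret N: prob_space "PiM {..<k} (\<lambda>_. K k)" using iid by (simp add: iid_processes_def)
  have ind: "N.indep_vars (\<lambda>_. seq_space) (\<lambda>j \<omega>. \<omega> j) {..<k}" using iid by (simp add: iid_processes_def)
  have dist: "distr (PiM {..<k} (\<lambda>_. K k)) seq_space (\<lambda>\<omega>. \<omega> j) = K k" if "j < k" for j
    by (rule indep_coords_seq_space(2)) (use that K k ne in auto)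
  have rv: "(\<lambda>\<omega>. \<omega> j) \<in> measurable (PiM {..<k} (\<lambda>_. K k)) seq_space" if "j < k" for j
    using ind that by (simp add: N.indep_vars_def)
  let ?S = "\<lambda>\<omega> n. \<Sum>j<k. \<omega> j n :: real"
  have S: "?S \<in> measurable (PiM {..<k} (\<lambda>_. K k)) seq_space"
    by (rule measurable_into_seq_space) (auto intro!: borel_measurable_sum measurable_compose[OF rv measurable_coord])
  show "distr (PiM {..<k} (\<lambda>_. K k)) seq_space ?S = G"
  proof (rule char_functional_unique)
    fix a assume a: "a \<in> finitely_supported"
    have "(CLINT x|distr (PiM {..<k} (\<lambda>_. K k)) seq_space ?S. iexp (pairing a x)) = (CLINT \<omega>|PiM {..<k} (\<lambda>_. K k). iexp (\<Sum>j<k. pairing a (\<omega> j)))"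
      by (subst integral_distr[OF S]) (simp_all only: pairing_sum_right, measurable)
    also have "\<dots> = (\<Prod>j<k. CLINT x|distr (PiM {..<k} (\<lambda>_. K k)) seq_space (\<lambda>\<omega>. \<omega> j). iexp (pairing a x))"
      by (rule N.cf_indep_sum[OF ind]) auto
    also have "\<dots> = (CLINT x|G. iexp (pairing a x))" using cf[OF k a] by (simp add: dist)
    finally show "(CLINT x|distr (PiM {..<k} (\<lambda>_. K k)) seq_space ?S. iexp (pairing a x)) = (CLINT x|G. iexp (pairing a x))" .
  qed (use G S in \<open>auto intro!: N.prob_space_distr\<close>)
qed

lemma levy_kernel_shift_by:
  assumes "a \<in> finitely_supported"
  shows "levy_kernel (shift_by j a) x = levy_kernel a (shift_by (- j) x)"
proof -
  have "trunc (shift_by (- j) x) = shift_by (- j) (trunc x)" by (simp add: trunc_def shift_by_def fun_eq_iff)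
  thus ?thesis unfolding levy_kernel_def by (simp add: pairing_shift_by[OF assms])
qed

text \<open>Invariance of \<open>Q\<close> moves the shift from the frequency to the set: the copy
  \<open>j\<close> contributes to the exponent at \<open>a\<close> exactly the part of the Levy
  integral over one translate of \<open>W\<close>.\<close>

lemma integral_levy_kernel_translate:
  assumes mp: "measure_preserving Q shift" "sets Q = sets seq_space"
    and W: "W \<in> sets seq_space" and a: "a \<in> finitely_supported"
  shows "(CLINT x|Q. indicator W x *\<^sub>R levy_kernel (shift_by j a) x) = (CLINT x|Q. indicator (shift_by j -` W) x *\<^sub>R levy_kernel a x)"
proof -
  note [measurable_cong] = mp(2)
  note [measurable] = W
  have [measurable]: "shift_by j -` W \<in> sets seq_space"
    using measurable_sets[OF shift_by_measurable W, of j] by simp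
  have "(CLINT x|Q. indicator (shift_by j -` W) x *\<^sub>R levy_kernel a x) = (CLINT x|distr Q seq_space (shift_by (- j)). indicator (shift_by j -` W) x *\<^sub>R levy_kernel a x)"
    by (simp add: distr_shift_by[OF mp])
  also have "\<dots> = (CLINT x|Q. indicator (shift_by j -` W) (shift_by (- j) x) *\<^sub>R levy_kernel a (shift_by (- j) x))"
    by (rule integral_distr) measurable
  also have "\<dots> = (CLINT x|Q. indicator W x *\<^sub>R levy_kernel (shift_by j a) x)"
    by (simp add: levy_kernel_shift_by[OF a] indicator_def)
  finally show ?thesis by simp
qed

lemma gma_if_dissipative:
  assumes X: "stationary_IDp_process M X Q" and diss: "dissipative Q shift"
  shows "gma_with_ID_generator M X"
proof -
  have st: "stationary_process M X" and Q: "stationary_Levy_measure Q"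
    using X by (simp_all add: stationary_IDp_process_def)
  have mp: "measure_preserving Q shift" and sQ: "sets Q = sets seq_space"
    using Q by (auto simp: stationary_Levy_measure_def)
  note R = levy_measure_stationary[OF Q]
  obtain W where W: "W \<in> sets seq_space" "disjoint_family (\<lambda>n. shift_by n -` W)"
    "AE x in Q. \<exists>n. shift_by n x \<in> W"
    using section_if_dissipative[OF Q diss] by blast
  note [measurable] = W(1)
  define \<kappa> where "\<kappa> a = (CLINT x|Q. indicator W x *\<^sub>R levy_kernel a x)" for a
  have T: "shift_by j -` W \<in> sets Q" for j
    using measurable_sets[OF shift_by_measurable W(1), of j] by (simp add: sQ)
  have \<kappa>_shift: "\<kappa> (shift_by j a) = (CLINT x|Q. indicator (shift_by j -` W) x *\<^sub>R levy_kernel a x)"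
    if "a \<in> finitely_supported" for a j
    unfolding \<kappa>_def by (rule integral_levy_kernel_translate[OF mp sQ W(1) that])
  obtain G where G: "prob_space G" "sets G = sets seq_space"
    "\<And>a. a \<in> finitely_supported \<Longrightarrow> (CLINT x|G. iexp (pairing a x)) = exp (\<kappa> a)"
    using levy_law_weighted_exists[OF R, of "indicator W"] by (auto simp: \<kappa>_def)
  \<comment> \<open>The \<open>k\<close>-th root of the generator has the Levy measure of the
    generator divided by \<open>k\<close>.\<close>
  have "\<forall>k\<ge>1. \<exists>P. prob_space P \<and> sets P = sets seq_space \<and> (\<forall>a\<in>finitely_supported.
      (CLINT x|P. iexp (pairing a x)) = exp (\<kappa> a / of_nat k))"
  proof (intro allI impI)
    fix k :: nat assume k: "k \<ge> 1"
    have "(CLINT x|Q. (indicator W x / real k) *\<^sub>R levy_kernel a x) = \<kappa> a / of_nat k" for a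
    proof -
      have "(CLINT x|Q. (indicator W x / real k) *\<^sub>R levy_kernel a x) = (CLINT x|Q. (indicator W x *\<^sub>R levy_kernel a x) / of_nat k)"
        by (simp add: scaleR_conv_of_real)
      thus ?thesis by (simp add: \<kappa>_def)
    qed
    thus "\<exists>P. prob_space P \<and> sets P = sets seq_space \<and> (\<forall>a\<in>finitely_supported.
      (CLINT x|P. iexp (pairing a x)) = exp (\<kappa> a / of_nat k))"
      using levy_law_weighted_exists[OF R, of "\<lambda>x. indicator W x / real k"] k
      by (simp add: indicator_def)
  qed
  then obtain K where K: "\<And>k. k \<ge> 1 \<Longrightarrow> prob_space (K k)" "\<And>k. k \<ge> 1 \<Longrightarrow> sets (K k) = sets seq_space"
    "\<And>k a. k \<ge> 1 \<Longrightarrow> a \<in> finitely_supported \<Longrightarrow> (CLINT x|K k. iexp (pairing a x)) = exp (\<kappa> a / of_nat k)"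
    by metis
  have ID: "infinitely_divisible G"
    by (rule infinitely_divisible_if_roots[OF G(1,2) K(1,2)]) (auto simp: K(3) G(3) exp_of_nat_mult[symmetric])
  let ?N = "PiM (UNIV :: int set) (\<lambda>_. G)"
  have iid: "iid_processes ?N UNIV (\<lambda>i \<omega>. \<omega> i)" by (rule iid_processes_PiM) (use G in auto)
  interpret N: prob_space ?N using iid by (simp add: iid_processes_def)
  have ind: "N.indep_vars (\<lambda>_. seq_space) (\<lambda>i \<omega>. \<omega> i) UNIV" using iid by (simp add: iid_processes_def)
  have dist: "distr ?N seq_space (\<lambda>\<omega>. \<omega> j) = G" for j
    by (rule indep_coords_seq_space(2)) (use G in auto)
  have co[measurable]: "(\<lambda>\<omega>. \<omega> j) \<in> measurable ?N seq_space" for j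
    using ind by (simp add: N.indep_vars_def)
  have co2[measurable]: "(\<lambda>\<omega>. \<omega> j i) \<in> borel_measurable ?N" for j i
    using measurable_compose[OF co measurable_coord] .
  \<comment> \<open>\<open>h\<close> runs through either half of the lags. Its injectivity makes the
    terms belong to different copies, hence independent, and the corresponding translates of
    \<open>W\<close> disjoint.\<close>
  have half: "AE \<omega> in ?N. summable (\<lambda>k. \<omega> (n - h k) (h k))" if h: "inj h" for h :: "nat \<Rightarrow> int" and n
  proof (rule N.indep_series_converges_AE)
    have "inj (\<lambda>k. n - h k)" using h by (auto simp: inj_def)
    hence "N.indep_vars (\<lambda>_. seq_space) (\<lambda>k \<omega>. \<omega> (n - h k)) UNIV"
      by (intro N.indep_vars_inj_reindex[OF ind]) auto
    thus "N.indep_vars (\<lambda>_. borel) (\<lambda>k \<omega>. \<omega> (n - h k) (h k)) UNIV"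
      by (rule N.indep_vars_compose2[where Y = "\<lambda>k x. x (h k)"]) simp
    let ?a = "\<lambda>t i. t * unit_seq 0 i"
    have a: "?a t \<in> finitely_supported" for t
      using finitely_supported_lin[OF unit_seq_finitely_supported zero_finitely_supported, of t 0 0] by simp
    \<comment> \<open>A frequency at time \<open>m\<close> is a shift of the one at time 0, so all
      exponents become integrals of one kernel over disjoint translates of \<open>W\<close>.\<close>
    have eq: "(\<lambda>i. t * unit_seq m i) = shift_by (- m) (?a t)" for t m
      by (auto simp: shift_by_def unit_seq_def fun_eq_iff)
    show "char (distr ?N borel (\<lambda>\<omega>. \<omega> (n - h k) (h k))) t = exp (\<kappa> (shift_by (- h k) (?a t)))" for k t
      unfolding N.char_coord_eq[OF co] dist eq[of t "h k"] G(3)[OF finitely_supported_shift_by[OF a]] ..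
    show "summable (\<lambda>k. norm (\<kappa> (shift_by (- h k) (?a t))))" for t
      unfolding \<kappa>_shift[OF a]
    proof (rule summableI_nonneg_bounded[OF norm_ge_zero])
      show "(\<Sum>k<m. norm (CLINT x|Q. indicator (shift_by (- h k) -` W) x *\<^sub>R levy_kernel (?a t) x)) \<le> (LINT x|Q. norm (levy_kernel (?a t) x))" for m
      proof (rule sum_norm_integral_disjoint_le[OF integrable_levy_kernel[OF R a] T])
        show "disjoint_family (\<lambda>k. shift_by (- h k) -` W)"
          unfolding disjoint_family_on_def
        proof (intro ballI impI)
          fix k l :: nat assume "k \<noteq> l"
          hence "- h k \<noteq> - h l" using h by (auto dest: injD)
          thus "shift_by (- h k) -` W \<inter> shift_by (- h l) -` W = {}"
            using W(2) unfolding disjoint_family_on_def by blast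
        qed
      qed simp
    qed
  qed
  have bs: "AE \<omega> in ?N. bi_summable (\<lambda>k. \<omega> (n - k) k)" for n
  proof -
    have "inj int" "inj (\<lambda>k. - int k - 1)" by (auto simp: inj_def)
    from half[OF this(1), of n] half[OF this(2), of n] show ?thesis
      by eventually_elim (simp add: bi_summable_def)
  qed
  define P where "P = distr ?N seq_space (\<lambda>\<omega> n. bi_suminf (\<lambda>k. \<omega> (n - k) k))"
  have rep: "gma_representation ?N (\<lambda>i \<omega>. \<omega> i) P"
    using iid bs by (simp add: gma_representation_def P_def)
  have mS: "(\<lambda>\<omega> n. bi_suminf (\<lambda>k. \<omega> (n - k) k)) \<in> measurable ?N seq_space"
    by (rule measurable_into_seq_space) (simp add: bi_suminf_def borel_measurable_suminf)
  have "P = distr M seq_space X"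
  proof (rule char_functional_unique)
    show "prob_space P" unfolding P_def by (rule N.prob_space_distr[OF mS])
    show "prob_space (distr M seq_space X)"
      using st by (auto simp: stationary_process_def intro: prob_space.prob_space_distr)
    fix a assume a: "a \<in> finitely_supported"
    \<comment> \<open>The translates of \<open>W\<close> exhaust almost the whole space, so the
      exponents of the copies add up to that of \<open>X\<close>.\<close>
    have "(\<lambda>J. exp (\<Sum>j\<in>{- int J..int J}. CLINT x|Q. indicator (shift_by j -` W) x *\<^sub>R levy_kernel a x)) \<longlonglongrightarrow> exp (CLINT x|Q. levy_kernel a x)"
    proof (intro tendsto_intros sum_integral_disjoint_tendsto[OF integrable_levy_kernel[OF R a] T W(2)])
      show "AE x in Q. \<exists>N. \<forall>J\<ge>N. \<exists>j\<in>{- int J..int J}. x \<in> shift_by j -` W"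
        using W(3)
      proof eventually_elim
        case (elim x)
        then obtain n where n: "shift_by n x \<in> W" by blast
        have "\<exists>j\<in>{- int J..int J}. x \<in> shift_by j -` W" if "nat \<bar>n\<bar> \<le> J" for J
          using n that by (intro bexI[of _ n]) auto
        thus ?case by blast
      qed
    qed simp
    moreover have "(\<Prod>j\<in>{- int J..int J}. CLINT x|distr ?N seq_space (\<lambda>\<omega>. \<omega> 0). iexp (pairing (shift_by j a) x))
       = exp (\<Sum>j\<in>{- int J..int J}. CLINT x|Q. indicator (shift_by j -` W) x *\<^sub>R levy_kernel a x)" for J
      by (simp add: dist G(3)[OF finitely_supported_shift_by[OF a]] exp_sum \<kappa>_shift[OF a])
    ultimately have "(CLINT x|P. iexp (pairing a x)) = exp (CLINT x|Q. levy_kernel a x)"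
      using cf_gma_tendsto[OF rep a] LIMSEQ_unique by auto
    thus "(CLINT x|P. iexp (pairing a x)) = (CLINT x|distr M seq_space X. iexp (pairing a x))"
      by (simp add: cf_stationary_IDp_process[OF X a])
  qed (simp_all add: P_def)
  hence "is_gma_generator G (distr M seq_space X)"
    using is_gma_generatorI[OF rep] by (simp add: dist)
  thus ?thesis using st ID unfolding gma_with_ID_generator_def by blast
qed

theorem theorem6p2:
  fixes M :: "'a measure" and X :: "'a \<Rightarrow> int \<Rightarrow> real" and Q :: "(int \<Rightarrow> real) measure"
  assumes "stationary_IDp_process M X Q"
  shows "gma_with_ID_generator M X \<longleftrightarrow> dissipative Q shift"
  using dissipative_if_gma[OF assms] gma_if_dissipative[OF assms] by blast

end
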